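(* Let $\beta>0$, $d\ge1$ an integer, and $C>0$ such that $\mathcal P_S(\beta,d,C/2)$ is non-empty. Then there exists a finite constant $C_1=C_1(\beta,d,C)$ such that for any $\epsilon\in(0,1)$ there exist $\mu_\epsilon,\nu_\epsilon\in\mathcal P_S(\beta,d,C)$ with $\mathsf{TV}(\mu_\epsilon,\nu_\epsilon)/\epsilon\in(1/C_1,C_1)$ and $$\overline{d_H}(\mu_\epsilon,\nu_\epsilon)\le C_1\,\mathsf{TV}(\mu_\epsilon,\nu_\epsilon)^{\frac{2\beta+d+1}{2\beta}}\,\log\Big(3+\frac1{\mathsf{TV}(\mu_\epsilon,\nu_\epsilon)}\Big)^{d-1}.$$
   Context: $\mathbb B(0,1)$ is the closed Euclidean unit ball of $\mathbb R^d$. Fourier transform: $\widehat f(\omega)=\int_{\mathbb R^d}e^{-i\langle x,\omega\rangle}f(x)\,dx$. For $f\in L^2(\mathbb R^d)$, $\|f\|_{\beta,2}^2=\int_{\mathbb R^d}\|\omega\|^{2\beta}|\widehat f(\omega)|^2\,d\omega$. $\mathcal P_S(\beta,d,C)$ is the set of probability distributions on $\mathbb R^d$ supported in $\mathbb B(0,1)$ having a density $p\in L^2(\mathbb R^d)$ with $\|p\|_{\beta,2}<C$. $\mathsf{TV}(\mu,\nu)=\sup_{A}[\mu(A)-\nu(A)]$ over measurable sets. The perceptron discrepancy is $\overline{d_H}(\mu,\nu)=\sup_{v\in\mathbb R^d,\,b\in\mathbb R}\{\mu(\{x:x^\top v\ge b\})-\nu(\{x:x^\top v\ge b\})\}$.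 *)

theory Defs
  imports "HOL-Probability.Probability"
begin

definition fourier :: "('a::euclidean_space \<Rightarrow> real) \<Rightarrow> 'a \<Rightarrow> complex" where
  "fourier f \<omega> =
     (LINT x|lborel. exp (- \<i> * complex_of_real (x \<bullet> \<omega>)) * complex_of_real (f x))"

(* The integral defining the Fourier transform is meaningful for integrable f. This covers
   every use below: a square-integrable function supported in the unit ball is integrable. *)

definition sobolev_sq :: "real \<Rightarrow> ('a::euclidean_space \<Rightarrow> real) \<Rightarrow> ennreal" where
  "sobolev_sq \<beta> f =
     (\<integral>\<^sup>+ \<omega>. ennreal (norm \<omega> powr (2 * \<beta>) * (cmod (fourier f \<omega>))\<^sup>2) \<partial>lborel)"

(* The square root in [0, \<infinity>]; the value \<infinity> is treated separately because enn2real
   sends \<infinity> to 0. *)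

definition sobolev_norm :: "real \<Rightarrow> ('a::euclidean_space \<Rightarrow> real) \<Rightarrow> ennreal" where
  "sobolev_norm \<beta> f =
     (if sobolev_sq \<beta> f = \<infinity> then \<infinity> else ennreal (sqrt (enn2real (sobolev_sq \<beta> f))))"

definition smooth_densities :: "real \<Rightarrow> real \<Rightarrow> 'a::euclidean_space measure set" where
  "smooth_densities \<beta> C =
     {\<mu>. prob_space \<mu> \<and> sets \<mu> = sets borel \<and> (AE x in \<mu>. x \<in> cball 0 1) \<and>
         (\<exists>p :: 'a \<Rightarrow> real. p \<in> borel_measurable borel \<and> (\<forall>x. 0 \<le> p x) \<and>
            \<mu> = density lborel (\<lambda>x. ennreal (p x)) \<and>
            integrable lborel (\<lambda>x. (p x)\<^sup>2) \<and>
            sobolev_norm \<beta> p < ennreal C)}"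

(* For finite measures on the Borel sets the two suprema below range over bounded sets of
   reals, so the conditionally complete supremum is the genuine one. *)

definition TV :: "'a::euclidean_space measure \<Rightarrow> 'a measure \<Rightarrow> real" where
  "TV \<mu> \<nu> = (SUP A\<in>sets borel. measure \<mu> A - measure \<nu> A)"

definition perceptron_disc :: "'a::euclidean_space measure \<Rightarrow> 'a measure \<Rightarrow> real" where
  "perceptron_disc \<mu> \<nu> =
     (SUP (v, b)\<in>(UNIV :: ('a \<times> real) set).
        measure \<mu> {x. x \<bullet> v \<ge> b} - measure \<nu> {x. x \<bullet> v \<ge> b})"

end

theory Submission
  imports Defs
begin

text \<open>
  Mix a given density with a smooth bump and perturb the bump by a multiple of
  $f(x) = h'(x_1) \prod_{i \ge 2} g(x_i)$ oscillating at frequency $K \sim \epsilon^{-1/\beta}$.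
  Here $h$ is $K^{-1}$ times a cutoff times a wave of frequency $K$, and $g$ is a cutoff times
  $K^{-1/2}$ times a Rudin-Shapiro polynomial of degree $K$: it is bounded, it has $L^1$ norm of
  order one, and its Fourier transform has size $K^{-1/2}$, spread over all frequencies up to $K$.
  Thus the Fourier transform of $f$ lives essentially on a face of the cube of side $K$, and
  $\|f\|_{\beta,2} \lesssim K^\beta$.  Integrating $f$ over a half-space $x \cdot v \ge b$ first
  in $x_1$ leaves an average of $h$ along an affine function of the other coordinates.
  By Fourier inversion of $h$ this is at most
  $\|\hat h\|_1 \prod_{i \ge 2} \|\hat g\|_\infty \lesssim K^{-1} K^{-(d-1)/2} = K^{-(d+1)/2}$,
  uniformly in the half-space.  With amplitude $K^{-\beta}$ both measures stay
  in the Sobolev ball, the total variation is of order $K^{-\beta}$, and the discrepancy is of order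
  $K^{-\beta - (d+1)/2}$; the logarithmic factor enters only through being at least $1$.
\<close>

section \<open>Compactly supported cosine powers\<close>

text \<open>The integral of f over a half-space with normal v sees the Fourier transform of f only
  along the line through the origin in direction v, and gains one inverse power of the frequency. A
  single wave of frequency K would put all its energy on one such line and gain only K^{-1}.
  Spreading the energy over the roughly K^{d-1} unit cells of a face of the cube leaves amplitude
  K^{-(d-1)/2} in each of them. The obstacle is that a function spread out in frequency tends to
  concentrate in space: f must stay below a fixed bump, or the densities become negative, and its L1
  norm must not shrink, or the total variation is lost. Rudin-Shapiro coefficients meet both
  demands. The bump is mixed in because the given density may vanish anywhere; that its norm is
  below C/2 leaves room in the Sobolev ball. Finite smoothness of order above \<beta> is enough, so
  the cutoffs are powers of a cosine, whose transforms obey an explicit recursion.\<close>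

definition cosbump :: "real \<Rightarrow> nat \<Rightarrow> real \<Rightarrow> real" where
  "cosbump r N s = (if \<bar>s\<bar> \<le> r then cos (pi * s / (2 * r)) ^ N else 0)"

lemma cos_scaled_nonneg:
  assumes "0 < r" "\<bar>s\<bar> \<le> r"
  shows "0 \<le> cos (pi * s / (2 * r))"
proof (rule cos_ge_zero)
  show "- (pi / 2) \<le> pi * s / (2 * r)" "pi * s / (2 * r) \<le> pi / 2"
    using assms mult_left_mono[of "-r" s pi] mult_left_mono[of s r pi]
    by (auto simp: field_simps abs_le_iff)
qed

lemma cosbump_nonneg: "0 < r \<Longrightarrow> 0 \<le> cosbump r N s"
  by (simp add: cosbump_def cos_scaled_nonneg)

lemma cosbump_le_one: "0 < r \<Longrightarrow> cosbump r N s \<le> 1"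
  by (simp add: cosbump_def cos_scaled_nonneg power_le_one)

text \<open>Lets the single envelope of power \<open>N\<close> serve for the cutoff of power
  \<open>N + 2\<close>, for its derivative and for their modulations.\<close>

lemma cosbump_antimono: "0 < r \<Longrightarrow> N \<le> M \<Longrightarrow> cosbump r M s \<le> cosbump r N s"
  by (simp add: cosbump_def cos_scaled_nonneg power_decreasing)

lemma cosbump_eq_0: "0 < r \<Longrightarrow> 0 < N \<Longrightarrow> r \<le> \<bar>s\<bar> \<Longrightarrow> cosbump r N s = 0"
  by (auto simp: cosbump_def abs_if split: if_splits)

lemma cosbump_outside: "r < \<bar>s\<bar> \<Longrightarrow> cosbump r N s = 0"
  by (simp add: cosbump_def)

lemma cosbump_measurable [measurable]: "cosbump r N \<in> borel_measurable borel"
  unfolding cosbump_def[abs_def] by measurable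

lemma integrable_indicator_Icc: "integrable lborel (indicator {a..b} :: real \<Rightarrow> real)"
  by (rule integrable_real_indicator) (auto simp: emeasure_lborel_Icc_eq)

lemma integrable_supported:
  fixes f :: "real \<Rightarrow> real"
  assumes [measurable]: "f \<in> borel_measurable borel"
    and "\<And>s. \<bar>f s\<bar> \<le> B * indicator {-r..r} s"
  shows "integrable lborel f"
proof (rule Bochner_Integration.integrable_bound)
  show "integrable lborel (\<lambda>s. B * indicator {-r..r} s :: real)"
    using integrable_indicator_Icc by simp
  show "AE s in lborel. norm (f s) \<le> norm (B * indicator {-r..r} s)"
    using assms(2) by (auto intro!: AE_I2 order_trans[OF _ abs_ge_self])
qed simp

lemma cosbump_abs_le: "0 < r \<Longrightarrow> \<bar>cosbump r N s\<bar> \<le> 1 * indicator {-r..r} s"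
  using cosbump_nonneg[of r N s] cosbump_le_one[of r N s] cosbump_outside[of r s N]
  by (cases "\<bar>s\<bar> \<le> r") (auto simp: indicator_def abs_le_iff)

lemma cosbump_integrable: "0 < r \<Longrightarrow> integrable lborel (cosbump r N)"
  by (rule integrable_supported[OF _ cosbump_abs_le]) auto

text \<open>On the middle half of the support the cosine is at least cos(pi/4), which fits a box
  under the graph.\<close>

lemma cosbump_integral_pos:
  assumes r: "0 < r"
  shows "0 < (LINT s|lborel. cosbump r N s)"
proof -
  have "(LINT s|lborel. (sqrt 2 / 2) ^ N * indicator {-r/2..r/2} s) \<le> (LINT s|lborel. cosbump r N s)"
  proof (intro integral_mono cosbump_integrable r)
    fix s :: real
    show "(sqrt 2 / 2) ^ N * indicator {-r/2..r/2} s \<le> cosbump r N s"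
    proof (cases "s \<in> {-r/2..r/2}")
      case True
      then have s: "\<bar>s\<bar> \<le> r / 2" by auto
      have "cos (pi / 4) \<le> cos \<bar>pi * s / (2 * r)\<bar>"
        using s r by (intro cos_monotone_0_pi_le) (auto simp: field_simps abs_mult)
      then have "sqrt 2 / 2 \<le> cos (pi * s / (2 * r))" by (simp only: cos_45 cos_abs_real)
      then show ?thesis using True s r by (auto simp: cosbump_def intro!: power_mono)
    qed (simp add: cosbump_nonneg r)
  qed (use integrable_indicator_Icc in simp)
  moreover have "(LINT s|lborel. (sqrt 2 / 2) ^ N * indicator {-r/2..r/2} s :: real) > 0"
    using r by simp
  ultimately show ?thesis by linarith
qed

section \<open>Fourier transforms of integrable functions, and their decay for cosine powers\<close>

lemma of_real_has_vector_derivative: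
  "(f has_real_derivative D) F \<Longrightarrow> ((\<lambda>x. complex_of_real (f x)) has_vector_derivative of_real D) F"
  by (auto simp: has_real_derivative_iff_has_vector_derivative intro: has_vector_derivative_of_real)

lemma exp_i_has_vector_derivative:
  "((\<lambda>s::real. exp (- \<i> * complex_of_real (s * t))) has_vector_derivative
     (- \<i> * of_real t) * exp (- \<i> * complex_of_real (s * t))) (at s within A)"
proof -
  have "((\<lambda>z. exp (- \<i> * (z * of_real t))) has_field_derivative
     (- \<i> * of_real t) * exp (- \<i> * (of_real s * of_real t))) (at (of_real s))"
    by (auto intro!: derivative_eq_intros)
  from has_vector_derivative_real_field[OF this, of A] show ?thesis by simp
qed

lemma fourier_real: "fourier f \<tau> = (LINT s|lborel. exp (- \<i> * complex_of_real (s * \<tau>)) * complex_of_real (f s))" 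
  for f :: "real \<Rightarrow> real"
  by (simp add: fourier_def)

lemma fourier_integrand_integrable:
  fixes f :: "'a::euclidean_space \<Rightarrow> real"
  assumes "integrable lborel f"
  shows "integrable lborel (\<lambda>x. exp (- \<i> * complex_of_real (x \<bullet> \<omega>)) * complex_of_real (f x))"
proof (rule Bochner_Integration.integrable_bound[OF assms])
  have [measurable]: "f \<in> borel_measurable borel" using assms by auto
  show "(\<lambda>x. exp (- \<i> * complex_of_real (x \<bullet> \<omega>)) * complex_of_real (f x)) \<in> borel_measurable lborel"
    by measurable
qed (simp add: norm_mult)

lemma cmod_fourier_le:
  fixes f :: "'a::euclidean_space \<Rightarrow> real"
  assumes "integrable lborel f"
  shows "cmod (fourier f \<omega>) \<le> (LINT x|lborel. \<bar>f x\<bar>)"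
  unfolding fourier_def
  by (rule order_trans[OF integral_norm_bound]) (simp add: norm_mult)

text \<open>
  With $c = \cos(Ls)$ and $L = \pi / (2r)$, this integrates the derivative of
  $e^{-i \tau s} (i \tau c^{N+2} + (c^{N+2})')$, which vanishes at both ends of $[-r, r]$.
\<close>

lemma fourier_cosbump_rec:
  assumes r: "0 < r"
  defines "L \<equiv> pi / (2 * r)"
  shows "complex_of_real (\<tau>\<^sup>2 - (real (N + 2) * L)\<^sup>2) * fourier (cosbump r (N + 2)) \<tau> 
     + complex_of_real (real (N + 2) * real (N + 1) * L\<^sup>2) * fourier (cosbump r N) \<tau> = 0"
proof -
  let ?e = "\<lambda>s. exp (- \<i> * complex_of_real (s * \<tau>))"
  let ?c = "\<lambda>s. cos (L * s)"
  let ?d = "\<lambda>s. - (real (N+2) * L) * ?c s ^ (N + 1) * sin (L * s)"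
  let ?d2 = "\<lambda>s. real (N + 2) * real (N + 1) * L\<^sup>2 * ?c s ^ N - (real (N + 2) * L)\<^sup>2 * ?c s ^ (N + 2)"
  let ?F = "\<lambda>s. ?e s * (\<i> * of_real \<tau> * of_real (?c s ^ (N+2)) + of_real (?d s))"
  let ?f = "\<lambda>s. ?e s * (of_real (\<tau>\<^sup>2 - (real (N + 2) * L)\<^sup>2) * of_real (?c s ^ (N+2)) 
       + of_real (real (N + 2) * real (N + 1) * L\<^sup>2) * of_real (?c s ^ N))"
  have d1: "((\<lambda>s. ?c s ^ (N+2)) has_real_derivative ?d s) (at s within A)" for s A
    by (auto intro!: derivative_eq_intros simp del: power_Suc)
  have d2: "(?d has_real_derivative ?d2 s) (at s within A)" for s A
  proof -
    have "(?d has_real_derivative 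
       - (real (N+2) * L) * (real (N + 1) * ?c s ^ N * (- sin (L * s) * L)) * sin (L * s) +
       - (real (N+2) * L) * ?c s ^ (N + 1) * (cos (L * s) * L)) (at s within A)"
      by (rule derivative_eq_intros refl | simp add: algebra_simps del: power_Suc)+
    moreover have "- (real (N+2) * L) * (real (N + 1) * ?c s ^ N * (- sin (L * s) * L)) * sin (L * s) +
       - (real (N+2) * L) * ?c s ^ (N + 1) * (cos (L * s) * L) = 
       real (N+2) * L\<^sup>2 * ?c s ^ N * (real (N + 1) * (sin (L * s))\<^sup>2 - (cos (L * s))\<^sup>2)"
      by (simp add: algebra_simps power2_eq_square)
    moreover have "\<dots> = ?d2 s"
      unfolding sin_squared_eq by (simp add: algebra_simps power2_eq_square)
    ultimately show ?thesis by simp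
  qed
  have FTC: "(LINT s|lborel. indicator {-r..r} s *\<^sub>R ?f s) = ?F r - ?F (-r)"
  proof (rule integral_FTC_Icc)
    fix s assume "-r \<le> s" "s \<le> r"
    have "(?F has_vector_derivative (?e s * (\<i> * of_real \<tau> * of_real (?d s) + of_real (?d2 s)) + 
       (- \<i> * of_real \<tau>) * ?e s * (\<i> * of_real \<tau> * of_real (?c s ^ (N+2)) + of_real (?d s)))) (at s within {-r..r})"
      by (intro has_vector_derivative_mult exp_i_has_vector_derivative has_vector_derivative_add
          has_vector_derivative_mult_right of_real_has_vector_derivative d1 d2)
    then show "(?F has_vector_derivative ?f s) (at s within {-r..r})"
      by (rule back_subst[where P="\<lambda>d. (?F has_vector_derivative d) (at s within {-r..r})"]) 
        (simp add: algebra_simps power2_eq_square)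
  qed (use r in \<open>auto intro!: continuous_intros\<close>)
  have F0: "?F r = 0" "?F (-r) = 0" 
    using r by (auto simp: L_def)
  have "(LINT s|lborel. indicator {-r..r} s *\<^sub>R ?f s) =
    (LINT s|lborel. of_real (\<tau>\<^sup>2 - (real (N + 2) * L)\<^sup>2) * (?e s * of_real (cosbump r (N+2) s)) + 
       of_real (real (N + 2) * real (N + 1) * L\<^sup>2) * (?e s * of_real (cosbump r N s)))"
    by (intro Bochner_Integration.integral_cong) 
      (auto simp: cosbump_def indicator_def L_def algebra_simps)
  also have "\<dots> = complex_of_real (\<tau>\<^sup>2 - (real (N + 2) * L)\<^sup>2) * fourier (cosbump r (N + 2)) \<tau> 
     + complex_of_real (real (N + 2) * real (N + 1) * L\<^sup>2) * fourier (cosbump r N) \<tau>"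
    unfolding fourier_real using fourier_integrand_integrable[OF cosbump_integrable[OF r], where \<omega>=\<tau>]
    by (subst Bochner_Integration.integral_add) (auto simp del: of_real_mult simp: inner_real_def)
  finally show ?thesis using FTC F0 by simp
qed

text \<open>Each use of the recursion divides by a quantity of order \<tau> squared and raises the
  power of the cosine by two. The divisor can vanish only for bounded \<tau>, where the bound by the
  integral of the cutoff suffices.\<close>

lemma fourier_cosbump_decay:
  assumes r: "0 < r"
  shows "\<exists>C>0. \<forall>\<tau>. cmod (fourier (cosbump r (2 * k)) \<tau>) \<le> C / (1 + \<bar>\<tau>\<bar>) ^ (2 * k)"
proof (induction k)
  case 0
  show ?case
    using cmod_fourier_le[OF cosbump_integrable[OF r], of 0] cosbump_integral_pos[OF r, of 0]
    by (intro exI[of _ "LINT s|lborel. cosbump r 0 s"]) (auto simp: cosbump_nonneg[OF r])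
next
  case (Suc k)
  then obtain C where C: "C > 0" "\<And>\<tau>. cmod (fourier (cosbump r (2 * k)) \<tau>) \<le> C / (1 + \<bar>\<tau>\<bar>) ^ (2 * k)"
    by blast
  define N where "N = 2 * k"
  define L where "L = pi / (2 * r)"
  define F where "F = fourier (cosbump r (N+2))"
  define I where "I = (LINT s|lborel. cosbump r (N+2) s)"
  \<comment> \<open>Beyond \<open>R\<close>, \<bar>\<tau>\<bar> is at least twice
    \<open>real (N+2) * L\<close>, so the divisor is at least 3/4 of \<tau> squared; moreover
    \<bar>\<tau>\<bar> \<ge> 1, so \<tau> squared is at least a quarter of the square of
    \<open>1 + \<bar>\<tau>\<bar>\<close>. Together these give 3/16, whose inverse appears in
    \<open>D2\<close>.\<close>
  define R where "R = 1 + 2 * real (N+2) * L"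
  define D1 where "D1 = I * (1 + R) ^ (N+2)"
  define D2 where "D2 = 16 / 3 * (real (N+2) * real (N+1) * L\<^sup>2) * C"
  have L: "L > 0" using r by (simp add: L_def)
  have Ipos: "I > 0" unfolding I_def by (rule cosbump_integral_pos[OF r])
  have R: "R \<ge> 1" using L by (simp add: R_def)
  have D: "D1 > 0" "D2 > 0" using Ipos R L C by (auto simp: D1_def D2_def intro!: mult_pos_pos)
  have "cmod (F \<tau>) \<le> (D1 + D2) / (1 + \<bar>\<tau>\<bar>) ^ (N+2)" for \<tau>
  proof (cases "\<bar>\<tau>\<bar> \<le> R")
    case True
    have "cmod (F \<tau>) \<le> I"
      using cmod_fourier_le[OF cosbump_integrable[OF r], of "N+2" \<tau>] cosbump_nonneg[OF r]
      by (simp add: F_def I_def)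
    also have "\<dots> = I * (1 + R) ^ (N+2) / (1 + R) ^ (N+2)" using R by simp
    also have "\<dots> \<le> D1 / (1 + \<bar>\<tau>\<bar>) ^ (N+2)" 
      unfolding D1_def using True R Ipos by (intro divide_left_mono power_mono mult_pos_pos) auto
    also have "\<dots> \<le> (D1 + D2) / (1 + \<bar>\<tau>\<bar>) ^ (N+2)" using D by (intro divide_right_mono) auto
    finally show ?thesis .
  next
    case False
    have "2 * (real (N+2) * L) \<le> \<bar>\<tau>\<bar>" using False by (simp add: R_def algebra_simps)
    then have "(2 * (real (N+2) * L))\<^sup>2 \<le> \<bar>\<tau>\<bar>\<^sup>2" using L by (intro power_mono) auto
    moreover have "(2 * (real (N+2) * L))\<^sup>2 = 4 * (real (N+2) * L)\<^sup>2" by (simp add: power2_eq_square)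
    moreover have "(1 + \<bar>\<tau>\<bar>)\<^sup>2 \<le> (2 * \<bar>\<tau>\<bar>)\<^sup>2" using False R by (intro power_mono) auto
    moreover have "(2 * \<bar>\<tau>\<bar>)\<^sup>2 = 4 * \<tau>\<^sup>2" by (simp add: power2_eq_square)
    ultimately have big: "3 / 16 * (1 + \<bar>\<tau>\<bar>)\<^sup>2 \<le> \<tau>\<^sup>2 - (real (N+2) * L)\<^sup>2" 
      by simp
    have "complex_of_real (\<tau>\<^sup>2 - (real (N + 2) * L)\<^sup>2) * F \<tau> =
       - (complex_of_real (real (N + 2) * real (N + 1) * L\<^sup>2) * fourier (cosbump r N) \<tau>)"
      using fourier_cosbump_rec[OF r, of \<tau> N] unfolding F_def L_def[symmetric]
      by (simp only: eq_neg_iff_add_eq_0)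
    then have "cmod (complex_of_real (\<tau>\<^sup>2 - (real (N + 2) * L)\<^sup>2) * F \<tau>) =
       cmod (complex_of_real (real (N + 2) * real (N + 1) * L\<^sup>2) * fourier (cosbump r N) \<tau>)"
      by simp
    then have "\<bar>\<tau>\<^sup>2 - (real (N + 2) * L)\<^sup>2\<bar> * cmod (F \<tau>) = 
        (real (N + 2) * real (N + 1) * L\<^sup>2) * cmod (fourier (cosbump r N) \<tau>)"
      unfolding norm_mult norm_of_real by (simp add: abs_mult)
    then have "3 / 16 * (1 + \<bar>\<tau>\<bar>)\<^sup>2 * cmod (F \<tau>) \<le> 
        (real (N + 2) * real (N + 1) * L\<^sup>2) * cmod (fourier (cosbump r N) \<tau>)"
      using mult_right_mono[OF order_trans[OF big abs_ge_self], of "cmod (F \<tau>)"] by simp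
    also have "\<dots> \<le> (real (N + 2) * real (N + 1) * L\<^sup>2) * (C / (1 + \<bar>\<tau>\<bar>) ^ N)"
      using C(2)[of \<tau>] by (intro mult_left_mono) (auto simp: N_def)
    finally have "cmod (F \<tau>) * (1 + \<bar>\<tau>\<bar>)\<^sup>2 \<le> D2 / (1 + \<bar>\<tau>\<bar>) ^ N"
      by (simp add: D2_def field_simps)
    then have "cmod (F \<tau>) \<le> D2 / (1 + \<bar>\<tau>\<bar>) ^ N / (1 + \<bar>\<tau>\<bar>)\<^sup>2"
      by (subst pos_le_divide_eq) auto
    also have "\<dots> = D2 / (1 + \<bar>\<tau>\<bar>) ^ (N+2)" by (simp only: power_add divide_divide_eq_left)
    also have "\<dots> \<le> (D1 + D2) / (1 + \<bar>\<tau>\<bar>) ^ (N+2)" using D by (intro divide_right_mono) auto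
    finally show ?thesis .
  qed
  then show ?case using D by (intro exI[of _ "D1 + D2"]) (auto simp: F_def N_def)
qed

section \<open>Fourier inversion\<close>

lemma fourier_measurable [measurable]:
  fixes f :: "'a::euclidean_space \<Rightarrow> real"
  assumes [measurable]: "f \<in> borel_measurable borel"
  shows "fourier f \<in> borel_measurable borel"
proof -
  have "(\<lambda>\<omega>. (LINT x|lborel. exp (- \<i> * complex_of_real (x \<bullet> \<omega>)) * complex_of_real (f x))) \<in> borel_measurable lborel"
    by (rule sigma_finite_measure.borel_measurable_lebesgue_integral) 
      (auto intro: lborel.sigma_finite_measure_axioms)
  then show ?thesis by (simp add: fourier_def[abs_def])
qed

text \<open>The derivative of an exponential, written with the kernel of Levy's inversion formula;
  it is the pointwise limit needed when the interval in that formula shrinks to a point.\<close>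

lemma iexp_quotient_tendsto:
  assumes "t \<noteq> 0" and h: "h \<longlonglongrightarrow> 0" "\<And>n. h n > 0"
  shows "(\<lambda>n. (iexp (- (t * a)) - iexp (- (t * (a + h n)))) / (\<i> * t) / of_real (h n)) \<longlonglongrightarrow> iexp (- (t * a))"
proof -
  have "((\<lambda>z. exp (- (\<i> * of_real t * z))) has_field_derivative - (\<i> * of_real t) * exp (- (\<i> * of_real t * of_real a))) (at (of_real a))"
    by (auto intro!: derivative_eq_intros)
  then have "((\<lambda>k. (exp (- (\<i> * of_real t * (of_real a + k))) - exp (- (\<i> * of_real t * of_real a))) / k) \<longlongrightarrow> - (\<i> * of_real t) * exp (- (\<i> * of_real t * of_real a))) (at 0)"
    by (simp add: DERIV_def)
  moreover have "filterlim (\<lambda>n. complex_of_real (h n)) (at 0) sequentially"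
    using h tendsto_of_real[OF h(1), where 'a=complex] by (intro filterlim_atI) (auto simp: less_imp_neq[symmetric])
  ultimately have "(\<lambda>n. (exp (- (\<i> * of_real t * (of_real a + of_real (h n)))) - exp (- (\<i> * of_real t * of_real a))) / of_real (h n)) 
      \<longlonglongrightarrow> - (\<i> * of_real t) * exp (- (\<i> * of_real t * of_real a))"
    by (rule filterlim_compose)
  from tendsto_divide[OF tendsto_minus[OF this] tendsto_const, of "\<i> * of_real t"] assms(1)
  show ?thesis by (simp add: algebra_simps diff_divide_distrib)
qed

text \<open>After division by its integral, f is the density of a probability measure whose
  characteristic function is a reflected multiple of the Fourier transform. Levy's formula gives the
  mass of a short interval; dividing by the length and letting it tend to 0 recovers f by
  continuity, while integrability of the transform lets the limit pass under the integral on the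
  other side.\<close>

lemma fourier_inversion:
  fixes f :: "real \<Rightarrow> real"
  assumes cont: "continuous_on UNIV f" and nn: "\<And>s. 0 \<le> f s" and bd: "\<And>s. f s \<le> B"
    and int: "integrable lborel f" and Z: "0 < (LINT s|lborel. f s)"
    and fint: "integrable lborel (fourier f)"
  shows "complex_of_real (f s) = (LINT t|lborel. iexp (t * s) * fourier f t) / (2 * pi)"
proof -
  define Z where "Z = (LINT s|lborel. f s)"
  define M where "M = density lborel (\<lambda>s. ennreal (f s / Z))"
  have Zp: "Z > 0" using Z by (simp add: Z_def)
  have [measurable]: "f \<in> borel_measurable borel" using int by auto
  have "emeasure M (space M) = (\<integral>\<^sup>+s. ennreal (f s / Z) \<partial>lborel)"
    by (simp add: M_def emeasure_density)
  also have "\<dots> = ennreal (LINT s|lborel. f s / Z)"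
    using int nn Zp by (intro nn_integral_eq_integral) auto
  also have "\<dots> = 1" using Zp by (simp add: Z_def)
  finally interpret M: prob_space M by (intro prob_spaceI)
  interpret M: real_distribution M by unfold_locales (auto simp: M_def)
  have char: "char M t = fourier f (- t) / Z" for t
  proof -
    have "char M t = (LINT x|lborel. (f x / Z) *\<^sub>R iexp (t * x))"
      unfolding char_def M_def using nn Zp by (subst integral_density) auto
    also have "\<dots> = (LINT x|lborel. exp (- \<i> * complex_of_real (x * (- t))) * complex_of_real (f x) / Z)"
      by (intro Bochner_Integration.integral_cong) (auto simp: scaleR_conv_of_real mult.commute)
    finally show ?thesis by (simp add: fourier_real)
  qed
  have charint: "integrable lborel (char M)"
    unfolding char[abs_def] using fint by (intro integrable_divide) (simp add: lborel_integrable_real_affine_iff[of "-1" _ 0, simplified])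
  \<comment> \<open>Levy's formula asks for interval endpoints without mass.\<close>
  have point: "measure M {a} = 0" for a
  proof -
    have "emeasure M {a} = (\<integral>\<^sup>+s. ennreal (f s / Z) * indicator {a} s \<partial>lborel)"
      unfolding M_def by (subst emeasure_density) auto
    also have "\<dots> = (\<integral>\<^sup>+s. 0 \<partial>(lborel :: real measure))"
    proof (rule nn_integral_cong_AE)
      have "AE s in lborel. s \<noteq> a" by (rule AE_lborel_singleton)
      then show "AE s in lborel. ennreal (f s / Z) * indicator {a} s = 0" by eventually_elim simp
    qed
    finally show ?thesis by (simp add: measure_def)
  qed
  \<comment> \<open>Rescaling to the unit interval turns the quotient into a mean of f over
    shrinking intervals, to which dominated convergence applies with the constant bound
    \<open>B\<close>.\<close>
  have meas: "measure M {a<..a+h} / h = (LINT u|lborel. indicator {0<..1} u * f (a + h * u)) / Z" if "h > 0" for a h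
  proof -
    have "measure M {a<..a+h} = (LINT x|M. indicator {a<..a+h} x)"
      by (simp add: M_def)
    also have "\<dots> = (LINT x|lborel. f x / Z * indicator {a<..a+h} x)"
      unfolding M_def using nn Zp by (subst integral_density) auto
    also have "\<dots> = h * (LINT u|lborel. f (a + h * u) / Z * indicator {a<..a+h} (a + h * u))"
      using that by (subst lborel_integral_real_affine[of h _ a]) auto
    also have "(LINT u|lborel. f (a + h * u) / Z * indicator {a<..a+h} (a + h * u)) = (LINT u|lborel. (indicator {0<..1} u * f (a + h * u)) / Z)"
      using that by (intro Bochner_Integration.integral_cong) (auto simp: indicator_def zero_less_mult_iff)
    finally show ?thesis using that by simp
  qed
  define a where "a = s"
  define J where "J = (LINT t|lborel. iexp (t * s) * fourier f t)"
  define h where "h n = 1 / real (Suc n)" for n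
  have h: "h \<longlonglongrightarrow> 0" "\<And>n. h n > 0"
    using LIMSEQ_inverse_real_of_nat by (auto simp: h_def[abs_def] inverse_eq_divide)
  let ?D = "\<lambda>b t. (iexp (- (t * a)) - iexp (- (t * b))) / (\<i> * t)"
  \<comment> \<open>At t = 0 the quotient is 0 by the convention for division, so the bound holds
    there too.\<close>
  have Dbd: "cmod (?D b t) \<le> b - a" if "a \<le> b" for b t
    using Levy_Inversion_aux2[of "-b" "-a" t] that by (cases "t = 0") auto
  \<comment> \<open>Levy's formula is a limit over the intervals from -T to T; since the
    characteristic function is integrable, the limit is the integral over the whole line.\<close>
  have levy: "complex_of_real (measure M {a<..b}) = (LINT t|lborel. ?D b t * char M t) / (2 * pi)" if "a \<le> b" for b
  proof -
    have "(\<lambda>T::nat. LINT t|lborel. indicator {- real T<..<real T} t *\<^sub>R (?D b t * char M t)) \<longlonglongrightarrow> (LINT t|lborel. ?D b t * char M t)"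
    proof (rule integral_dominated_convergence)
      show "integrable lborel (\<lambda>t. (b - a) * cmod (char M t))"
        using charint by auto
      show "AE t in lborel. (\<lambda>T. indicator {- real T<..<real T} t *\<^sub>R (?D b t * char M t)) \<longlonglongrightarrow> ?D b t * char M t"
      proof (rule AE_I2)
        fix t :: real
        obtain N :: nat where "\<bar>t\<bar> < N" using reals_Archimedean2 by blast
        then have "\<forall>\<^sub>F T in sequentially. ?D b t * char M t = indicator {- real T<..<real T} t *\<^sub>R (?D b t * char M t)"
          by (intro eventually_sequentiallyI[of N]) (auto simp: indicator_def)
        from tendsto_eventually[OF eventually_mono[OF this]] 
        show "(\<lambda>T. indicator {- real T<..<real T} t *\<^sub>R (?D b t * char M t)) \<longlonglongrightarrow> ?D b t * char M t"
          by (simp add: eq_commute)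
      qed
      show "AE t in lborel. norm (indicator {- real T<..<real T} t *\<^sub>R (?D b t * char M t)) \<le> (b - a) * cmod (char M t)" for T
        using Dbd[OF that] that by (intro AE_I2) (auto simp: indicator_def norm_mult intro!: mult_right_mono simp del: norm_divide times_divide_eq_left)
    qed measurable
    moreover have "(CLBINT t=-real T..real T. ?D b t * char M t) = (LINT t|lborel. indicator {- real T<..<real T} t *\<^sub>R (?D b t * char M t))" for T
      by (simp add: interval_lebesgue_integral_def set_lebesgue_integral_def)
    ultimately have "(\<lambda>T::nat. 1 / (2 * pi) * (CLBINT t=-real T..real T. ?D b t * char M t)) \<longlonglongrightarrow> 1 / (2 * pi) * (LINT t|lborel. ?D b t * char M t)"
      by (intro tendsto_mult tendsto_const) auto
    moreover have "(\<lambda>T::nat. 1 / (2 * pi) * (CLBINT t=-real T..real T. ?D b t * char M t)) \<longlonglongrightarrow> measure M {a<..b}"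
      using M.Levy_Inversion[OF that point point] by (simp only: of_int_minus of_int_of_nat_eq)
    ultimately have "1 / (2 * pi) * (LINT t|lborel. ?D b t * char M t) = complex_of_real (measure M {a<..b})"
      using LIMSEQ_unique by blast
    from this[symmetric]
    show ?thesis by simp
  qed
  have "(\<lambda>n. LINT t|lborel. (?D (a + h n) t / of_real (h n)) * char M t) \<longlonglongrightarrow> (LINT t|lborel. iexp (- (t * a)) * char M t)"
  proof (rule integral_dominated_convergence)
    show "integrable lborel (\<lambda>t. cmod (char M t))" using charint by auto
    show "AE t in lborel. (\<lambda>n. (?D (a + h n) t / of_real (h n)) * char M t) \<longlonglongrightarrow> iexp (- (t * a)) * char M t"
      using AE_lborel_singleton[of 0]
      by eventually_elim (intro tendsto_mult tendsto_const iexp_quotient_tendsto h)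
    show "AE t in lborel. norm ((?D (a + h n) t / of_real (h n)) * char M t) \<le> cmod (char M t)" for n
    proof (rule AE_I2)
      fix t
      have "cmod (?D (a + h n) t / of_real (h n)) \<le> 1"
        unfolding norm_divide[of _ "of_real (h n)"] using Dbd[of "a + h n" t] h(2)[of n] by (simp add: divide_le_eq_1)
      from mult_right_mono[OF this norm_ge_zero, of "char M t"]
      show "norm ((?D (a + h n) t / of_real (h n)) * char M t) \<le> cmod (char M t)" by (simp only: norm_mult mult_1)
    qed
  qed measurable
  then have lim1: "(\<lambda>n. (LINT t|lborel. (?D (a + h n) t / of_real (h n)) * char M t) / (2 * pi)) \<longlonglongrightarrow> (LINT t|lborel. iexp (- (t * a)) * char M t) / (2 * pi)"
    by (intro tendsto_divide tendsto_const) auto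
  have eq: "(LINT t|lborel. (?D (a + h n) t / of_real (h n)) * char M t) / (2 * pi) = complex_of_real (measure M {a<..a+h n} / h n)" for n
  proof -
    have "(LINT t|lborel. (?D (a + h n) t / of_real (h n)) * char M t) = (LINT t|lborel. ?D (a + h n) t * char M t) / of_real (h n)"
      unfolding times_divide_eq_left[of _ "of_real (h n)"] by (rule integral_divide_zero)
    then show ?thesis using levy[of "a + h n"] h(2)[of n] by simp
  qed
  have "(\<lambda>n. LINT u|lborel. indicator {0<..1} u * f (a + h n * u)) \<longlonglongrightarrow> (LINT u|lborel. indicator {0<..1::real} u * f a)"
  proof (rule integral_dominated_convergence)
    show "integrable lborel (\<lambda>u. B * indicator {0..1::real} u :: real)" 
      using integrable_indicator_Icc by simp
    show "AE u in lborel. (\<lambda>n. indicator {0<..1} u * f (a + h n * u)) \<longlonglongrightarrow> indicator {0<..1} u * f a"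
    proof (rule AE_I2)
      fix u
      have "(\<lambda>n. a + h n * u) \<longlonglongrightarrow> a + 0 * u" by (intro tendsto_intros h)
      moreover have "isCont f a" using cont by (simp add: continuous_on_eq_continuous_at)
      ultimately have "(\<lambda>n. f (a + h n * u)) \<longlonglongrightarrow> f a" by (auto intro: isCont_tendsto_compose)
      then show "(\<lambda>n. indicator {0<..1} u * f (a + h n * u)) \<longlonglongrightarrow> indicator {0<..1} u * f a" by (intro tendsto_intros)
    qed
    show "AE u in lborel. norm (indicator {0<..1} u * f (a + h n * u)) \<le> B * indicator {0..1::real} u" for n
      using nn bd order_trans[OF nn bd] by (intro AE_I2) (auto simp: indicator_def)
  qed auto
  then have "(\<lambda>n. complex_of_real (measure M {a<..a+h n} / h n)) \<longlonglongrightarrow> of_real ((LINT u|lborel. indicator {0<..1::real} u * f a) / Z)"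
    unfolding meas[OF h(2)] using Zp by (intro tendsto_of_real tendsto_divide tendsto_const) auto
  then have "complex_of_real (f a / Z) = (LINT t|lborel. iexp (- (t * a)) * char M t) / (2 * pi)"
    using LIMSEQ_unique lim1 unfolding eq by simp
  also have "(LINT t|lborel. iexp (- (t * a)) * char M t) = (LINT t|lborel. iexp (t * a) * char M (-t))"
    by (subst lborel_integral_real_affine[of "-1" _ 0]) auto
  also have "\<dots> = (LINT t|lborel. iexp (t * s) * fourier f t) / Z"
    by (simp add: char a_def)
  finally have eq: "complex_of_real (f s / Z) = J / Z / (2 * pi)" by (simp add: a_def J_def)
  then show ?thesis using Zp unfolding J_def[symmetric] by (simp add: field_simps)
qed

section \<open>Quadratic decay: integrals and sums over integer shifts\<close>

lemma lborel_integrable_inverse_1_plus_square: "integrable lborel (\<lambda>x::real. inverse (1 + x\<^sup>2))"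
  using integrable_inverse_1_plus_square by (simp add: set_integrable_def)

lemma integrable_decay: "integrable lborel (\<lambda>x::real. 1 / (1 + \<bar>x\<bar>)\<^sup>2)"
proof (rule Bochner_Integration.integrable_bound[OF lborel_integrable_inverse_1_plus_square])
  show "AE x in lborel. norm (1 / (1 + \<bar>x\<bar>)\<^sup>2) \<le> norm (inverse (1 + (x::real)\<^sup>2))"
  proof (rule AE_I2)
    fix x :: real
    have "1 + x\<^sup>2 \<le> (1 + \<bar>x\<bar>)\<^sup>2" by (simp add: power2_sum)
    then show "norm (1 / (1 + \<bar>x\<bar>)\<^sup>2) \<le> norm (inverse (1 + x\<^sup>2))"
      by (simp add: inverse_eq_divide frac_le add_pos_nonneg)
  qed
qed simp

text \<open>By the mean value theorem each term is at most twice the increment of the arctangent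
  over a unit interval, and these increments telescope. Hence the bound depends neither on the
  number of shifts nor on \<tau>.\<close>

lemma sum_decay_le:
  fixes \<tau> :: real
  shows "(\<Sum>k<n. 1 / (1 + \<bar>\<tau> - real k\<bar>)\<^sup>2) \<le> 2 * pi"
proof -
  have step: "1 / (1 + \<bar>y\<bar>)\<^sup>2 \<le> 2 * (arctan (y + 1) - arctan y)" for y :: real
  proof -
    obtain z where z: "y < z" "z < y + 1" "arctan (y + 1) - arctan y = (y + 1 - y) * inverse (1 + z\<^sup>2)"
      using MVT2[of y "y + 1" arctan "\<lambda>x. inverse (1 + x\<^sup>2)"] DERIV_arctan by auto
    have "\<bar>z\<bar> \<le> 1 + \<bar>y\<bar>" using z by auto
    then have "z\<^sup>2 \<le> (1 + \<bar>y\<bar>)\<^sup>2" by (metis abs_ge_zero power2_abs power_mono)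
    moreover have "1 \<le> (1 + \<bar>y\<bar>)\<^sup>2" by simp
    ultimately have "1 + z\<^sup>2 \<le> 2 * (1 + \<bar>y\<bar>)\<^sup>2" by linarith
    then have "1 / (2 * (1 + \<bar>y\<bar>)\<^sup>2) \<le> inverse (1 + z\<^sup>2)"
      unfolding inverse_eq_divide by (intro divide_left_mono) (auto intro!: mult_pos_pos add_pos_nonneg)
    then show ?thesis using z(3) by simp
  qed
  have "(\<Sum>k<n. 1 / (1 + \<bar>\<tau> - real k\<bar>)\<^sup>2) \<le> (\<Sum>k<n. 2 * (arctan (real (Suc k) - \<tau>) - arctan (real k - \<tau>)))"
    using step[of "real _ - \<tau>"] by (intro sum_mono) (simp add: abs_minus_commute algebra_simps)
  also have "\<dots> = 2 * (arctan (real n - \<tau>) - arctan (- \<tau>))"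
    unfolding sum_distrib_left[symmetric] by (subst sum_lessThan_telescope) simp
  also have "\<dots> \<le> 2 * pi" using arctan_bounded[of "real n - \<tau>"] arctan_bounded[of "- \<tau>"] by simp
  finally show ?thesis .
qed

section \<open>Rudin-Shapiro polynomials\<close>

text \<open>Complex coefficients let one definition cover both phases: a common factor
  \<open>-\<i>\<close> replaces real part by imaginary part, that is, cosines by sines.\<close>

definition trig :: "nat set \<Rightarrow> (nat \<Rightarrow> complex) \<Rightarrow> real \<Rightarrow> real" where
  "trig S z s = Re (\<Sum>k\<in>S. z k * iexp (real k * s))"

lemma trig_measurable [measurable]: "trig S z \<in> borel_measurable borel"
  unfolding trig_def[abs_def] by measurable

lemma abs_trig_le: "\<bar>trig S z s\<bar> \<le> (\<Sum>k\<in>S. cmod (z k))"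
proof -
  have "\<bar>trig S z s\<bar> \<le> cmod (\<Sum>k\<in>S. z k * iexp (real k * s))"
    unfolding trig_def by (rule abs_Re_le_cmod)
  also have "\<dots> \<le> (\<Sum>k\<in>S. cmod (z k))"
    by (rule sum_norm_le) (simp add: norm_mult)
  finally show ?thesis .
qed

lemma integrable_trig_mult:
  assumes "integrable lborel f"
  shows "integrable lborel (\<lambda>s. trig S z s * f s)"
proof (rule Bochner_Integration.integrable_bound)
  show "integrable lborel (\<lambda>s. (\<Sum>k\<in>S. cmod (z k)) * f s)" using assms by simp
  have [measurable]: "f \<in> borel_measurable borel" using assms by auto
  show "(\<lambda>s. trig S z s * f s) \<in> borel_measurable lborel" by measurable
  show "AE s in lborel. norm (trig S z s * f s) \<le> norm ((\<Sum>k\<in>S. cmod (z k)) * f s)"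
    using order_trans[OF abs_trig_le abs_ge_self] by (intro AE_I2) (simp add: abs_mult mult_right_mono)
qed

text \<open>A real part is half the sum of a number and its conjugate, so each frequency shifts the
  transform of f once in either direction.\<close>

lemma fourier_trig_mult:
  assumes f: "integrable lborel f" and S: "finite S"
  shows "fourier (\<lambda>s. trig S z s * f s) \<tau> =
    (\<Sum>k\<in>S. (z k * fourier f (\<tau> - real k) + cnj (z k) * fourier f (\<tau> + real k)) / 2)"
proof -
  let ?e = "\<lambda>\<tau> s. exp (- \<i> * complex_of_real (s * \<tau>))"
  have eq: "?e \<tau> s * complex_of_real (trig S z s * f s) =
     (\<Sum>k\<in>S. (z k * (?e (\<tau> - real k) s * of_real (f s)) + cnj (z k) * (?e (\<tau> + real k) s * of_real (f s))) / 2)" for s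
  proof -
    have 1: "?e (\<tau> - real k) s = ?e \<tau> s * iexp (real k * s)" for k
      by (simp add: exp_add[symmetric] algebra_simps)
    have 2: "?e (\<tau> + real k) s = ?e \<tau> s * cnj (iexp (real k * s))" for k
      by (simp add: exp_cnj exp_add[symmetric] algebra_simps)
    have "complex_of_real (trig S z s) = (\<Sum>k\<in>S. (z k * iexp (real k * s) + cnj (z k * iexp (real k * s))) / 2)"
      unfolding trig_def Re_sum of_real_sum by (intro sum.cong refl) (simp only: complex_add_cnj, simp)
    then show ?thesis unfolding 1 2
      by (simp add: sum_distrib_left sum_distrib_right algebra_simps add_divide_distrib)
  qed
  let ?F = "\<lambda>\<tau> s. ?e \<tau> s * complex_of_real (f s)"
  have int: "integrable lborel (\<lambda>s. c * ?F \<tau> s)" for c \<tau>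
    using fourier_integrand_integrable[OF f, unfolded inner_real_def] by (rule integrable_mult_right)
  have "fourier (\<lambda>s. trig S z s * f s) \<tau> = 
      (\<Sum>k\<in>S. (LINT s|lborel. (z k * ?F (\<tau> - real k) s + cnj (z k) * ?F (\<tau> + real k) s) / 2))"
    unfolding fourier_real eq 
    by (intro Bochner_Integration.integral_sum integrable_divide Bochner_Integration.integrable_add int)
  also have "\<dots> = (\<Sum>k\<in>S. (z k * fourier f (\<tau> - real k) + cnj (z k) * fourier f (\<tau> + real k)) / 2)"
    unfolding integral_divide_zero Bochner_Integration.integral_add[OF int int] integral_mult_right_zero fourier_real ..
  finally show ?thesis .
qed

text \<open>From a pair P, Q of length 2^n, the next pair is P plus and minus the wave of frequency
  2^n times Q. By the parallelogram law the sum of the squared moduli doubles, and so remains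
  constant in s. Thus both polynomials have the size of their root mean square everywhere, up to a
  constant.\<close>

lemma rudin_shapiro:
  "\<exists>p q :: nat \<Rightarrow> real. (\<forall>k. \<bar>p k\<bar> \<le> 1 \<and> \<bar>q k\<bar> \<le> 1) \<and>
     (\<forall>s. (cmod (\<Sum>k<2^n. of_real (p k) * iexp (real k * s)))\<^sup>2 + 
          (cmod (\<Sum>k<2^n. of_real (q k) * iexp (real k * s)))\<^sup>2 = 2 * 2 ^ n)"
proof (induction n)
  case 0
  show ?case by (intro exI[of _ "\<lambda>_. 1"]) simp
next
  case (Suc n)
  then obtain p q :: "nat \<Rightarrow> real" where pq: "\<And>k. \<bar>p k\<bar> \<le> 1 \<and> \<bar>q k\<bar> \<le> 1"
    "\<And>s. (cmod (\<Sum>k<2^n. of_real (p k) * iexp (real k * s)))\<^sup>2 + 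
          (cmod (\<Sum>k<2^n. of_real (q k) * iexp (real k * s)))\<^sup>2 = 2 * 2 ^ n" by blast
  \<comment> \<open>The coefficients of \<open>q\<close> are appended to those of \<open>p\<close>
    with sign \<open>c\<close>; \<open>P 1\<close> and \<open>P (-1)\<close> form the next
    pair.\<close>
  define P where "P c k = (if k < 2^n then p k else c * q (k - 2^n))" for c k
  have split: "(\<Sum>k<2^Suc n. of_real (P c k) * iexp (real k * s)) = 
     (\<Sum>k<2^n. of_real (p k) * iexp (real k * s)) +
     of_real c * iexp (2 ^ n * s) * (\<Sum>k<2^n. of_real (q k) * iexp (real k * s))" for c s
  proof -
    have "(\<Sum>k<2^n + 2^n. of_real (P c k) * iexp (real k * s)) = 
       (\<Sum>k<2^n. of_real (P c k) * iexp (real k * s)) + 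
       (\<Sum>k<2^n. of_real (P c (2^n + k)) * iexp (real (2^n + k) * s))"
      using sum.nat_group[of "\<lambda>k. of_real (P c k) * iexp (real k * s)" "2^n" 2]
      by (simp add: lessThan_atLeast0 sum.atLeastLessThan_concat[of 0 "2^n" "2^n + 2^n", symmetric]
          sum.shift_bounds_nat_ivl[of _ 0 "2^n" "2^n", simplified] add.commute)
    also have "(\<Sum>k<2^n. of_real (P c k) * iexp (real k * s)) = (\<Sum>k<2^n. of_real (p k) * iexp (real k * s))"
      by (intro sum.cong) (auto simp: P_def)
    also have "(\<Sum>k<2^n. of_real (P c (2^n + k)) * iexp (real (2^n + k) * s)) =
      of_real c * iexp (2 ^ n * s) * (\<Sum>k<2^n. of_real (q k) * iexp (real k * s))"
      unfolding sum_distrib_left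
      by (intro sum.cong refl) (auto simp: P_def algebra_simps exp_add)
    finally show ?thesis by (simp add: mult_2)
  qed
  have par: "(cmod (a + b))\<^sup>2 + (cmod (a - b))\<^sup>2 = 2 * ((cmod a)\<^sup>2 + (cmod b)\<^sup>2)" for a b :: complex
    unfolding cmod_power2 by (simp add: power2_eq_square algebra_simps)
  have "(\<forall>k. \<bar>P 1 k\<bar> \<le> 1 \<and> \<bar>P (-1) k\<bar> \<le> 1)" using pq(1) by (auto simp: P_def)
  moreover have "(cmod (\<Sum>k<2^Suc n. of_real (P 1 k) * iexp (real k * s)))\<^sup>2 + 
          (cmod (\<Sum>k<2^Suc n. of_real (P (-1) k) * iexp (real k * s)))\<^sup>2 = 2 * 2 ^ Suc n" for s
    unfolding split using par[of "\<Sum>k<2^n. of_real (p k) * iexp (real k * s)" 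
        "iexp (2 ^ n * s) * (\<Sum>k<2^n. of_real (q k) * iexp (real k * s))"] pq(2)[of s]
    by (simp add: norm_mult)
  ultimately show ?case by blast
qed

text \<open>
  The squares of the real and imaginary parts of the Rudin-Shapiro pair add up to the constant
  $2^{n+1}$, so one of these four functions carries at least a quarter of the weighted mass;
  this replaces an orthogonality argument.
\<close>

lemma flat_trig_exists:
  assumes f: "integrable lborel f" "\<And>s. 0 \<le> f s"
  shows "\<exists>z. (\<forall>k. cmod (z k) \<le> 1) \<and> (\<forall>s. (trig {..<2^n} z s)\<^sup>2 \<le> 2 * 2 ^ n) \<and>
    2 ^ n / 2 * (LINT s|lborel. f s) \<le> (LINT s|lborel. (trig {..<2^n} z s)\<^sup>2 * f s)"
proof -
  obtain p q :: "nat \<Rightarrow> real" where pq: "\<And>k. \<bar>p k\<bar> \<le> 1" "\<And>k. \<bar>q k\<bar> \<le> 1"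
    "\<And>s. (cmod (\<Sum>k<2^n. of_real (p k) * iexp (real k * s)))\<^sup>2 + 
          (cmod (\<Sum>k<2^n. of_real (q k) * iexp (real k * s)))\<^sup>2 = 2 * 2 ^ n"
    using rudin_shapiro[of n] by blast
  define z where "z c r = (\<lambda>k. c * complex_of_real (r k))" for c and r :: "nat \<Rightarrow> real"
  let ?T = "\<lambda>c r s. trig {..<2^n} (z c r) s"
  have T: "?T c r s = Re (c * (\<Sum>k<2^n. of_real (r k) * iexp (real k * s)))" for c r s
    by (simp add: trig_def z_def sum_distrib_left mult.assoc)
  have sum4: "(?T 1 p s)\<^sup>2 + (?T (-\<i>) p s)\<^sup>2 + (?T 1 q s)\<^sup>2 + (?T (-\<i>) q s)\<^sup>2 = 2 * 2 ^ n" for s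
    unfolding T using pq(3)[of s] by (simp add: cmod_power2 add.assoc)
  define A where "A c r = (LINT s|lborel. (?T c r s)\<^sup>2 * f s)" for c r
  have int: "integrable lborel (\<lambda>s. (?T c r s)\<^sup>2 * f s)" for c r
    using integrable_trig_mult[OF integrable_trig_mult[OF f(1)], of _ "z c r" _ "z c r"]
    by (simp add: power2_eq_square mult.assoc)
  have "A 1 p + A (-\<i>) p + A 1 q + A (-\<i>) q = 
     (LINT s|lborel. (?T 1 p s)\<^sup>2 * f s + (?T (-\<i>) p s)\<^sup>2 * f s + (?T 1 q s)\<^sup>2 * f s + (?T (-\<i>) q s)\<^sup>2 * f s)"
    unfolding A_def using int by (simp del: z_def)
  also have "\<dots> = (LINT s|lborel. 2 * 2 ^ n * f s)"
    unfolding distrib_right[symmetric] sum4 ..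
  finally have "A 1 p + A (-\<i>) p + A 1 q + A (-\<i>) q = 4 * (2 ^ n / 2 * (LINT s|lborel. f s))" by simp
  then consider "A 1 p \<ge> 2 ^ n / 2 * (LINT s|lborel. f s)" | "A (-\<i>) p \<ge> 2 ^ n / 2 * (LINT s|lborel. f s)"
   | "A 1 q \<ge> 2 ^ n / 2 * (LINT s|lborel. f s)" | "A (-\<i>) q \<ge> 2 ^ n / 2 * (LINT s|lborel. f s)"
    by argo
  then obtain c r where cr: "c \<in> {1, -\<i>}" "r \<in> {p, q}" "A c r \<ge> 2 ^ n / 2 * (LINT s|lborel. f s)"
    by cases blast+
  have "cmod (z c r k) \<le> 1" for k using cr(1,2) pq(1,2) by (auto simp: z_def norm_mult)
  moreover have "(?T c r s)\<^sup>2 \<le> 2 * 2 ^ n" for s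
  proof -
    have "0 \<le> (?T c' r' s)\<^sup>2" for c' r' by simp
    from this[of 1 p] this[of "-\<i>" p] this[of 1 q] this[of "-\<i>" q] sum4[of s]
    have "(?T 1 p s)\<^sup>2 \<le> 2 * 2 ^ n \<and> (?T (-\<i>) p s)\<^sup>2 \<le> 2 * 2 ^ n \<and> (?T 1 q s)\<^sup>2 \<le> 2 * 2 ^ n \<and> (?T (-\<i>) q s)\<^sup>2 \<le> 2 * 2 ^ n"
      by linarith
    then show ?thesis using cr(1,2) by blast
  qed
  ultimately show ?thesis using cr(3) unfolding A_def by blast
qed

text \<open>Decay around a frequency of modulus at most K is decay in \<tau> at scale K, at the cost
  of a factor 2 that is independent of K.\<close>

lemma peetre_inequality:
  fixes \<tau> k K :: real
  assumes "0 \<le> k" "k \<le> K" "1 \<le> K"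
  shows "1 + \<bar>\<tau>\<bar> / K \<le> 2 * (1 + \<bar>\<tau> - k\<bar>)" "1 + \<bar>\<tau>\<bar> / K \<le> 2 * (1 + \<bar>\<tau> + k\<bar>)"
proof -
  have *: "1 + \<bar>\<tau>\<bar> / K \<le> 2 * (1 + y)" if "\<bar>\<tau>\<bar> \<le> k + y" "0 \<le> y" for y
  proof -
    have "\<bar>\<tau>\<bar> \<le> K + K * y" using that assms mult_right_mono[of 1 K y] by linarith
    then have "\<bar>\<tau>\<bar> / K \<le> 1 + y" using assms by (simp add: divide_le_eq algebra_simps)
    then show ?thesis using that by simp
  qed
  show "1 + \<bar>\<tau>\<bar> / K \<le> 2 * (1 + \<bar>\<tau> - k\<bar>)" "1 + \<bar>\<tau>\<bar> / K \<le> 2 * (1 + \<bar>\<tau> + k\<bar>)"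
    using assms by (intro *; linarith)+
qed

text \<open>Of the m + 2 available powers, m are traded for decay in y, which will be 1 +
  \<bar>\<tau>\<bar>/K; the remaining two keep sums over shifts and integrals finite.\<close>

lemma decay_split:
  fixes x y C :: real
  assumes "0 < y" "y \<le> 2 * (1 + \<bar>x\<bar>)" "0 \<le> C"
  shows "C / (1 + \<bar>x\<bar>) ^ (m + 2) \<le> C * 2 ^ m / y ^ m * (1 / (1 + \<bar>x\<bar>)\<^sup>2)"
proof -
  have "y ^ m \<le> 2 ^ m * (1 + \<bar>x\<bar>) ^ m"
    using power_mono[OF assms(2), of m] assms(1) by (simp only: power_mult_distrib less_imp_le)
  then have "1 / (1 + \<bar>x\<bar>) ^ m \<le> 2 ^ m / y ^ m"
    using assms(1) by (simp add: field_simps)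
  then have "1 / (1 + \<bar>x\<bar>) ^ m * (C / (1 + \<bar>x\<bar>)\<^sup>2) \<le> 2 ^ m / y ^ m * (C / (1 + \<bar>x\<bar>)\<^sup>2)"
    using assms(3) by (intro mult_right_mono) auto
  moreover have "C / (1 + \<bar>x\<bar>) ^ (m + 2) = 1 / (1 + \<bar>x\<bar>) ^ m * (C / (1 + \<bar>x\<bar>)\<^sup>2)"
    by (simp only: power_add times_divide_times_eq mult_1)
  moreover have "C * 2 ^ m / y ^ m * (1 / (1 + \<bar>x\<bar>)\<^sup>2) = 2 ^ m / y ^ m * (C / (1 + \<bar>x\<bar>)\<^sup>2)"
    by (simp add: mult_ac)
  ultimately show ?thesis by (simp only:)
qed

text \<open>The K shifted copies of the transform of f hardly overlap, so their sum is bounded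
  independently of K, although the polynomial itself has size about the square root of K.
  Normalising by that root makes the transform small everywhere.\<close>

lemma fourier_trig_decay:
  assumes f: "integrable lborel f" and C: "0 \<le> C" "\<And>\<tau>. cmod (fourier f \<tau>) \<le> C / (1 + \<bar>\<tau>\<bar>) ^ (m + 2)"
    and z: "\<And>k. cmod (z k) \<le> 1" and K: "1 \<le> K"
  shows "cmod (fourier (\<lambda>s. trig {..<K} z s * f s) \<tau>) \<le> C * 2 ^ m * (2 * pi) / (1 + \<bar>\<tau>\<bar> / real K) ^ m"
proof -
  define Y where "Y = C * 2 ^ m / (1 + \<bar>\<tau>\<bar> / real K) ^ m"
  have Y: "Y \<ge> 0" using C by (simp add: Y_def)
  have "cmod (fourier (\<lambda>s. trig {..<K} z s * f s) \<tau>) \<le> 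
    (\<Sum>k<K. (cmod (fourier f (\<tau> - real k)) + cmod (fourier f (\<tau> + real k))) / 2)"
    unfolding fourier_trig_mult[OF f finite_lessThan]
  proof (rule sum_norm_le)
    fix k
    have "cmod (z k * fourier f (\<tau> - real k) + cnj (z k) * fourier f (\<tau> + real k)) \<le>
      cmod (z k) * cmod (fourier f (\<tau> - real k)) + cmod (z k) * cmod (fourier f (\<tau> + real k))"
      by (rule order_trans[OF norm_triangle_ineq]) (simp add: norm_mult)
    also have "\<dots> \<le> 1 * cmod (fourier f (\<tau> - real k)) + 1 * cmod (fourier f (\<tau> + real k))"
      by (intro add_mono mult_right_mono z) auto
    finally show "cmod ((z k * fourier f (\<tau> - real k) + cnj (z k) * fourier f (\<tau> + real k)) / 2) \<le>
        (cmod (fourier f (\<tau> - real k)) + cmod (fourier f (\<tau> + real k))) / 2" by (simp add: norm_divide)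
  qed
  also have "\<dots> \<le> (\<Sum>k<K. (Y * (1 / (1 + \<bar>\<tau> - real k\<bar>)\<^sup>2) + Y * (1 / (1 + \<bar>\<tau> + real k\<bar>)\<^sup>2)) / 2)"
  proof (intro sum_mono divide_right_mono add_mono)
    fix k assume "k \<in> {..<K}"
    then have k: "0 \<le> real k" "real k \<le> real K" "1 \<le> real K" using K by auto
    have p: "0 < 1 + \<bar>\<tau>\<bar> / real K" by (simp add: add_pos_nonneg)
    show "cmod (fourier f (\<tau> - real k)) \<le> Y * (1 / (1 + \<bar>\<tau> - real k\<bar>)\<^sup>2)"
      unfolding Y_def using order_trans[OF C(2) decay_split[OF p peetre_inequality(1)[OF k] C(1)]] .
    show "cmod (fourier f (\<tau> + real k)) \<le> Y * (1 / (1 + \<bar>\<tau> + real k\<bar>)\<^sup>2)"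
      unfolding Y_def using order_trans[OF C(2) decay_split[OF p peetre_inequality(2)[OF k] C(1)]] .
  qed simp
  also have "\<dots> = Y / 2 * ((\<Sum>k<K. 1 / (1 + \<bar>\<tau> - real k\<bar>)\<^sup>2) + (\<Sum>k<K. 1 / (1 + \<bar>- \<tau> - real k\<bar>)\<^sup>2))"
  proof -
    \<comment> \<open>Shifts in the other direction are the same sum taken at -\<tau>.\<close>
    have "\<bar>- \<tau> - real k\<bar> = \<bar>\<tau> + real k\<bar>" for k by linarith
    then show ?thesis by (simp only: sum_distrib_left sum.distrib[symmetric] add_divide_distrib distrib_left 
          times_divide_eq_left)
  qed
  also have "\<dots> \<le> Y / 2 * (2 * pi + 2 * pi)"
    using Y by (intro mult_left_mono add_mono sum_decay_le) auto
  finally show ?thesis by (simp add: Y_def mult_ac)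
qed

section \<open>The differentiated wave\<close>

text \<open>Because h vanishes at both ends of its support, integrating its derivative over a
  half-line leaves only the boundary value at t.\<close>

lemma supported_primitive_FTC:
  fixes h h' :: "real \<Rightarrow> real"
  assumes r: "0 < r" and h0: "\<And>s. r \<le> \<bar>s\<bar> \<Longrightarrow> h s = 0" and h0': "\<And>s. r < \<bar>s\<bar> \<Longrightarrow> h' s = 0"
    and der: "\<And>s. \<bar>s\<bar> \<le> r \<Longrightarrow> (h has_real_derivative h' s) (at s within {-r..r})"
    and cont: "continuous_on {-r..r} h'"
    and [measurable]: "h' \<in> borel_measurable borel"
  shows "(LINT s|lborel. indicator {t..} s * h' s) = - h t"
    and "(LINT s|lborel. indicator {..t} s * h' s) = h t"
proof -
  \<comment> \<open>Clamping t to the support changes neither h nor, up to a null set, the integral,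
    and reduces all positions of t to one compact interval.\<close>
  define a where "a = max (-r) (min t r)"
  have a: "-r \<le> a" "a \<le> r" using r by (auto simp: a_def)
  have ha: "h a = h t" using h0[of t] h0[of r] h0[of "-r"] r by (auto simp: a_def max_def min_def)
  have hr: "h r = 0" "h (-r) = 0" using h0 r by auto
  have der': "(h has_vector_derivative h' s) (at s within {u..v})" if "{u..v} \<subseteq> {-r..r}" "s \<in> {u..v}" for u v s
    using der[of s] that 
    by (auto simp: has_real_derivative_iff_has_vector_derivative abs_le_iff intro: has_vector_derivative_within_subset)
  have 1: "(LINT s|lborel. indicator {a..r} s *\<^sub>R h' s) = h r - h a"
    using a by (intro integral_FTC_Icc der' continuous_on_subset[OF cont]) auto
  have 2: "(LINT s|lborel. indicator {-r..a} s *\<^sub>R h' s) = h a - h (-r)"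
    using a by (intro integral_FTC_Icc der' continuous_on_subset[OF cont]) auto
  have "(LINT s|lborel. indicator {t..} s * h' s) = (LINT s|lborel. indicator {a..r} s *\<^sub>R h' s)"
  proof (rule integral_cong_AE)
    \<comment> \<open>The derivative need not vanish at the endpoints, and the clamped interval may
      contain an endpoint that the half-line misses.\<close>
    have "AE s in lborel. s \<noteq> r \<and> s \<noteq> -r" using AE_lborel_singleton[of r] AE_lborel_singleton[of "-r"] by eventually_elim simp
    then show "AE s in lborel. indicator {t..} s * h' s = indicator {a..r} s *\<^sub>R h' s"
    proof eventually_elim
      case (elim s)
      then show ?case using h0'[of s] by (cases "r < \<bar>s\<bar>") (auto simp: a_def indicator_def max_def min_def)
    qed
  qed auto
  then show "(LINT s|lborel. indicator {t..} s * h' s) = - h t" using 1 ha hr by simp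
  have "(LINT s|lborel. indicator {..t} s * h' s) = (LINT s|lborel. indicator {-r..a} s *\<^sub>R h' s)"
  proof (rule integral_cong_AE)
    have "AE s in lborel. s \<noteq> r \<and> s \<noteq> -r" using AE_lborel_singleton[of r] AE_lborel_singleton[of "-r"] by eventually_elim simp
    then show "AE s in lborel. indicator {..t} s * h' s = indicator {-r..a} s *\<^sub>R h' s"
    proof eventually_elim
      case (elim s)
      then show ?case using h0'[of s] by (cases "r < \<bar>s\<bar>") (auto simp: a_def indicator_def max_def min_def)
    qed
  qed auto
  then show "(LINT s|lborel. indicator {..t} s * h' s) = h t" using 2 ha hr by simp
qed

text \<open>Integration by parts; h vanishes at the endpoints, so there is no boundary term even
  though h' may jump there.\<close>

lemma fourier_deriv_supported:
  fixes h h' :: "real \<Rightarrow> real"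
  assumes r: "0 < r" and h0: "\<And>s. r \<le> \<bar>s\<bar> \<Longrightarrow> h s = 0" and h0': "\<And>s. r < \<bar>s\<bar> \<Longrightarrow> h' s = 0"
    and der: "\<And>s. \<bar>s\<bar> \<le> r \<Longrightarrow> (h has_real_derivative h' s) (at s within {-r..r})"
    and cont: "continuous_on {-r..r} h'"
    and int: "integrable lborel h" "integrable lborel h'"
  shows "fourier h' \<tau> = \<i> * of_real \<tau> * fourier h \<tau>"
proof -
  let ?e = "\<lambda>s. exp (- \<i> * complex_of_real (s * \<tau>))"
  let ?f = "\<lambda>s. ?e s * of_real (h' s) + (- \<i> * of_real \<tau>) * ?e s * of_real (h s)"
  have conth: "continuous_on {-r..r} h"
    using der by (intro DERIV_continuous_on[of _ _ h']) (auto simp: abs_le_iff)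
  have "(LINT s|lborel. indicator {-r..r} s *\<^sub>R ?f s) = ?e r * of_real (h r) - ?e (-r) * of_real (h (-r))"
  proof (rule integral_FTC_Icc)
    show "((\<lambda>s. ?e s * of_real (h s)) has_vector_derivative ?f s) (at s within {-r..r})" if "-r \<le> s" "s \<le> r" for s
      using that by (intro has_vector_derivative_mult exp_i_has_vector_derivative of_real_has_vector_derivative der) auto
  qed (use r in \<open>auto intro!: continuous_intros cont conth\<close>)
  also have "\<dots> = 0" using h0 r by simp
  finally have 0: "(LINT s|lborel. indicator {-r..r} s *\<^sub>R ?f s) = 0" .
  have "(LINT s|lborel. indicator {-r..r} s *\<^sub>R ?f s) = 
     (LINT s|lborel. ?e s * of_real (h' s) - (\<i> * of_real \<tau>) * (?e s * of_real (h s)))"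
    using h0 h0' by (intro Bochner_Integration.integral_cong) (auto simp: indicator_def abs_le_iff not_le)
  also have "\<dots> = fourier h' \<tau> - \<i> * of_real \<tau> * fourier h \<tau>"
    using int[THEN fourier_integrand_integrable, unfolded inner_real_def, of \<tau>]
    unfolding fourier_real integral_mult_right_zero[symmetric]
    by (intro Bochner_Integration.integral_diff integrable_mult_right)
  finally show ?thesis using 0 by simp
qed

section \<open>The derivative of the cutoff and the oscillating factor\<close>

definition cosbump_deriv :: "real \<Rightarrow> nat \<Rightarrow> real \<Rightarrow> real" where
  "cosbump_deriv r N s = (if \<bar>s\<bar> \<le> r then
     - (real (N + 2) * (pi / (2 * r))) * cos (pi * s / (2 * r)) ^ (N + 1) * sin (pi * s / (2 * r)) else 0)"

lemma cosbump_has_derivative: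
  assumes "0 < r" "\<bar>s\<bar> \<le> r"
  shows "(cosbump r (N + 2) has_real_derivative cosbump_deriv r N s) (at s within {-r..r})"
proof (rule has_field_derivative_transform_within[where d=1])
  show "((\<lambda>s. cos (pi * s / (2 * r)) ^ (N + 2)) has_real_derivative cosbump_deriv r N s) (at s within {-r..r})"
    using assms by (auto intro!: derivative_eq_intros simp: cosbump_deriv_def simp del: power_Suc)
qed (use assms in \<open>auto simp: cosbump_def abs_le_iff\<close>)

lemma cosbump_deriv_measurable [measurable]: "cosbump_deriv r N \<in> borel_measurable borel"
  unfolding cosbump_deriv_def[abs_def] by measurable

lemma continuous_on_cosbump_deriv: "continuous_on {-r..r} (cosbump_deriv r N)"
proof -
  have "continuous_on {-r..r} (\<lambda>s. - (real (N + 2) * (pi / (2 * r))) * cos (pi * s / (2 * r)) ^ (N + 1) * sin (pi * s / (2 * r)))"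
    by (cases "r = 0") (auto intro!: continuous_intros)
  then show ?thesis by (rule continuous_on_eq) (auto simp: cosbump_deriv_def abs_le_iff)
qed

text \<open>\<open>cosbump_deriv r N\<close> differentiates the power \<open>N + 2\<close>. Bounding
  one cosine and the sine by 1 leaves the envelope of power \<open>N\<close>.\<close>

lemma abs_cosbump_deriv_le:
  assumes r: "0 < r"
  shows "\<bar>cosbump_deriv r N s\<bar> \<le> real (N + 2) * (pi / (2 * r)) * cosbump r N s"
proof (cases "\<bar>s\<bar> \<le> r")
  case True
  let ?c = "cos (pi * s / (2 * r))" and ?s = "sin (pi * s / (2 * r))"
  have c: "0 \<le> ?c" by (rule cos_scaled_nonneg[OF r True])
  have "\<bar>cosbump_deriv r N s\<bar> = real (N + 2) * (pi / (2 * r)) * (?c ^ N * (?c * \<bar>?s\<bar>))"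
    using True r c by (simp add: cosbump_deriv_def abs_mult mult_ac)
  also have "\<dots> \<le> real (N + 2) * (pi / (2 * r)) * (?c ^ N * (1 * 1))"
    using c r by (intro mult_left_mono mult_mono) auto
  finally show ?thesis using True by (simp add: cosbump_def)
qed (simp add: cosbump_def cosbump_deriv_def)

lemma continuous_cosbump:
  assumes r: "0 < r"
  shows "continuous_on UNIV (cosbump r (N + 2))"
proof -
  \<comment> \<open>Clamping the argument removes the case distinction: at the ends of the support
    the cosine is zero and the exponent is positive.\<close>
  have eq: "cosbump r (N + 2) = (\<lambda>s. cos (pi * max (-r) (min s r) / (2 * r)) ^ (N + 2))"
    using r by (auto simp: fun_eq_iff cosbump_def max_def min_def)
  show ?thesis unfolding eq using r by (auto intro!: continuous_intros)
qed

text \<open>The function h of the overview. The phase \<open>\<kappa>\<close> will be 1 (a cosine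
  wave) or \<open>-\<i>\<close> (a sine wave); dividing by K makes the derivative, not the function,
  of order one.\<close>

definition osc :: "real \<Rightarrow> nat \<Rightarrow> nat \<Rightarrow> complex \<Rightarrow> real \<Rightarrow> real" where
  "osc r N K \<kappa> s = trig {K} (\<lambda>_. \<kappa>) s * cosbump r (N + 2) s / K"

definition osc_deriv :: "real \<Rightarrow> nat \<Rightarrow> nat \<Rightarrow> complex \<Rightarrow> real \<Rightarrow> real" where
  "osc_deriv r N K \<kappa> s = (- Re \<kappa> * sin (K * s) - Im \<kappa> * cos (K * s)) * cosbump r (N + 2) s +
     (Re \<kappa> * cos (K * s) - Im \<kappa> * sin (K * s)) * cosbump_deriv r N s / K"

lemma trig_single: "trig {K} (\<lambda>_. \<kappa>) s = Re \<kappa> * cos (K * s) - Im \<kappa> * sin (K * s)"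
  by (simp add: trig_def Re_exp Im_exp)

lemma osc_has_derivative:
  assumes "0 < r" "\<bar>s\<bar> \<le> r" "0 < K"
  shows "(osc r N K \<kappa> has_real_derivative osc_deriv r N K \<kappa> s) (at s within {-r..r})"
proof -
  have *: "((\<lambda>s. (a * cos (K * s) - b * sin (K * s)) * c s / K) has_real_derivative
      (- a * sin (K * s) - b * cos (K * s)) * c s + (a * cos (K * s) - b * sin (K * s)) * c' / K) F"
    if "(c has_real_derivative c') F" "F = (at s within A)" for a b c' :: real and c F A
    using that assms(3) by (auto intro!: derivative_eq_intros simp: field_simps)
  show ?thesis
    unfolding osc_def[abs_def] trig_single osc_deriv_def
    by (rule *[OF cosbump_has_derivative[OF assms(1,2)] refl])
qed

lemma osc_deriv_measurable [measurable]: "osc_deriv r N K \<kappa> \<in> borel_measurable borel"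
  unfolding osc_deriv_def[abs_def] by measurable

lemma osc_integrable: "0 < r \<Longrightarrow> integrable lborel (osc r N K \<kappa>)"
  unfolding osc_def[abs_def] by (intro integrable_divide integrable_trig_mult cosbump_integrable)

lemma osc_eq_0: "0 < r \<Longrightarrow> r \<le> \<bar>s\<bar> \<Longrightarrow> osc r N K \<kappa> s = 0"
  by (simp add: osc_def cosbump_eq_0)

lemma osc_deriv_outside: "r < \<bar>s\<bar> \<Longrightarrow> osc_deriv r N K \<kappa> s = 0"
  by (simp add: osc_deriv_def cosbump_outside cosbump_deriv_def)

lemma continuous_on_osc_deriv: "0 < r \<Longrightarrow> continuous_on {-r..r} (osc_deriv r N K \<kappa>)"
  unfolding osc_deriv_def[abs_def] divide_inverse
  by (intro continuous_intros continuous_on_cosbump_deriv continuous_on_subset[OF continuous_cosbump]) auto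

lemma abs_osc_deriv_le:
  assumes r: "0 < r" and K: "0 < K" and \<kappa>: "\<kappa> \<in> {1, -\<i>}"
  shows "\<bar>osc_deriv r N K \<kappa> s\<bar> \<le> (1 + real (N + 2) * (pi / (2 * r))) * cosbump r N s"
proof -
  have *: "\<bar>x * a + y * b / K\<bar> \<le> \<bar>a\<bar> + \<bar>b\<bar>" if "\<bar>x\<bar> \<le> 1" "\<bar>y\<bar> \<le> 1" for x y a b :: real
  proof -
    have "\<bar>y\<bar> / K \<le> 1" using that K by (simp add: divide_le_eq)
    then have "\<bar>x\<bar> * \<bar>a\<bar> + \<bar>y\<bar> / K * \<bar>b\<bar> \<le> 1 * \<bar>a\<bar> + 1 * \<bar>b\<bar>"
      using that by (intro add_mono mult_right_mono) auto
    moreover have "\<bar>x * a + y * b / K\<bar> \<le> \<bar>x * a\<bar> + \<bar>y * b / K\<bar>" by (rule abs_triangle_ineq)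
    ultimately show ?thesis by (simp add: abs_mult)
  qed
  have "\<bar>osc_deriv r N K \<kappa> s\<bar> \<le> \<bar>cosbump r (N + 2) s\<bar> + \<bar>cosbump_deriv r N s\<bar>"
    unfolding osc_deriv_def using \<kappa> by (intro *) auto
  also have "\<dots> \<le> cosbump r N s + real (N + 2) * (pi / (2 * r)) * cosbump r N s"
    using cosbump_antimono[OF r, of N "N+2" s] abs_cosbump_deriv_le[OF r] cosbump_nonneg[OF r] by (intro add_mono) auto
  finally show ?thesis by (simp add: algebra_simps)
qed

lemma osc_deriv_integrable:
  assumes "0 < r" "0 < K" "\<kappa> \<in> {1, -\<i>}"
  shows "integrable lborel (osc_deriv r N K \<kappa>)"
proof (rule Bochner_Integration.integrable_bound)
  show "integrable lborel (\<lambda>s. (1 + real (N + 2) * (pi / (2 * r))) * cosbump r N s)"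
    using cosbump_integrable[OF assms(1)] by simp
  show "AE s in lborel. norm (osc_deriv r N K \<kappa> s) \<le> norm ((1 + real (N + 2) * (pi / (2 * r))) * cosbump r N s)"
    using abs_osc_deriv_le[OF assms] by (auto intro!: AE_I2 order_trans[OF _ abs_ge_self])
qed simp

text \<open>
  The two phases are in quadrature: the squares of the two derivatives add up to at least the
  square of the cutoff, so one of the two has large $L^1$ norm.
\<close>

lemma osc_deriv_L1:
  assumes r: "0 < r" and K: "0 < K"
  shows "\<exists>\<kappa>\<in>{1, -\<i>}. (LINT s|lborel. cosbump r (N + 2) s) / 2 \<le> (LINT s|lborel. \<bar>osc_deriv r N K \<kappa> s\<bar>)"
proof -
  let ?w = "osc_deriv r N K"
  have int: "integrable lborel (?w 1)" "integrable lborel (?w (-\<i>))"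
    using r K by (auto intro: osc_deriv_integrable)
  have pt: "cosbump r (N + 2) s \<le> \<bar>?w 1 s\<bar> + \<bar>?w (-\<i>) s\<bar>" for s
  proof -
    let ?a = "cosbump r (N + 2) s" and ?b = "cosbump_deriv r N s / K" and ?c = "cos (K * s)" and ?s = "sin (K * s)"
    have w: "?w 1 s = - ?s * ?a + ?c * ?b" "?w (-\<i>) s = ?c * ?a + ?s * ?b"
      by (simp_all add: osc_deriv_def)
    have "(?w 1 s)\<^sup>2 + (?w (-\<i>) s)\<^sup>2 = (?s\<^sup>2 + ?c\<^sup>2) * (?a\<^sup>2 + ?b\<^sup>2)"
      unfolding w by (simp only: power2_eq_square algebra_simps)
    then have "?a\<^sup>2 \<le> (?w 1 s)\<^sup>2 + (?w (-\<i>) s)\<^sup>2" by simp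
    also have "\<dots> \<le> (\<bar>?w 1 s\<bar> + \<bar>?w (-\<i>) s\<bar>)\<^sup>2" by (simp add: power2_sum)
    finally show ?thesis by (rule power2_le_imp_le) simp
  qed
  have "(LINT s|lborel. cosbump r (N + 2) s) \<le> (LINT s|lborel. \<bar>?w 1 s\<bar> + \<bar>?w (-\<i>) s\<bar>)"
    using int r by (intro integral_mono pt cosbump_integrable) auto
  also have "\<dots> = (LINT s|lborel. \<bar>?w 1 s\<bar>) + (LINT s|lborel. \<bar>?w (-\<i>) s\<bar>)"
    using int by simp
  finally have "(LINT s|lborel. cosbump r (N + 2) s) / 2 \<le> (LINT s|lborel. \<bar>?w 1 s\<bar>) \<or>
    (LINT s|lborel. cosbump r (N + 2) s) / 2 \<le> (LINT s|lborel. \<bar>?w (-\<i>) s\<bar>)" by linarith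
  then show ?thesis by auto
qed

lemma fourier_osc:
  assumes "0 < r"
  shows "fourier (osc r N K \<kappa>) \<tau> = (\<kappa> * fourier (cosbump r (N + 2)) (\<tau> - K) + cnj \<kappa> * fourier (cosbump r (N + 2)) (\<tau> + K)) / (2 * of_nat K)"
proof -
  have "fourier (osc r N K \<kappa>) \<tau> = fourier (\<lambda>s. trig {K} (\<lambda>_. \<kappa>) s * cosbump r (N + 2) s) \<tau> / of_nat K"
    unfolding fourier_real osc_def by (simp flip: integral_divide_zero)
  then show ?thesis using fourier_trig_mult[OF cosbump_integrable[OF assms], of "{K}"] by simp
qed

lemma cmod_fourier_osc_le:
  assumes "0 < r" "cmod \<kappa> \<le> 1"
  shows "cmod (fourier (osc r N K \<kappa>) \<tau>) \<le> (cmod (fourier (cosbump r (N + 2)) (\<tau> - K)) + cmod (fourier (cosbump r (N + 2)) (\<tau> + K))) / (2 * K)"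
proof -
  let ?F = "fourier (cosbump r (N + 2))"
  have "cmod (\<kappa> * ?F (\<tau> - K) + cnj \<kappa> * ?F (\<tau> + K)) \<le> cmod \<kappa> * cmod (?F (\<tau> - K)) + cmod \<kappa> * cmod (?F (\<tau> + K))"
    by (rule order_trans[OF norm_triangle_ineq]) (simp add: norm_mult)
  also have "\<dots> \<le> 1 * cmod (?F (\<tau> - K)) + 1 * cmod (?F (\<tau> + K))"
    by (intro add_mono mult_right_mono assms) auto
  finally show ?thesis unfolding fourier_osc[OF assms(1)] by (simp add: norm_divide norm_mult divide_right_mono)
qed

text \<open>Differentiation multiplies the transform by \<tau>, and the normalisation of
  \<open>osc\<close> divides by K. The quotient \<bar>\<tau>\<bar>/K is absorbed by one power of 1 +
  \<bar>\<tau>\<bar>/K, which is why the cutoff is assumed to decay one order faster, with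
  \<open>Suc m\<close> in place of \<open>m\<close>.\<close>

lemma fourier_osc_deriv_decay:
  assumes r: "0 < r" and K: "0 < K" and \<kappa>: "\<kappa> \<in> {1, -\<i>}"
    and C: "0 \<le> C" "\<And>\<tau>. cmod (fourier (cosbump r (N + 2)) \<tau>) \<le> C / (1 + \<bar>\<tau>\<bar>) ^ (Suc m + 2)"
  shows "cmod (fourier (osc_deriv r N K \<kappa>) \<tau>) \<le> C * 2 ^ Suc m / (1 + \<bar>\<tau>\<bar> / real K) ^ m * 
     ((1 / (1 + \<bar>\<tau> - real K\<bar>)\<^sup>2 + 1 / (1 + \<bar>\<tau> + real K\<bar>)\<^sup>2) / 2)"
proof -
  let ?F = "fourier (cosbump r (N + 2))"
  define y where "y = 1 + \<bar>\<tau>\<bar> / real K"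
  have y: "0 < y" by (simp add: y_def add_pos_nonneg)
  have \<kappa>1: "cmod \<kappa> \<le> 1" using \<kappa> by auto
  have K1: "0 \<le> real K" "real K \<le> real K" "1 \<le> real K" using K by auto
  have "fourier (osc_deriv r N K \<kappa>) \<tau> = \<i> * of_real \<tau> * fourier (osc r N K \<kappa>) \<tau>"
    using r K \<kappa> by (intro fourier_deriv_supported[of r] osc_has_derivative osc_deriv_integrable osc_integrable
        continuous_on_osc_deriv osc_eq_0 osc_deriv_outside) auto
  then have "cmod (fourier (osc_deriv r N K \<kappa>) \<tau>) = \<bar>\<tau>\<bar> * cmod (fourier (osc r N K \<kappa>) \<tau>)"
    by (simp add: norm_mult)
  also have "\<dots> \<le> \<bar>\<tau>\<bar> * ((cmod (?F (\<tau> - K)) + cmod (?F (\<tau> + K))) / (2 * K))"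
    by (intro mult_left_mono cmod_fourier_osc_le r \<kappa>1) auto
  also have "\<dots> = \<bar>\<tau>\<bar> / K * ((cmod (?F (\<tau> - K)) + cmod (?F (\<tau> + K))) / 2)" by simp
  also have "\<dots> \<le> y * ((C * 2 ^ Suc m / y ^ Suc m * (1 / (1 + \<bar>\<tau> - real K\<bar>)\<^sup>2) + C * 2 ^ Suc m / y ^ Suc m * (1 / (1 + \<bar>\<tau> + real K\<bar>)\<^sup>2)) / 2)"
  proof (intro mult_mono divide_right_mono add_mono)
    show "cmod (?F (\<tau> - real K)) \<le> C * 2 ^ Suc m / y ^ Suc m * (1 / (1 + \<bar>\<tau> - real K\<bar>)\<^sup>2)"
      using order_trans[OF C(2) decay_split[OF y _ C(1)]] peetre_inequality(1)[OF K1] by (simp add: y_def)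
    show "cmod (?F (\<tau> + real K)) \<le> C * 2 ^ Suc m / y ^ Suc m * (1 / (1 + \<bar>\<tau> + real K\<bar>)\<^sup>2)"
      using order_trans[OF C(2) decay_split[OF y _ C(1)]] peetre_inequality(2)[OF K1] by (simp add: y_def)
  qed (use y in \<open>auto simp: y_def\<close>)
  also have "\<dots> = C * 2 ^ Suc m / y ^ m * ((1 / (1 + \<bar>\<tau> - real K\<bar>)\<^sup>2 + 1 / (1 + \<bar>\<tau> + real K\<bar>)\<^sup>2) / 2)"
  proof -
    have *: "y * ((D / y ^ Suc m * a + D / y ^ Suc m * b) / 2) = D / y ^ m * ((a + b) / 2)" for D a b
      using y by (simp add: field_simps)
    show ?thesis by (rule *)
  qed
  finally show ?thesis by (simp add: y_def)
qed

lemma fourier_cosbump_integrable: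
  assumes C: "\<And>\<tau>. cmod (fourier (cosbump r N) \<tau>) \<le> C / (1 + \<bar>\<tau>\<bar>)\<^sup>2"
  shows "integrable lborel (fourier (cosbump r N))"
proof (rule Bochner_Integration.integrable_bound)
  show "integrable lborel (\<lambda>\<tau>. C * (1 / (1 + \<bar>\<tau>\<bar>)\<^sup>2))" using integrable_decay by (rule integrable_mult_right)
  show "AE \<tau> in lborel. norm (fourier (cosbump r N) \<tau>) \<le> norm (C * (1 / (1 + \<bar>\<tau>\<bar>)\<^sup>2))"
    by (intro AE_I2 order_trans[OF C]) (simp add: abs_mult divide_right_mono)
qed simp

text \<open>The oscillating factor changes sign, so the inversion formula for nonnegative functions
  is applied to the cutoff and carried over by translation in frequency. Translation keeps the L1
  norm of the transform, and the division by K supplies the gain of K^{-1}.\<close>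

lemma osc_inversion:
  assumes r: "0 < r" and K: "0 < K" and \<kappa>: "\<kappa> \<in> {1, -\<i>}" and int: "integrable lborel (fourier (cosbump r (N + 2)))"
  shows "complex_of_real (osc r N K \<kappa> s) = (LINT t|lborel. iexp (t * s) * fourier (osc r N K \<kappa>) t) / (2 * pi)" (is ?inv)
    and "integrable lborel (fourier (osc r N K \<kappa>))" (is ?int)
    and "(LINT t|lborel. cmod (fourier (osc r N K \<kappa>) t)) \<le> (LINT t|lborel. cmod (fourier (cosbump r (N + 2)) t)) / K" (is ?L1)
proof -
  let ?F = "fourier (cosbump r (N + 2))" and ?G = "fourier (osc r N K \<kappa>)"
  have \<kappa>1: "cmod \<kappa> \<le> 1" using \<kappa> by auto
  have i1: "integrable lborel (\<lambda>t. ?F (t - K))" 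
    using lborel_integrable_real_affine[OF int, of 1 "- real K"] by (simp add: algebra_simps)
  have i2: "integrable lborel (\<lambda>t. ?F (t + K))" 
    using lborel_integrable_real_affine[OF int, of 1 "real K"] by (simp add: add.commute)
  show ?int unfolding fourier_osc[OF r, abs_def]
    by (intro integrable_divide Bochner_Integration.integrable_add integrable_mult_right i1 i2)
  have "(LINT t|lborel. cmod (?G t)) \<le> (LINT t|lborel. (cmod (?F (t - K)) + cmod (?F (t + K))) / (2 * K))"
    using i1 i2 \<open>?int\<close> by (intro integral_mono cmod_fourier_osc_le r \<kappa>1) auto
  also have "\<dots> = ((LINT t|lborel. cmod (?F (t - K))) + (LINT t|lborel. cmod (?F (t + K)))) / (2 * K)"
    using i1 i2 by simp
  also have "(LINT t|lborel. cmod (?F (t - K))) = (LINT t|lborel. cmod (?F t))"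
    by (subst lborel_integral_real_affine[of 1 _ "real K"]) auto
  also have "(LINT t|lborel. cmod (?F (t + K))) = (LINT t|lborel. cmod (?F t))"
    by (subst lborel_integral_real_affine[of 1 _ "- real K"]) auto
  finally show ?L1 using K by (simp add: field_simps)
  define J where "J = (LINT t|lborel. iexp (t * s) * ?F t)"
  have inv: "complex_of_real (cosbump r (N + 2) s) = J / (2 * pi)"
    unfolding J_def
    using r by (intro fourier_inversion[where B=1] continuous_cosbump cosbump_nonneg cosbump_le_one cosbump_integrable cosbump_integral_pos int)
  have ii: "integrable lborel (\<lambda>t. iexp (t * s) * ?F (t + a))" for a
  proof (rule Bochner_Integration.integrable_bound)
    show "integrable lborel (\<lambda>t. ?F (t + a))"
      using lborel_integrable_real_affine[OF int, of 1 a] by (simp add: add.commute)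
    show "AE t in lborel. norm (iexp (t * s) * ?F (t + a)) \<le> norm (?F (t + a))" by (simp add: norm_mult)
  qed measurable
  \<comment> \<open>Translating the transform by a multiplies the inverse transform by a
    phase.\<close>
  have shift: "(LINT t|lborel. iexp (t * s) * ?F (t + a)) = iexp (- a * s) * J" for a
  proof -
    have e: "iexp ((- a + 1 * t) * s) * ?F (- a + 1 * t + a) = iexp (- a * s) * (iexp (t * s) * ?F t)" for t
    proof -
      have "iexp ((- a + 1 * t) * s) = iexp (- a * s) * iexp (t * s)"
        by (simp add: exp_add[symmetric] algebra_simps)
      then show ?thesis by (simp only: mult.assoc) simp
    qed
    have "(LINT t|lborel. iexp (t * s) * ?F (t + a)) = (LINT t|lborel. iexp (- a * s) * (iexp (t * s) * ?F t))"
      unfolding e[symmetric] by (subst lborel_integral_real_affine[of 1 _ "- a"]) auto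
    then show ?thesis by (simp add: J_def)
  qed
  have "(LINT t|lborel. iexp (t * s) * ?G t) = 
     (LINT t|lborel. (\<kappa> * (iexp (t * s) * ?F (t + (- real K))) + cnj \<kappa> * (iexp (t * s) * ?F (t + real K))) / (2 * of_nat K))"
    unfolding fourier_osc[OF r] by (simp add: distrib_left mult.left_commute)
  also have "\<dots> = (\<kappa> * (iexp (real K * s) * J) + cnj \<kappa> * (iexp (- real K * s) * J)) / (2 * of_nat K)"
    unfolding integral_divide_zero 
      Bochner_Integration.integral_add[OF integrable_mult_right[OF ii] integrable_mult_right[OF ii]]
      integral_mult_right_zero shift by simp
  also have "\<dots> = complex_of_real (trig {K} (\<lambda>_. \<kappa>) s) * J / of_nat K"
  proof -
    have "complex_of_real (trig {K} (\<lambda>_. \<kappa>) s) = (\<kappa> * iexp (real K * s) + cnj (\<kappa> * iexp (real K * s))) / 2"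
      unfolding trig_def by (simp only: complex_add_cnj, simp)
    then show ?thesis using K by (simp add: exp_cnj field_simps)
  qed
  finally show ?inv using inv by (simp add: osc_def)
qed

section \<open>Product functions and half-spaces\<close>

interpretation lborel_product: product_sigma_finite "\<lambda>_ :: 'i. lborel :: real measure" 
  by unfold_locales

lemma sum_scaleR_Basis_inner [simp]:
  "b \<in> Basis \<Longrightarrow> (\<Sum>c\<in>Basis. y c *\<^sub>R c) \<bullet> b = y b" for b :: "'a::euclidean_space"
  by (simp add: inner_sum_left inner_Basis if_distrib sum.delta cong: if_cong)

lemma measurable_sum_Basis [measurable]:
  "(\<lambda>y. \<Sum>b\<in>Basis. y b *\<^sub>R b) \<in> (\<Pi>\<^sub>M b\<in>(Basis::'a::euclidean_space set). lborel) \<rightarrow>\<^sub>M borel"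
  by measurable

lemma
  fixes f :: "'a::euclidean_space \<Rightarrow> real \<Rightarrow> 'c::{real_normed_field,banach,second_countable_topology}"
  assumes int: "\<And>b. b \<in> Basis \<Longrightarrow> integrable lborel (f b)"
  shows integrable_lborel_prod: "integrable lborel (\<lambda>x::'a. \<Prod>b\<in>Basis. f b (x \<bullet> b))"
    and integral_lborel_prod: "(LINT x|lborel. (\<Prod>b\<in>Basis. f b ((x::'a) \<bullet> b))) = (\<Prod>b\<in>Basis. LINT s|lborel. f b s)"
proof -
  have [measurable]: "f b \<in> borel_measurable borel" if "b \<in> Basis" for b using int[OF that] by auto
  have m: "(\<lambda>x::'a. \<Prod>b\<in>Basis. f b (x \<bullet> b)) \<in> borel_measurable borel" by measurable
  have i: "integrable (\<Pi>\<^sub>M b\<in>(Basis::'a set). lborel) (\<lambda>y. \<Prod>b\<in>Basis. f b (y b))"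
    by (intro lborel_product.product_integrable_prod int) auto
  show "integrable lborel (\<lambda>x::'a. \<Prod>b\<in>Basis. f b (x \<bullet> b))"
    unfolding lborel_eq[where 'a='a] using i m by (subst integrable_distr_eq) auto
  show "(LINT x|lborel. (\<Prod>b\<in>Basis. f b ((x::'a) \<bullet> b))) = (\<Prod>b\<in>Basis. LINT s|lborel. f b s)"
    unfolding lborel_eq[where 'a='a] using m int
    by (subst integral_distr) (auto intro!: lborel_product.product_integral_prod)
qed

lemma fourier_prod:
  fixes f :: "'a::euclidean_space \<Rightarrow> real \<Rightarrow> real"
  assumes int: "\<And>b. b \<in> Basis \<Longrightarrow> integrable lborel (f b)"
  shows "fourier (\<lambda>x::'a. \<Prod>b\<in>Basis. f b (x \<bullet> b)) \<omega> = (\<Prod>b\<in>Basis. fourier (f b) (\<omega> \<bullet> b))"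
proof -
  have e: "exp (- \<i> * complex_of_real (x \<bullet> \<omega>)) = (\<Prod>b\<in>Basis. exp (- \<i> * complex_of_real ((x \<bullet> b) * (\<omega> \<bullet> b))))" for x
    by (subst euclidean_inner) (simp only: of_real_sum sum_distrib_left exp_sum[OF finite_Basis])
  have "exp (- \<i> * complex_of_real (x \<bullet> \<omega>)) * complex_of_real (\<Prod>b\<in>Basis. f b (x \<bullet> b)) = 
    (\<Prod>b\<in>Basis. exp (- \<i> * complex_of_real ((x \<bullet> b) * (\<omega> \<bullet> b))) * complex_of_real (f b (x \<bullet> b)))" for x
    unfolding e prod.distrib of_real_prod ..
  then have "fourier (\<lambda>x::'a. \<Prod>b\<in>Basis. f b (x \<bullet> b)) \<omega> = 
     (LINT x|lborel. (\<Prod>b\<in>Basis. (\<lambda>b s. exp (- \<i> * complex_of_real (s * (\<omega> \<bullet> b))) * complex_of_real (f b s)) b (x \<bullet> b)))"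
    by (simp add: fourier_def)
  also have "\<dots> = (\<Prod>b\<in>Basis. fourier (f b) (\<omega> \<bullet> b))"
    unfolding fourier_real using fourier_integrand_integrable[OF int, unfolded inner_real_def]
    by (subst integral_lborel_prod) auto
  finally show ?thesis .
qed

text \<open>The left side consists of terms of the expanded product. This is how a weight in the
  norm of \<omega> is bounded by a product of one-dimensional weights.\<close>

lemma one_plus_sum_le_prod:
  fixes a :: "'i \<Rightarrow> real"
  assumes "finite A" "\<And>i. i \<in> A \<Longrightarrow> 0 \<le> a i"
  shows "1 + (\<Sum>i\<in>A. a i) \<le> (\<Prod>i\<in>A. 1 + a i)"
  using assms
proof (induction A rule: finite_induct)
  case (insert i A)
  have "1 \<le> (\<Prod>i\<in>A. 1 + a i)" using insert.prems by (intro prod_ge_1) auto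
  then have "a i * 1 \<le> a i * (\<Prod>i\<in>A. 1 + a i)" using insert.prems by (intro mult_left_mono) auto
  moreover have "1 + (\<Sum>i\<in>A. a i) \<le> (\<Prod>i\<in>A. 1 + a i)" using insert by auto
  ultimately show ?case using insert(1,2) by (simp add: algebra_simps)
qed simp

text \<open>The norm of \<omega> is at most K times the product of the factors 1 + \<bar>\<omega>
  \<bullet> b\<bar>/K. With this weight the whole integrand is a product over coordinates, and the
  integral factors by Tonelli.\<close>

lemma sobolev_sq_prod_le:
  fixes f :: "'a::euclidean_space \<Rightarrow> real \<Rightarrow> real"
  assumes int: "\<And>b. b \<in> Basis \<Longrightarrow> integrable lborel (f b)" and \<beta>: "0 < \<beta>" and K: "0 < K" and D: "0 \<le> D"
    and bd: "\<And>b. b \<in> Basis \<Longrightarrow> (\<integral>\<^sup>+\<tau>. ennreal (((1 + \<bar>\<tau>\<bar> / K) powr \<beta> * cmod (fourier (f b) \<tau>))\<^sup>2) \<partial>lborel) \<le> ennreal D"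
  shows "sobolev_sq \<beta> (\<lambda>x::'a. \<Prod>b\<in>Basis. f b (x \<bullet> b)) \<le> ennreal (K powr (2 * \<beta>) * D ^ DIM('a))"
proof -
  let ?h = "\<lambda>b \<tau>. ((1 + \<bar>\<tau>\<bar> / K) powr \<beta> * cmod (fourier (f b) \<tau>))\<^sup>2"
  have [measurable]: "f b \<in> borel_measurable borel" if "b \<in> Basis" for b using int[OF that] by auto
  have pt: "norm \<omega> powr (2 * \<beta>) * (cmod (fourier (\<lambda>x::'a. \<Prod>b\<in>Basis. f b (x \<bullet> b)) \<omega>))\<^sup>2
     \<le> K powr (2 * \<beta>) * (\<Prod>b\<in>Basis. ?h b (\<omega> \<bullet> b))" for \<omega> :: 'a
  proof -
    have sq: "(x powr \<beta>)\<^sup>2 = x powr (2 * \<beta>)" for x :: real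
      by (simp add: power2_eq_square powr_add[symmetric])
    have fp: "(cmod (fourier (\<lambda>x::'a. \<Prod>b\<in>Basis. f b (x \<bullet> b)) \<omega>))\<^sup>2 = (\<Prod>b\<in>Basis. (cmod (fourier (f b) (\<omega> \<bullet> b)))\<^sup>2)"
      by (subst fourier_prod[OF int]) (simp_all add: prod_norm[symmetric] prod_power_distrib)
    have "norm \<omega> \<le> (\<Sum>b\<in>Basis. \<bar>\<omega> \<bullet> b\<bar>)" by (rule norm_le_l1)
    also have "\<dots> = K * (\<Sum>b\<in>Basis. \<bar>\<omega> \<bullet> b\<bar> / K)" using K by (simp flip: sum_divide_distrib)
    also have "\<dots> \<le> K * (\<Prod>b\<in>Basis. 1 + \<bar>\<omega> \<bullet> b\<bar> / K)"
      using one_plus_sum_le_prod[of Basis "\<lambda>b. \<bar>\<omega> \<bullet> b\<bar> / K"] K by (intro mult_left_mono) auto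
    finally have "norm \<omega> powr (2 * \<beta>) \<le> (K * (\<Prod>b\<in>Basis. 1 + \<bar>\<omega> \<bullet> b\<bar> / K)) powr (2 * \<beta>)"
      using \<beta> by (intro powr_mono2) auto
    also have "\<dots> = K powr (2 * \<beta>) * (\<Prod>b\<in>Basis. (1 + \<bar>\<omega> \<bullet> b\<bar> / K) powr (2 * \<beta>))"
      using K by (subst powr_mult) (auto intro!: prod_nonneg add_nonneg_nonneg simp: prod_powr_distrib)
    finally have "norm \<omega> powr (2 * \<beta>) * (cmod (fourier (\<lambda>x::'a. \<Prod>b\<in>Basis. f b (x \<bullet> b)) \<omega>))\<^sup>2 \<le>
       K powr (2 * \<beta>) * (\<Prod>b\<in>Basis. (1 + \<bar>\<omega> \<bullet> b\<bar> / K) powr (2 * \<beta>)) * (cmod (fourier (\<lambda>x::'a. \<Prod>b\<in>Basis. f b (x \<bullet> b)) \<omega>))\<^sup>2"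
      by (intro mult_right_mono) auto
    also have "\<dots> = K powr (2 * \<beta>) * (\<Prod>b\<in>Basis. ?h b (\<omega> \<bullet> b))"
      unfolding fp power_mult_distrib sq prod.distrib by (simp add: mult.assoc)
    finally show ?thesis .
  qed
  have "sobolev_sq \<beta> (\<lambda>x::'a. \<Prod>b\<in>Basis. f b (x \<bullet> b)) \<le> 
     (\<integral>\<^sup>+\<omega>. ennreal (K powr (2 * \<beta>)) * (\<Prod>b\<in>Basis. ennreal (?h b (\<omega> \<bullet> b))) \<partial>(lborel :: 'a measure))"
    unfolding sobolev_sq_def
  proof (rule nn_integral_mono)
    fix \<omega> :: 'a
    show "ennreal (norm \<omega> powr (2 * \<beta>) * (cmod (fourier (\<lambda>x::'a. \<Prod>b\<in>Basis. f b (x \<bullet> b)) \<omega>))\<^sup>2) \<le>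
      ennreal (K powr (2 * \<beta>)) * (\<Prod>b\<in>Basis. ennreal (?h b (\<omega> \<bullet> b)))"
      using ennreal_leI[OF pt[of \<omega>]] by (simp add: ennreal_mult prod_ennreal prod_nonneg)
  qed
  also have "\<dots> = ennreal (K powr (2 * \<beta>)) * (\<integral>\<^sup>+\<omega>. (\<Prod>b\<in>Basis. ennreal (?h b (\<omega> \<bullet> b))) \<partial>(lborel :: 'a measure))"
    by (rule nn_integral_cmult) measurable
  also have "\<dots> = ennreal (K powr (2 * \<beta>)) * (\<Prod>b\<in>(Basis::'a set). \<integral>\<^sup>+\<tau>. ennreal (?h b \<tau>) \<partial>lborel)"
    by (subst nn_integral_lborel_prod) auto
  also have "\<dots> \<le> ennreal (K powr (2 * \<beta>)) * (\<Prod>b\<in>(Basis::'a set). ennreal D)"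
    by (intro mult_left_mono prod_mono_ennreal bd) auto
  also have "\<dots> = ennreal (K powr (2 * \<beta>) * D ^ DIM('a))"
    using D by (simp add: ennreal_mult ennreal_power)
  finally show ?thesis .
qed

text \<open>Inserting the inversion formula for h and exchanging integrals leaves, at each t, the
  transforms of the factors at the frequencies \<open>t * q b\<close>. These are bounded uniformly
  by \<open>D b\<close>, so the estimate depends neither on p nor on the slopes q. The factor 1/(2
  pi) is at most 1 and is dropped.\<close>

lemma product_average_bound:
  fixes g :: "'i \<Rightarrow> real \<Rightarrow> real" and h :: "real \<Rightarrow> real" and H :: "real \<Rightarrow> complex"
  assumes h: "\<And>s. complex_of_real (h s) = (LINT t|lborel. iexp (t * s) * H t) / (2 * pi)"
    and H: "integrable lborel H" and J: "finite J"
    and g: "\<And>b. b \<in> J \<Longrightarrow> integrable lborel (g b)"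
    and D: "\<And>b \<tau>. b \<in> J \<Longrightarrow> cmod (fourier (g b) \<tau>) \<le> D b"
  shows "\<bar>LINT x|(\<Pi>\<^sub>M b\<in>J. lborel). h (p - (\<Sum>b\<in>J. x b * q b)) * (\<Prod>b\<in>J. g b (x b))\<bar> \<le> (LINT t|lborel. cmod (H t)) * (\<Prod>b\<in>J. D b)"
proof -
  let ?P = "\<Pi>\<^sub>M b\<in>J. (lborel :: real measure)"
  interpret finite_product_sigma_finite "\<lambda>_. lborel :: real measure" J by unfold_locales (rule J)
  interpret PP: pair_sigma_finite ?P "lborel :: real measure" ..
  have [measurable]: "H \<in> borel_measurable borel" using H by auto
  have [measurable]: "g b \<in> borel_measurable borel" if "b \<in> J" for b using g[OF that] by auto
  define G where "G x = (\<Prod>b\<in>J. g b (x b))" for x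
  define F where "F x t = iexp (t * (p - (\<Sum>b\<in>J. x b * q b))) * H t * complex_of_real (G x)" for x t
  have Gint: "integrable ?P (\<lambda>x. G x)" unfolding G_def by (intro lborel_product.product_integrable_prod g J)
  have [measurable]: "G \<in> borel_measurable ?P" using Gint by auto
  have Fm: "(\<lambda>(x, t). F x t) \<in> borel_measurable (?P \<Otimes>\<^sub>M lborel)"
    unfolding F_def[abs_def] by measurable
  have normF: "cmod (F x t) = cmod (H t) * \<bar>G x\<bar>" for x t by (simp add: F_def norm_mult)
  have Fint: "integrable (?P \<Otimes>\<^sub>M lborel) (\<lambda>(x, t). F x t)"
  proof (rule PP.Fubini_integrable[OF Fm])
    show "integrable ?P (\<lambda>x. LINT t|lborel. cmod (case (x, t) of (x, t) \<Rightarrow> F x t))"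
      using Gint by (simp add: normF)
    show "AE x in ?P. integrable lborel (\<lambda>t. case (x, t) of (x, t) \<Rightarrow> F x t)"
    proof (rule AE_I2)
      fix x assume x: "x \<in> space ?P"
      have "integrable lborel (\<lambda>t. F x t)"
      proof (rule Bochner_Integration.integrable_bound)
        show "integrable lborel (\<lambda>t. H t * of_real (G x))" using H by simp
        show "F x \<in> borel_measurable lborel" unfolding F_def[abs_def] by measurable
      qed (simp add: normF norm_mult)
      then show "integrable lborel (\<lambda>t. case (x, t) of (x, t) \<Rightarrow> F x t)" by simp
    qed
  qed
  have inner: "(LINT x|?P. F x t) = iexp (t * p) * H t * (\<Prod>b\<in>J. fourier (g b) (t * q b))" for t
  proof -
    have "F x t = iexp (t * p) * H t * (\<Prod>b\<in>J. exp (- \<i> * complex_of_real (x b * (t * q b))) * complex_of_real (g b (x b)))" for x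
    proof -
      have "iexp (t * (p - (\<Sum>b\<in>J. x b * q b))) = iexp (t * p) * (\<Prod>b\<in>J. exp (- \<i> * complex_of_real (x b * (t * q b))))"
        using J by (simp add: exp_sum[symmetric] exp_add[symmetric] algebra_simps sum_distrib_left sum_negf)
      then show ?thesis by (simp add: F_def G_def prod.distrib mult_ac)
    qed
    then have "(LINT x|?P. F x t) = iexp (t * p) * H t * (LINT x|?P. (\<Prod>b\<in>J. exp (- \<i> * complex_of_real (x b * (t * q b))) * complex_of_real (g b (x b))))"
      by simp
    moreover have gi: "integrable lborel (\<lambda>s. exp (- \<i> * complex_of_real (s * (t * q b))) * complex_of_real (g b s))" if "b \<in> J" for b
      using fourier_integrand_integrable[OF g[OF that], of "t * q b"] by (simp only: inner_real_def)
    moreover have "(LINT x|?P. (\<Prod>b\<in>J. exp (- \<i> * complex_of_real (x b * (t * q b))) * complex_of_real (g b (x b)))) = 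
       (\<Prod>b\<in>J. fourier (g b) (t * q b))"
      unfolding fourier_real using gi
      by (intro lborel_product.product_integral_prod[where f="\<lambda>b s. exp (- \<i> * complex_of_real (s * (t * q b))) * complex_of_real (g b s)"] J) auto
    ultimately show ?thesis by simp
  qed
  have "complex_of_real (LINT x|?P. h (p - (\<Sum>b\<in>J. x b * q b)) * G x) = (LINT x|?P. (LINT t|lborel. F x t) / (2 * pi))"
    unfolding integral_complex_of_real[symmetric]
    by (intro Bochner_Integration.integral_cong) (simp_all add: h F_def)
  also have "\<dots> = (LINT x|?P. LINT t|lborel. F x t) / (2 * pi)" by (rule integral_divide_zero)
  also have "(LINT x|?P. LINT t|lborel. F x t) = (LINT t|lborel. LINT x|?P. F x t)"
    using PP.Fubini_integral[OF Fint] by simp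
  also have "\<dots> = (LINT t|lborel. iexp (t * p) * H t * (\<Prod>b\<in>J. fourier (g b) (t * q b)))"
    unfolding inner ..
  finally have eq: "complex_of_real (LINT x|?P. h (p - (\<Sum>b\<in>J. x b * q b)) * G x) = 
    (LINT t|lborel. iexp (t * p) * H t * (\<Prod>b\<in>J. fourier (g b) (t * q b))) / complex_of_real (2 * pi)" .
  have "\<bar>LINT x|?P. h (p - (\<Sum>b\<in>J. x b * q b)) * G x\<bar> = 
    cmod (LINT t|lborel. iexp (t * p) * H t * (\<Prod>b\<in>J. fourier (g b) (t * q b))) / (2 * pi)"
    using arg_cong[OF eq, of cmod] unfolding norm_divide norm_of_real by simp
  also have "\<dots> \<le> cmod (LINT t|lborel. iexp (t * p) * H t * (\<Prod>b\<in>J. fourier (g b) (t * q b)))"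
    using pi_ge_two by (simp add: divide_le_eq mult_le_cancel_left1)
  also have "\<dots> \<le> (LINT t|lborel. cmod (iexp (t * p) * H t * (\<Prod>b\<in>J. fourier (g b) (t * q b))))"
    by (rule integral_norm_bound)
  also have "\<dots> \<le> (LINT t|lborel. cmod (H t) * (\<Prod>b\<in>J. D b))"
  proof (rule Bochner_Integration.integral_mono')
    show "integrable lborel (\<lambda>t. cmod (H t) * (\<Prod>b\<in>J. D b))" using H by simp
    fix t 
    have "(\<Prod>b\<in>J. cmod (fourier (g b) (t * q b))) \<le> (\<Prod>b\<in>J. D b)" by (intro prod_mono) (auto intro: D)
    then show "cmod (iexp (t * p) * H t * (\<Prod>b\<in>J. fourier (g b) (t * q b))) \<le> cmod (H t) * (\<Prod>b\<in>J. D b)"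
      by (simp add: norm_mult prod_norm[symmetric] mult_left_mono)
  qed (use order_trans[OF norm_ge_zero D] in \<open>auto intro!: mult_nonneg_nonneg prod_nonneg\<close>)
  finally show ?thesis by (simp add: G_def)
qed

text \<open>For fixed other coordinates, a half-space cuts the line in direction e in a half-line
  whose endpoint is an affine function of them. Integrating h' over it gives h or -h at that
  endpoint, and the average of h along an affine function is already bounded. The sign of
  \<open>v \<bullet> e\<close> decides the direction of the half-line.\<close>

lemma halfspace_integral_le:
  fixes g :: "'a::euclidean_space \<Rightarrow> real \<Rightarrow> real" and h h' :: "real \<Rightarrow> real" and H :: "real \<Rightarrow> complex"
  assumes h: "\<And>s. complex_of_real (h s) = (LINT t|lborel. iexp (t * s) * H t) / (2 * pi)"
    and H: "integrable lborel H" and e: "e \<in> Basis"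
    and h': "integrable lborel h'" "\<And>t. (LINT s|lborel. indicator {t..} s * h' s) = - h t"
      "\<And>t. (LINT s|lborel. indicator {..t} s * h' s) = h t" "(LINT s|lborel. h' s) = 0"
    and ge: "g e = h'"
    and g: "\<And>b. b \<in> Basis - {e} \<Longrightarrow> integrable lborel (g b)"
    and D: "\<And>b \<tau>. b \<in> Basis - {e} \<Longrightarrow> cmod (fourier (g b) \<tau>) \<le> D b"
  shows "\<bar>LINT x|lborel. indicator {x. x \<bullet> v \<ge> t} x * (\<Prod>b\<in>Basis. g b (x \<bullet> b))\<bar> \<le> (LINT t|lborel. cmod (H t)) * (\<Prod>b\<in>Basis - {e}. D b)"
proof -
  define J where "J = Basis - {e}"
  define a where "a = v \<bullet> e"
  let ?P = "\<Pi>\<^sub>M b\<in>J. (lborel :: real measure)"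
  let ?B = "\<Pi>\<^sub>M b\<in>insert e J. (lborel :: real measure)"
  have J: "finite J" "e \<notin> J" "insert e J = Basis" using e by (auto simp: J_def)
  have gi: "integrable lborel (g b)" if "b \<in> Basis" for b using g ge h'(1) that by (cases "b = e") auto
  have [measurable]: "g b \<in> borel_measurable borel" if "b \<in> Basis" for b using gi[OF that] by auto
  have [measurable]: "h' \<in> borel_measurable borel" using h' by auto
  define c where "c x = (\<Sum>b\<in>J. x b * (v \<bullet> b))" for x :: "'a \<Rightarrow> real"
  define \<Phi> where "\<Phi> y = indicator {y. c y + y e * a \<ge> t} y * (\<Prod>b\<in>Basis. g b (y b))" for y
  have comp [measurable]: "(\<lambda>y. y b) \<in> borel_measurable (\<Pi>\<^sub>M b\<in>Basis. (lborel :: real measure))" if "b \<in> Basis" for b :: 'a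
    using measurable_component_singleton[OF that, of "\<lambda>_. lborel :: real measure"] by simp
  have cm: "c \<in> borel_measurable (\<Pi>\<^sub>M b\<in>Basis. lborel)" 
    unfolding c_def[abs_def] using J(3) by (intro borel_measurable_sum borel_measurable_times comp) auto
  have \<Phi>m: "\<Phi> \<in> borel_measurable (\<Pi>\<^sub>M b\<in>Basis. lborel)"
    unfolding \<Phi>_def[abs_def] indicator_def using cm e by measurable
  have "integrable (\<Pi>\<^sub>M b\<in>Basis. lborel) \<Phi>"
  proof (rule Bochner_Integration.integrable_bound)
    show "integrable (\<Pi>\<^sub>M b\<in>Basis. lborel) (\<lambda>y. \<Prod>b\<in>Basis. g b (y b))"
      by (intro lborel_product.product_integrable_prod gi) auto
  qed (use \<Phi>m in \<open>auto simp: \<Phi>_def indicator_def\<close>)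
  then have \<Phi>i: "integrable ?B \<Phi>" by (simp add: J)
  have "(LINT x|lborel. indicator {x. x \<bullet> v \<ge> t} x * (\<Prod>b\<in>Basis. g b (x \<bullet> b))) = (LINT y|?B. \<Phi> y)"
  proof -
    have cv: "(\<Sum>b\<in>Basis. y b *\<^sub>R b) \<bullet> v = c y + y e * a" for y
    proof -
      have "(\<Sum>b\<in>Basis. y b *\<^sub>R b) \<bullet> v = (\<Sum>b\<in>insert e J. y b * (v \<bullet> b))"
        by (simp add: inner_sum_left inner_commute[of v] J)
      then show ?thesis unfolding sum.insert[OF J(1,2)] c_def a_def by simp
    qed
    let ?f = "\<lambda>x. indicator {x. x \<bullet> v \<ge> t} x * (\<Prod>b\<in>Basis. g b (x \<bullet> b))"
    have [measurable]: "{x :: 'a. x \<bullet> v \<ge> t} \<in> sets borel"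
      by (intro borel_closed closed_Collect_le continuous_intros)
    have fm: "?f \<in> borel_measurable borel" 
      by (intro borel_measurable_times borel_measurable_indicator borel_measurable_prod) measurable
    have "(LINT x|lborel. ?f x) = (LINT y|(\<Pi>\<^sub>M b\<in>Basis. lborel). ?f (\<Sum>b\<in>Basis. y b *\<^sub>R b))"
      unfolding lborel_eq[where 'a='a] by (rule integral_distr[OF measurable_sum_Basis fm])
    also have "\<dots> = (LINT y|(\<Pi>\<^sub>M b\<in>Basis. lborel). \<Phi> y)"
    proof (intro Bochner_Integration.integral_cong refl)
      fix y
      have "(\<Prod>b\<in>Basis. g b ((\<Sum>b\<in>Basis. y b *\<^sub>R b) \<bullet> b)) = (\<Prod>b\<in>Basis. g b (y b))"
        by (intro prod.cong refl) simp
      then show "?f (\<Sum>b\<in>Basis. y b *\<^sub>R b) = \<Phi> y" by (simp add: \<Phi>_def cv indicator_def)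
    qed
    finally show ?thesis by (simp only: J(3))
  qed
  also have "\<dots> = (LINT x|?P. LINT s|lborel. \<Phi> (x(e := s)))"
    by (rule lborel_product.product_integral_insert[OF J(1,2) \<Phi>i])
  also have "\<dots> = (LINT x|?P. (LINT s|lborel. indicator {s. c x + s * a \<ge> t} s * h' s) * (\<Prod>b\<in>J. g b (x b)))"
  proof (intro Bochner_Integration.integral_cong refl)
    fix x :: "'a \<Rightarrow> real"
    have "\<Phi> (x(e := s)) = indicator {s. c x + s * a \<ge> t} s * h' s * (\<Prod>b\<in>J. g b (x b))" for s
    proof -
      have "c (x(e := s)) = c x" unfolding c_def using J(2) by (intro sum.cong) auto
      moreover have "(\<Prod>b\<in>J. g b ((x(e := s)) b)) = (\<Prod>b\<in>J. g b (x b))" using J(2) by (intro prod.cong) auto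
      ultimately show ?thesis unfolding \<Phi>_def J(3)[symmetric] prod.insert[OF J(1,2)] by (simp add: ge indicator_def)
    qed
    then show "(LINT s|lborel. \<Phi> (x(e := s))) = (LINT s|lborel. indicator {s. c x + s * a \<ge> t} s * h' s) * (\<Prod>b\<in>J. g b (x b))"
      by simp
  qed
  finally have main: "(LINT x|lborel. indicator {x. x \<bullet> v \<ge> t} x * (\<Prod>b\<in>Basis. g b (x \<bullet> b))) = 
     (LINT x|?P. (LINT s|lborel. indicator {s. c x + s * a \<ge> t} s * h' s) * (\<Prod>b\<in>J. g b (x b)))" .
  have Dn: "0 \<le> (LINT t|lborel. cmod (H t)) * (\<Prod>b\<in>J. D b)"
    using order_trans[OF norm_ge_zero D] by (intro mult_nonneg_nonneg prod_nonneg) (auto simp: J_def)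
  have bound: "\<bar>LINT x|?P. h (t / a - (\<Sum>b\<in>J. x b * (v \<bullet> b / a))) * (\<Prod>b\<in>J. g b (x b))\<bar> \<le> (LINT t|lborel. cmod (H t)) * (\<Prod>b\<in>J. D b)"
    using g D by (intro product_average_bound[OF h H J(1)]) (auto simp: J_def)
  have arg: "(t - c x) / a = t / a - (\<Sum>b\<in>J. x b * (v \<bullet> b / a))" for x
    by (simp add: c_def diff_divide_distrib sum_divide_distrib)
  consider "a = 0" | "a > 0" | "a < 0" by linarith
  then have "\<bar>LINT x|?P. (LINT s|lborel. indicator {s. c x + s * a \<ge> t} s * h' s) * (\<Prod>b\<in>J. g b (x b))\<bar> \<le> (LINT t|lborel. cmod (H t)) * (\<Prod>b\<in>J. D b)"
  proof cases
    \<comment> \<open>The half-space does not restrict coordinate e (this includes v = 0), so the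
      inner integral runs over everything or nothing and vanishes either way.\<close>
    case 1
    have "(LINT s|lborel. indicator {s. c x + s * a \<ge> t} s * h' s) = 0" for x
      using h'(4) 1 by (cases "c x \<ge> t") auto
    then show ?thesis using Dn by simp
  next
    case 2
    have "{s. c x + s * a \<ge> t} = {(t - c x) / a..}" for x using 2 by (auto simp: divide_le_eq algebra_simps)
    then show ?thesis using bound by (simp add: h'(2) arg)
  next
    case 3
    have "{s. c x + s * a \<ge> t} = {..(t - c x) / a}" for x using 3 by (auto simp: le_divide_eq algebra_simps)
    then show ?thesis using bound by (simp add: h'(3) arg)
  qed
  then show ?thesis unfolding main J_def .
qed

section \<open>One-dimensional factors\<close>

text \<open>A Sobolev energy measured at frequency scale K: the weight is bounded up to frequencies
  of order K, so that waves of frequency K have energy bounded independently of K.\<close>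

definition weighted_energy :: "real \<Rightarrow> real \<Rightarrow> (real \<Rightarrow> real) \<Rightarrow> ennreal" where
  "weighted_energy \<beta> K f = (\<integral>\<^sup>+\<tau>. ennreal (((1 + \<bar>\<tau>\<bar> / K) powr \<beta> * cmod (fourier f \<tau>))\<^sup>2) \<partial>lborel)"

text \<open>Decay of integer order m \<ge> \<beta> cancels the weight, and the energy of the
  remaining profile \<open>\<phi>\<close> is left.\<close>

lemma weighted_energy_le:
  assumes K: "0 < K" and m: "\<beta> \<le> real m"
    and f: "\<And>\<tau>. cmod (fourier f \<tau>) \<le> \<phi> \<tau> / (1 + \<bar>\<tau>\<bar> / K) ^ m"
    and \<phi>: "integrable lborel (\<lambda>\<tau>. (\<phi> \<tau>)\<^sup>2)" and D: "(LINT \<tau>|lborel. (\<phi> \<tau>)\<^sup>2) \<le> D"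
  shows "weighted_energy \<beta> K f \<le> ennreal D"
proof -
  have "weighted_energy \<beta> K f \<le> (\<integral>\<^sup>+\<tau>. ennreal ((\<phi> \<tau>)\<^sup>2) \<partial>lborel)"
    unfolding weighted_energy_def
  proof (intro nn_integral_mono ennreal_leI power_mono)
    fix \<tau>
    let ?y = "1 + \<bar>\<tau>\<bar> / K"
    have y: "1 \<le> ?y" using K by simp
    have "?y powr \<beta> \<le> ?y powr real m" using y m by (intro powr_mono) auto
    also have "\<dots> = ?y ^ m" using y by (intro powr_realpow) auto
    finally have "?y powr \<beta> * cmod (fourier f \<tau>) \<le> ?y ^ m * (\<phi> \<tau> / ?y ^ m)"
      using f[of \<tau>] y by (intro mult_mono) auto
    also have "?y ^ m * (\<phi> \<tau> / ?y ^ m) = \<phi> \<tau>" using y by simp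
    finally show "?y powr \<beta> * cmod (fourier f \<tau>) \<le> \<phi> \<tau>" .
  qed simp
  also have "\<dots> = ennreal (LINT \<tau>|lborel. (\<phi> \<tau>)\<^sup>2)" using \<phi> by (intro nn_integral_eq_integral) auto
  also have "\<dots> \<le> ennreal D" using D by (rule ennreal_leI)
  finally show ?thesis .
qed

lemma integrable_decay_shift: 
  "integrable lborel (\<lambda>x::real. 1 / (1 + \<bar>x + a\<bar>)\<^sup>2)"
  "(LINT x|lborel. 1 / (1 + \<bar>x + a\<bar>)\<^sup>2) = (LINT x|lborel. 1 / (1 + \<bar>x\<bar>)\<^sup>2)"
  using lborel_integrable_real_affine[OF integrable_decay, of 1 a] 
    lborel_integral_real_affine[of 1 "\<lambda>x. 1 / (1 + \<bar>x\<bar>)\<^sup>2" a] by (simp_all add: add.commute)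

lemma integrable_decay_scale: 
  assumes "0 < K"
  shows "integrable lborel (\<lambda>x::real. 1 / (1 + \<bar>x\<bar> / K)\<^sup>2)"
    and "(LINT x|lborel. 1 / (1 + \<bar>x\<bar> / K)\<^sup>2) = K * (LINT x|lborel. 1 / (1 + \<bar>x\<bar>)\<^sup>2)"
  using lborel_integrable_real_affine[OF integrable_decay, of "1/K" 0] 
    lborel_integral_real_affine[of K "\<lambda>x. 1 / (1 + \<bar>x\<bar> / K)\<^sup>2" 0] assms by (simp_all add: abs_mult)

text \<open>Collects the properties that pass to products over coordinates: a pointwise envelope, a
  lower bound on the L1 norm and an upper bound on the energy.\<close>

definition wave_factor :: "real \<Rightarrow> real \<Rightarrow> (real \<Rightarrow> real) \<Rightarrow> real \<Rightarrow> real \<Rightarrow> (real \<Rightarrow> real) \<Rightarrow> bool" where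
  "wave_factor \<beta> K \<eta> A c f \<longleftrightarrow> integrable lborel f \<and> (\<forall>s. \<bar>f s\<bar> \<le> A * \<eta> s) \<and> 
     c \<le> (LINT s|lborel. \<bar>f s\<bar>) \<and> weighted_energy \<beta> K f \<le> ennreal A"

text \<open>The factor is a flat trigonometric polynomial times the cutoff, divided by the square
  root of K. Flatness makes it bounded with L1 norm of order one, while the same division makes its
  transform of size K^{-1/2}.\<close>

lemma trig_factor_exists:
  assumes r: "0 < r" and \<beta>: "\<beta> \<le> real m"
    and C: "0 \<le> C" "\<And>\<tau>. cmod (fourier (cosbump r (N + 2)) \<tau>) \<le> C / (1 + \<bar>\<tau>\<bar>) ^ (Suc m + 2)"
    and A: "2 \<le> A" "C * 2 ^ Suc m * (2 * pi) \<le> A" 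
       "(C * 2 ^ Suc m * (2 * pi))\<^sup>2 * (LINT x|lborel. 1 / (1 + \<bar>x\<bar>)\<^sup>2) \<le> A"
  shows "\<exists>g. wave_factor \<beta> (2 ^ n) (cosbump r N) A ((LINT s|lborel. cosbump r (N + 2) s) / 4) g \<and>
     (\<forall>\<tau>. cmod (fourier g \<tau>) \<le> A / sqrt (2 ^ n))"
proof -
  let ?\<chi> = "cosbump r (N + 2)"
  define K :: real where "K = 2 ^ n"
  define I where "I = (LINT s|lborel. ?\<chi> s)"
  define E where "E = C * 2 ^ Suc m * (2 * pi)"
  have K: "1 \<le> K" "0 < K" by (simp_all add: K_def)
  obtain z where z: "\<And>k. cmod (z k) \<le> 1" "\<And>s. (trig {..<2^n} z s)\<^sup>2 \<le> 2 * K"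
    "K / 2 * I \<le> (LINT s|lborel. (trig {..<2^n} z s)\<^sup>2 * ?\<chi> s)"
    using flat_trig_exists[OF cosbump_integrable[OF r] cosbump_nonneg[OF r], of n "N + 2"]
    unfolding K_def I_def by blast
  let ?u = "trig {..<2^n} z"
  define g where "g s = ?u s * ?\<chi> s / sqrt K" for s
  have \<chi>i: "integrable lborel ?\<chi>" by (rule cosbump_integrable[OF r])
  have gi: "integrable lborel g" unfolding g_def[abs_def] by (intro integrable_divide integrable_trig_mult \<chi>i)
  have u: "\<bar>?u s\<bar> \<le> 2 * sqrt K" for s
  proof -
    have "(?u s)\<^sup>2 \<le> (2 * sqrt K)\<^sup>2" using z(2)[of s] K by (simp add: power_mult_distrib)
    then show ?thesis using K by (metis abs_le_square_iff abs_of_nonneg mult_nonneg_nonneg real_sqrt_ge_zero less_imp_le zero_le_numeral)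
  qed
  have "\<bar>g s\<bar> \<le> A * cosbump r N s" for s
  proof -
    have "\<bar>?u s\<bar> / sqrt K * ?\<chi> s \<le> A * cosbump r N s"
      using u[of s] K A(1) cosbump_antimono[OF r, of N "N + 2" s] cosbump_nonneg[OF r]
      by (intro mult_mono) (auto simp: divide_le_eq intro: order_trans[OF _ mult_right_mono])
    then show ?thesis using K cosbump_nonneg[OF r, of "N+2" s] by (simp add: g_def abs_mult)
  qed
  moreover have "I / 4 \<le> (LINT s|lborel. \<bar>g s\<bar>)"
  proof -
    \<comment> \<open>A lower bound on the L1 norm from the L2 mass and the supremum: replacing one
      of the two factors of the square by its bound \<open>2 * sqrt K\<close> turns the weighted
      mass into a multiple of the L1 norm.\<close>
    have "K / 2 * I \<le> (LINT s|lborel. (2 * K) * \<bar>g s\<bar>)"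
    proof (rule order_trans[OF z(3)], rule Bochner_Integration.integral_mono')
      show "integrable lborel (\<lambda>s. 2 * K * \<bar>g s\<bar>)" using gi by simp
      fix s
      have "(?u s)\<^sup>2 * ?\<chi> s = \<bar>?u s\<bar> * (\<bar>?u s\<bar> * ?\<chi> s)" by (simp add: power2_eq_square)
      also have "\<dots> \<le> 2 * sqrt K * (\<bar>?u s\<bar> * ?\<chi> s)"
        using u[of s] cosbump_nonneg[OF r] by (intro mult_right_mono mult_nonneg_nonneg) auto
      also have "\<dots> = 2 * K * \<bar>g s\<bar>"
        using K cosbump_nonneg[OF r, of "N+2" s] by (simp add: g_def abs_mult real_div_sqrt field_simps)
      finally show "(?u s)\<^sup>2 * ?\<chi> s \<le> 2 * K * \<bar>g s\<bar>" .
    qed (use K in auto)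
    then show ?thesis using K by (simp add: field_simps)
  qed
  moreover have Fg: "cmod (fourier g \<tau>) \<le> E / sqrt K / (1 + \<bar>\<tau>\<bar> / K) ^ Suc m" for \<tau>
  proof -
    have "fourier g \<tau> = fourier (\<lambda>s. ?u s * ?\<chi> s) \<tau> / sqrt K"
      unfolding fourier_real g_def by (simp flip: integral_divide_zero)
    then have "cmod (fourier g \<tau>) = cmod (fourier (\<lambda>s. ?u s * ?\<chi> s) \<tau>) / sqrt K"
      using K by (simp only: norm_divide norm_of_real abs_of_nonneg real_sqrt_ge_zero less_imp_le)
    also have "\<dots> \<le> E / (1 + \<bar>\<tau>\<bar> / K) ^ Suc m / sqrt K"
      using fourier_trig_decay[OF \<chi>i C, where K = "2 ^ n" and \<tau> = \<tau> and z = z] z(1) K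
      unfolding E_def K_def by (intro divide_right_mono) simp_all
    finally show ?thesis by (simp only: divide_divide_eq_left mult.commute)
  qed
  moreover have "weighted_energy \<beta> K g \<le> ennreal A"
  proof (rule weighted_energy_le[OF K(2) \<beta>])
    \<comment> \<open>The profile has width of order K and squared height of order 1/K, so its
      energy does not depend on K. One power beyond m is held back to make it square
      integrable.\<close>
    let ?\<phi> = "\<lambda>\<tau>. E / sqrt K / (1 + \<bar>\<tau>\<bar> / K)"
    show "cmod (fourier g \<tau>) \<le> ?\<phi> \<tau> / (1 + \<bar>\<tau>\<bar> / K) ^ m" for \<tau>
      using Fg[of \<tau>] by simp
    have sq: "(?\<phi> \<tau>)\<^sup>2 = E\<^sup>2 / K * (1 / (1 + \<bar>\<tau>\<bar> / K)\<^sup>2)" for \<tau>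
      using K by (simp add: power_divide power_mult_distrib)
    show "integrable lborel (\<lambda>\<tau>. (?\<phi> \<tau>)\<^sup>2)"
      unfolding sq by (intro integrable_mult_right integrable_decay_scale K)
    show "(LINT \<tau>|lborel. (?\<phi> \<tau>)\<^sup>2) \<le> A"
      unfolding sq integral_mult_right_zero integrable_decay_scale(2)[OF K(2)] using A(3) K
      by (simp add: E_def)
  qed
  moreover have "cmod (fourier g \<tau>) \<le> A / sqrt K" for \<tau>
  proof -
    have "0 \<le> E" using C by (simp add: E_def)
    then have "E / sqrt K / (1 + \<bar>\<tau>\<bar> / K) ^ Suc m \<le> E / sqrt K / 1"
      using K by (intro divide_left_mono one_le_power) (auto intro!: mult_pos_pos zero_less_power add_pos_nonneg)
    also have "\<dots> \<le> A / sqrt K" using A(2) K by (simp add: E_def divide_right_mono)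
    finally show ?thesis using Fg[of \<tau>] by linarith
  qed
  ultimately show ?thesis using gi unfolding wave_factor_def K_def I_def by blast
qed

text \<open>Here the transform has height of order one and sits in windows of bounded width around K
  and -K, so the energy is again independent of K.\<close>

lemma osc_deriv_wave_factor:
  assumes r: "0 < r" and \<beta>: "\<beta> \<le> real m" and K: "0 < K" and \<kappa>: "\<kappa> \<in> {1, -\<i>}"
    and C: "0 \<le> C" "\<And>\<tau>. cmod (fourier (cosbump r (N + 2)) \<tau>) \<le> C / (1 + \<bar>\<tau>\<bar>) ^ (Suc m + 2)"
    and A: "1 + real (N + 2) * (pi / (2 * r)) \<le> A"
       "(C * 2 ^ Suc m)\<^sup>2 * (LINT x|lborel. 1 / (1 + \<bar>x\<bar>)\<^sup>2) \<le> A"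
    and c: "c \<le> (LINT s|lborel. \<bar>osc_deriv r N K \<kappa> s\<bar>)"
  shows "wave_factor \<beta> K (cosbump r N) A c (osc_deriv r N K \<kappa>)"
proof -
  let ?w = "osc_deriv r N K \<kappa>"
  define E where "E = C * 2 ^ Suc m"
  have "\<bar>?w s\<bar> \<le> A * cosbump r N s" for s
    using order_trans[OF abs_osc_deriv_le[OF r K \<kappa>] mult_right_mono[OF A(1) cosbump_nonneg[OF r]]] .
  moreover have "weighted_energy \<beta> (real K) ?w \<le> ennreal A"
  proof (rule weighted_energy_le[OF _ \<beta>])
    let ?a = "\<lambda>\<tau>. 1 / (1 + \<bar>\<tau> - real K\<bar>)\<^sup>2" and ?b = "\<lambda>\<tau>. 1 / (1 + \<bar>\<tau> + real K\<bar>)\<^sup>2"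
    let ?\<phi> = "\<lambda>\<tau>. E * ((?a \<tau> + ?b \<tau>) / 2)"
    show "cmod (fourier ?w \<tau>) \<le> ?\<phi> \<tau> / (1 + \<bar>\<tau>\<bar> / real K) ^ m" for \<tau>
      using fourier_osc_deriv_decay[OF r K \<kappa> C, of \<tau>] by (simp add: E_def)
    \<comment> \<open>A number in the unit interval is at least its square, so the energy of the
      profile is controlled by its integral.\<close>
    have gen: "((a + b) / 2)\<^sup>2 \<le> (a + b) / 2" if "0 \<le> a" "a \<le> 1" "0 \<le> b" "b \<le> 1" for a b :: real
      using that mult_left_le[of "(a + b) / 2" "(a + b) / 2"] by (simp add: power2_eq_square)
    have le: "(?\<phi> \<tau>)\<^sup>2 \<le> E\<^sup>2 * ((?a \<tau> + ?b \<tau>) / 2)" for \<tau>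
    proof -
      have ab: "0 \<le> ?a \<tau>" "?a \<tau> \<le> 1" "0 \<le> ?b \<tau>" "?b \<tau> \<le> 1" by (auto simp: divide_le_eq one_le_power)
      have "((?a \<tau> + ?b \<tau>) / 2)\<^sup>2 \<le> (?a \<tau> + ?b \<tau>) / 2"
        by (rule gen[OF ab])
      then show ?thesis by (simp only: power_mult_distrib mult_left_mono zero_le_power2)
    qed
    have ai: "integrable lborel ?a" "integrable lborel ?b" 
      using integrable_decay_shift(1)[of "- real K"] integrable_decay_shift(1)[of "real K"] by simp_all
    have int: "integrable lborel (\<lambda>\<tau>. E\<^sup>2 * ((?a \<tau> + ?b \<tau>) / 2))"
      by (intro integrable_mult_right integrable_divide Bochner_Integration.integrable_add ai)
    show int\<phi>: "integrable lborel (\<lambda>\<tau>. (?\<phi> \<tau>)\<^sup>2)"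
      by (rule Bochner_Integration.integrable_bound[OF int]) 
        (use le in \<open>auto intro!: AE_I2 order_trans[OF _ abs_ge_self] simp del: power_mult_distrib\<close>)
    have "(LINT \<tau>|lborel. (?\<phi> \<tau>)\<^sup>2) \<le> (LINT \<tau>|lborel. E\<^sup>2 * ((?a \<tau> + ?b \<tau>) / 2))"
      by (intro integral_mono int int\<phi> le)
    also have "\<dots> = E\<^sup>2 * (LINT x|lborel. 1 / (1 + \<bar>x\<bar>)\<^sup>2)"
      unfolding integral_mult_right_zero integral_divide_zero Bochner_Integration.integral_add[OF ai]
      using integrable_decay_shift(2)[of "- real K"] integrable_decay_shift(2)[of "real K"] by simp
    finally show "(LINT \<tau>|lborel. (?\<phi> \<tau>)\<^sup>2) \<le> A" using A(2) by (simp add: E_def)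
  qed (use K in auto)
  ultimately show ?thesis using osc_deriv_integrable[OF r K \<kappa>] c unfolding wave_factor_def by blast
qed

text \<open>Both directions are recorded because the normal of the half-space may have either sign
  in the distinguished coordinate; the vanishing integral answers the case where that component is
  zero.\<close>

definition half_line_primitive :: "(real \<Rightarrow> real) \<Rightarrow> (real \<Rightarrow> real) \<Rightarrow> bool" where
  "half_line_primitive h w \<longleftrightarrow> (\<forall>t. (LINT s|lborel. indicator {t..} s * w s) = - h t) \<and>
     (\<forall>t. (LINT s|lborel. indicator {..t} s * w s) = h t) \<and> (LINT s|lborel. w s) = 0"

text \<open>The order of the quantifiers matters: envelope and constants are fixed before the
  frequency 2^n.\<close>

lemma wave_factors_exist:
  assumes r: "0 < r" and \<beta>: "0 < \<beta>"
  shows "\<exists>\<eta> A c. 0 < A \<and> 0 < c \<and> integrable lborel \<eta> \<and> (\<forall>s. 0 \<le> \<eta> s \<and> \<eta> s \<le> 1) \<and> 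
    (\<forall>s. r < \<bar>s\<bar> \<longrightarrow> \<eta> s = 0) \<and> 0 < (LINT s|lborel. \<eta> s) \<and> weighted_energy \<beta> 1 \<eta> \<le> ennreal A \<and>
    (\<forall>n. \<exists>g h w H. wave_factor \<beta> (2 ^ n) \<eta> A c g \<and> (\<forall>\<tau>. cmod (fourier g \<tau>) \<le> A / sqrt (2 ^ n)) \<and>
       wave_factor \<beta> (2 ^ n) \<eta> A c w \<and> half_line_primitive h w \<and> 
       (\<forall>s. complex_of_real (h s) = (LINT t|lborel. iexp (t * s) * H t) / (2 * pi)) \<and>
       integrable lborel H \<and> (LINT t|lborel. cmod (H t)) \<le> A / 2 ^ n)"
proof -
  define m where "m = nat \<lceil>\<beta>\<rceil>"
  have m: "\<beta> \<le> real m" unfolding m_def by linarith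
  \<comment> \<open>A comfortable choice: no decay order used below exceeds m + 3, and the cosine
    powers \<open>2 * k\<close> and \<open>2 * k + 2\<close> provide more.\<close>
  define k where "k = m + 3"
  define N where "N = 2 * k"
  have N2: "N + 2 = 2 * (k + 1)" by (simp add: N_def)
  obtain C1 where C1: "C1 > 0" "\<And>\<tau>. cmod (fourier (cosbump r N) \<tau>) \<le> C1 / (1 + \<bar>\<tau>\<bar>) ^ N"
    using fourier_cosbump_decay[OF r, of k] unfolding N_def by blast
  obtain C2 where C2: "C2 > 0" "\<And>\<tau>. cmod (fourier (cosbump r (N + 2)) \<tau>) \<le> C2 / (1 + \<bar>\<tau>\<bar>) ^ (N + 2)"
    using fourier_cosbump_decay[OF r, of "k + 1"] unfolding N2 by blast
  have weaken: "C / (1 + \<bar>\<tau>\<bar>) ^ i \<le> C / (1 + \<bar>\<tau>\<bar>) ^ j" if "0 < C" "j \<le> i" for C \<tau> :: real and i j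
    using that by (intro divide_left_mono power_increasing mult_pos_pos) auto
  have C1': "cmod (fourier (cosbump r N) \<tau>) \<le> C1 / (1 + \<bar>\<tau>\<bar>) ^ Suc m" for \<tau>
    by (rule order_trans[OF C1(2) weaken[OF C1(1)]]) (simp add: N_def k_def)
  have C2': "cmod (fourier (cosbump r (N + 2)) \<tau>) \<le> C2 / (1 + \<bar>\<tau>\<bar>) ^ (Suc m + 2)" for \<tau>
    by (rule order_trans[OF C2(2) weaken[OF C2(1)]]) (simp add: N_def k_def)
  have C2'': "cmod (fourier (cosbump r (N + 2)) \<tau>) \<le> C2 / (1 + \<bar>\<tau>\<bar>)\<^sup>2" for \<tau>
    by (rule order_trans[OF C2(2) weaken[OF C2(1)]]) simp
  have Fint: "integrable lborel (fourier (cosbump r (N + 2)))" by (rule fourier_cosbump_integrable[OF C2''])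
  define I0 where "I0 = (LINT x|lborel. 1 / (1 + \<bar>x::real\<bar>)\<^sup>2)"
  define E where "E = C2 * 2 ^ Suc m * (2 * pi)"
  define L where "L = (LINT t|lborel. cmod (fourier (cosbump r (N + 2)) t))"
  \<comment> \<open>The sum of all nonnegative bounds that occur, so that each of them is at most
    \<open>A\<close>.\<close>
  define A where "A = 2 + E + E\<^sup>2 * I0 + (1 + real (N + 2) * (pi / (2 * r))) + C1\<^sup>2 * I0 + L"
  define I where "I = (LINT s|lborel. cosbump r (N + 2) s)"
  have I0: "0 \<le> I0" unfolding I0_def by (rule Bochner_Integration.integral_nonneg) simp
  have E: "0 \<le> E" using C2 by (simp add: E_def)
  have L: "0 \<le> L" unfolding L_def by (rule Bochner_Integration.integral_nonneg) simp
  have I: "0 < I" unfolding I_def by (rule cosbump_integral_pos[OF r])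
  have nn: "0 \<le> E\<^sup>2 * I0" "0 \<le> C1\<^sup>2 * I0" "0 \<le> real (N + 2) * (pi / (2 * r))" using I0 r by auto
  have A: "2 \<le> A" "E \<le> A" "E\<^sup>2 * I0 \<le> A" "1 + real (N + 2) * (pi / (2 * r)) \<le> A" "C1\<^sup>2 * I0 \<le> A" "L \<le> A"
    using nn E L unfolding A_def by linarith+
  have A2: "(C2 * 2 ^ Suc m)\<^sup>2 * I0 \<le> A"
  proof -
    have "C2 * 2 ^ Suc m * 1 \<le> C2 * 2 ^ Suc m * (2 * pi)" using C2(1) pi_ge_two by (intro mult_left_mono) auto
    then have "(C2 * 2 ^ Suc m)\<^sup>2 \<le> E\<^sup>2" using C2(1) unfolding E_def by (intro power_mono) auto
    from mult_right_mono[OF this I0] show ?thesis using A(3) by linarith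
  qed
  have W: "weighted_energy \<beta> 1 (cosbump r N) \<le> ennreal A"
  proof (rule weighted_energy_le[OF _ m])
    show "cmod (fourier (cosbump r N) \<tau>) \<le> C1 / (1 + \<bar>\<tau>\<bar>) / (1 + \<bar>\<tau>\<bar> / 1) ^ m" for \<tau>
      using C1'[of \<tau>] by simp
    have sq: "(C1 / (1 + \<bar>\<tau>\<bar>))\<^sup>2 = C1\<^sup>2 * (1 / (1 + \<bar>\<tau>\<bar>)\<^sup>2)" for \<tau> by (simp add: power_divide)
    show "integrable lborel (\<lambda>\<tau>. (C1 / (1 + \<bar>\<tau>\<bar>))\<^sup>2)" unfolding sq by (intro integrable_mult_right integrable_decay)
    show "(LINT \<tau>|lborel. (C1 / (1 + \<bar>\<tau>\<bar>))\<^sup>2) \<le> A"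
      unfolding sq integral_mult_right_zero using A(5) by (simp add: I0_def)
  qed simp
  have main: "\<exists>g h w H. wave_factor \<beta> (2 ^ n) (cosbump r N) A (I / 4) g \<and> (\<forall>\<tau>. cmod (fourier g \<tau>) \<le> A / sqrt (2 ^ n)) \<and>
       wave_factor \<beta> (2 ^ n) (cosbump r N) A (I / 4) w \<and> half_line_primitive h w \<and> 
       (\<forall>s. complex_of_real (h s) = (LINT t|lborel. iexp (t * s) * H t) / (2 * pi)) \<and>
       integrable lborel H \<and> (LINT t|lborel. cmod (H t)) \<le> A / 2 ^ n" for n
  proof -
    define K :: nat where "K = 2 ^ n"
    have K: "0 < K" "real K = 2 ^ n" by (simp_all add: K_def)
    obtain g where g: "wave_factor \<beta> (2 ^ n) (cosbump r N) A (I / 4) g" "\<And>\<tau>. cmod (fourier g \<tau>) \<le> A / sqrt (2 ^ n)"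
      using trig_factor_exists[OF r m less_imp_le[OF C2(1)] C2' A(1), of n] A(2,3) 
      unfolding I_def I0_def E_def by blast
    obtain \<kappa> where \<kappa>: "\<kappa> \<in> {1, -\<i>}" "I / 2 \<le> (LINT s|lborel. \<bar>osc_deriv r N K \<kappa> s\<bar>)"
      using osc_deriv_L1[OF r K(1), of N] unfolding I_def by blast
    let ?w = "osc_deriv r N K \<kappa>" and ?h = "osc r N K \<kappa>"
    have c: "I / 4 \<le> (LINT s|lborel. \<bar>?w s\<bar>)" using \<kappa>(2) I by linarith
    have w: "wave_factor \<beta> (2 ^ n) (cosbump r N) A (I / 4) ?w"
      using osc_deriv_wave_factor[OF r m K(1) \<kappa>(1) less_imp_le[OF C2(1)] C2' A(4) _ c] A2 
      unfolding I0_def K(2) by blast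
    have FTC: "(LINT s|lborel. indicator {t..} s * ?w s) = - ?h t" "(LINT s|lborel. indicator {..t} s * ?w s) = ?h t" for t
      by (rule supported_primitive_FTC[OF r osc_eq_0[OF r] osc_deriv_outside osc_has_derivative[OF r _ K(1)] continuous_on_osc_deriv[OF r]]; simp)+
    \<comment> \<open>The total integral is the half-line integral from \<open>-r\<close>, where the
      primitive vanishes.\<close>
    have "(LINT s|lborel. ?w s) = (LINT s|lborel. indicator {-r..} s * ?w s)"
      using osc_deriv_outside[of r _ N K \<kappa>] by (intro Bochner_Integration.integral_cong) (auto simp: indicator_def)
    then have "half_line_primitive ?h ?w"
      unfolding half_line_primitive_def using FTC osc_eq_0[OF r, of "-r"] r by simp
    then show ?thesis
      using g w osc_inversion[OF r K(1) \<kappa>(1) Fint] A(6) unfolding L_def[symmetric] K(2)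
      by (intro exI[of _ g] exI[of _ ?h] exI[of _ ?w] exI[of _ "fourier ?h"] conjI allI)
        (auto intro: order_trans[OF _ divide_right_mono])
  qed
  show ?thesis
    using main A(1) I W cosbump_integrable[OF r] cosbump_nonneg[OF r] cosbump_le_one[OF r] cosbump_outside[of r] cosbump_integral_pos[OF r]
    by (intro exI[of _ "cosbump r N"] exI[of _ A] exI[of _ "I / 4"] conjI allI impI main) auto
qed

section \<open>Measures with densities\<close>

lemma sobolev_sq_cmult: 
  fixes f :: "'a::euclidean_space \<Rightarrow> real"
  assumes f [measurable]: "f \<in> borel_measurable borel"
  shows "sobolev_sq \<beta> (\<lambda>x. c * f x) = ennreal (c\<^sup>2) * sobolev_sq \<beta> f"
proof -
  have "fourier (\<lambda>x. c * f x) \<omega> = of_real c * fourier f \<omega>" for \<omega>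
    unfolding fourier_def by (simp add: mult.left_commute)
  then have "sobolev_sq \<beta> (\<lambda>x. c * f x) = (\<integral>\<^sup>+ \<omega>. ennreal (c\<^sup>2) * ennreal (norm \<omega> powr (2 * \<beta>) * (cmod (fourier f \<omega>))\<^sup>2) \<partial>lborel)"
    unfolding sobolev_sq_def by (simp add: norm_mult power_mult_distrib ennreal_mult[symmetric] mult.left_commute)
  also have "\<dots> = ennreal (c\<^sup>2) * sobolev_sq \<beta> f"
    unfolding sobolev_sq_def by (rule nn_integral_cmult) measurable
  finally show ?thesis .
qed

text \<open>Squaring costs a factor 2 compared with the triangle inequality. This is affordable,
  since twice the square of C/2 is only half of the square of C.\<close>

lemma sobolev_sq_add_le:
  fixes f g :: "'a::euclidean_space \<Rightarrow> real"
  assumes "integrable lborel f" "integrable lborel g"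
  shows "sobolev_sq \<beta> (\<lambda>x. f x + g x) \<le> 2 * sobolev_sq \<beta> f + 2 * sobolev_sq \<beta> g"
proof -
  have [measurable]: "f \<in> borel_measurable borel" "g \<in> borel_measurable borel" using assms by auto
  have add: "fourier (\<lambda>x. f x + g x) \<omega> = fourier f \<omega> + fourier g \<omega>" for \<omega>
    unfolding fourier_def of_real_add distrib_left
    by (intro Bochner_Integration.integral_add fourier_integrand_integrable assms)
  have par: "(cmod (a + b))\<^sup>2 \<le> 2 * (cmod a)\<^sup>2 + 2 * (cmod b)\<^sup>2" for a b :: complex
  proof -
    have "(cmod (a + b))\<^sup>2 \<le> (cmod a + cmod b)\<^sup>2" by (intro power_mono norm_triangle_ineq) auto
    also have "\<dots> \<le> 2 * (cmod a)\<^sup>2 + 2 * (cmod b)\<^sup>2"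
      using sum_squares_bound[of "cmod a" "cmod b"] by (simp add: power2_sum)
    finally show ?thesis .
  qed
  have "sobolev_sq \<beta> (\<lambda>x. f x + g x) \<le> (\<integral>\<^sup>+ \<omega>. 2 * ennreal (norm \<omega> powr (2 * \<beta>) * (cmod (fourier f \<omega>))\<^sup>2) + 
     2 * ennreal (norm \<omega> powr (2 * \<beta>) * (cmod (fourier g \<omega>))\<^sup>2) \<partial>lborel)"
    unfolding sobolev_sq_def add
  proof (rule nn_integral_mono)
    fix \<omega> :: 'a
    let ?p = "norm \<omega> powr (2 * \<beta>)"
    have "ennreal (?p * (cmod (fourier f \<omega> + fourier g \<omega>))\<^sup>2) \<le> ennreal (2 * (?p * (cmod (fourier f \<omega>))\<^sup>2) + 2 * (?p * (cmod (fourier g \<omega>))\<^sup>2))"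
      using mult_left_mono[OF par[of "fourier f \<omega>" "fourier g \<omega>"], of ?p] by (intro ennreal_leI) (simp add: algebra_simps)
    also have "\<dots> = 2 * ennreal (?p * (cmod (fourier f \<omega>))\<^sup>2) + 2 * ennreal (?p * (cmod (fourier g \<omega>))\<^sup>2)"
      by (simp add: ennreal_mult)
    finally show "ennreal (?p * (cmod (fourier f \<omega> + fourier g \<omega>))\<^sup>2) \<le> 2 * ennreal (?p * (cmod (fourier f \<omega>))\<^sup>2) + 2 * ennreal (?p * (cmod (fourier g \<omega>))\<^sup>2)" .
  qed
  also have "\<dots> = 2 * sobolev_sq \<beta> f + 2 * sobolev_sq \<beta> g"
    unfolding sobolev_sq_def by (subst nn_integral_add) (auto simp: nn_integral_cmult)
  finally show ?thesis .
qed

lemma sobolev_norm_less_iff: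
  assumes "0 < C"
  shows "sobolev_norm \<beta> f < ennreal C \<longleftrightarrow> sobolev_sq \<beta> f < ennreal (C\<^sup>2)"
proof (cases "sobolev_sq \<beta> f")
  case (real x)
  have "sqrt x < C \<longleftrightarrow> x < C\<^sup>2" 
    using real(1) assms by (metis less_imp_le real_less_lsqrt real_sqrt_less_iff real_sqrt_unique not_less_iff_gr_or_eq)
  then show ?thesis using real assms by (simp add: sobolev_norm_def ennreal_less_iff)
next
  case top
  then show ?thesis by (simp add: sobolev_norm_def)
qed

lemma density_in_smooth_densities:
  fixes \<rho> :: "'a::euclidean_space \<Rightarrow> real"
  assumes "integrable lborel \<rho>" "\<And>x. 0 \<le> \<rho> x" "(LINT x|lborel. \<rho> x) = 1"
    and "AE x in lborel. x \<notin> cball 0 1 \<longrightarrow> \<rho> x = 0" "integrable lborel (\<lambda>x. (\<rho> x)\<^sup>2)"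
    and "0 < C" "sobolev_sq \<beta> \<rho> < ennreal (C\<^sup>2)"
  shows "density lborel (\<lambda>x. ennreal (\<rho> x)) \<in> smooth_densities \<beta> C"
proof -
  have [measurable]: "\<rho> \<in> borel_measurable borel" using assms(1) by auto
  have "emeasure (density lborel (\<lambda>x. ennreal (\<rho> x))) UNIV = (\<integral>\<^sup>+x. ennreal (\<rho> x) \<partial>lborel)"
    by (simp add: emeasure_density)
  also have "\<dots> = 1" using assms(1-3) by (simp add: nn_integral_eq_integral)
  finally have "prob_space (density lborel (\<lambda>x. ennreal (\<rho> x)))" by (intro prob_spaceI) simp
  moreover have "AE x in density lborel (\<lambda>x. ennreal (\<rho> x)). x \<in> cball 0 1"
    using assms(4) by (subst AE_density) (auto elim!: eventually_mono)
  ultimately show ?thesis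
    unfolding smooth_densities_def using assms by (auto simp: sobolev_norm_less_iff intro!: exI[of _ \<rho>])
qed

lemma measure_density_diff:
  fixes \<rho> \<sigma> :: "'a::euclidean_space \<Rightarrow> real"
  assumes "integrable lborel \<rho>" "\<And>x. 0 \<le> \<rho> x" "integrable lborel \<sigma>" "\<And>x. 0 \<le> \<sigma> x" and A: "A \<in> sets borel"
  shows "measure (density lborel (\<lambda>x. ennreal (\<rho> x))) A - measure (density lborel (\<lambda>x. ennreal (\<sigma> x))) A =
    (LINT x|lborel. indicator A x * (\<rho> x - \<sigma> x))"
proof -
  have *: "measure (density lborel (\<lambda>x. ennreal (\<rho> x))) A = (LINT x|lborel. indicator A x * \<rho> x)"
    "integrable lborel (\<lambda>x. indicator A x * \<rho> x)"
    if \<rho>: "integrable lborel \<rho>" "\<And>x. 0 \<le> \<rho> x" for \<rho> :: "'a \<Rightarrow> real"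
  proof -
    have [measurable]: "\<rho> \<in> borel_measurable borel" using \<rho> by auto
    show i: "integrable lborel (\<lambda>x. indicator A x * \<rho> x)"
      using A by (intro Bochner_Integration.integrable_bound[OF \<rho>(1)]) (auto simp: indicator_def)
    have "emeasure (density lborel (\<lambda>x. ennreal (\<rho> x))) A = (\<integral>\<^sup>+x. ennreal (indicator A x * \<rho> x) \<partial>lborel)"
      using A by (subst emeasure_density) (auto intro!: nn_integral_cong simp: indicator_def)
    also have "\<dots> = ennreal (LINT x|lborel. indicator A x * \<rho> x)"
      using i \<rho> by (intro nn_integral_eq_integral) auto
    finally show "measure (density lborel (\<lambda>x. ennreal (\<rho> x))) A = (LINT x|lborel. indicator A x * \<rho> x)"
      using \<rho> by (simp add: measure_def Bochner_Integration.integral_nonneg)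
  qed
  show ?thesis using *[OF assms(1,2)] *[OF assms(3,4)] by (simp add: right_diff_distrib)
qed

text \<open>Since f has integral zero, the set where it is positive carries exactly half of its L1
  norm and serves as test set for the lower bound.\<close>

lemma TV_density_bounds:
  fixes \<rho> \<sigma> f :: "'a::euclidean_space \<Rightarrow> real"
  assumes \<rho>: "integrable lborel \<rho>" "\<And>x. 0 \<le> \<rho> x" and \<sigma>: "integrable lborel \<sigma>" "\<And>x. 0 \<le> \<sigma> x"
    and f: "\<And>x. \<rho> x - \<sigma> x = f x" "(LINT x|lborel. f x) = 0"
  shows "TV (density lborel (\<lambda>x. ennreal (\<rho> x))) (density lborel (\<lambda>x. ennreal (\<sigma> x))) \<le> (LINT x|lborel. \<bar>f x\<bar>)"
    and "(LINT x|lborel. \<bar>f x\<bar>) / 2 \<le> TV (density lborel (\<lambda>x. ennreal (\<rho> x))) (density lborel (\<lambda>x. ennreal (\<sigma> x)))"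
proof -
  let ?D = "\<lambda>A. measure (density lborel (\<lambda>x. ennreal (\<rho> x))) A - measure (density lborel (\<lambda>x. ennreal (\<sigma> x))) A"
  have fi: "integrable lborel f" using Bochner_Integration.integrable_diff[OF \<rho>(1) \<sigma>(1)] by (simp add: f)
  have [measurable]: "f \<in> borel_measurable borel" using fi by auto
  have D: "?D A = (LINT x|lborel. indicator A x * f x)" if "A \<in> sets borel" for A
    using measure_density_diff[OF \<rho> \<sigma> that] by (simp add: f)
  have le: "?D A \<le> (LINT x|lborel. \<bar>f x\<bar>)" if "A \<in> sets borel" for A
    unfolding D[OF that] using fi 
    by (intro Bochner_Integration.integral_mono') (auto simp: indicator_def)
  show "TV (density lborel (\<lambda>x. ennreal (\<rho> x))) (density lborel (\<lambda>x. ennreal (\<sigma> x))) \<le> (LINT x|lborel. \<bar>f x\<bar>)"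
    unfolding TV_def by (intro cSUP_least le) auto
  let ?P = "{x. 0 < f x}"
  have P: "?P \<in> sets borel" by measurable
  have ii: "integrable lborel (\<lambda>x. indicator ?P x * f x)"
    using fi P by (intro Bochner_Integration.integrable_bound[OF fi]) (auto simp: indicator_def)
  have "(LINT x|lborel. \<bar>f x\<bar>) = (LINT x|lborel. 2 * (indicator ?P x * f x) - f x)"
    by (intro Bochner_Integration.integral_cong) (auto simp: indicator_def)
  also have "\<dots> = 2 * ?D ?P" unfolding D[OF P] using ii fi f(2) by (simp del: f(1))
  finally have "(LINT x|lborel. \<bar>f x\<bar>) / 2 = ?D ?P" by simp
  also have "\<dots> \<le> TV (density lborel (\<lambda>x. ennreal (\<rho> x))) (density lborel (\<lambda>x. ennreal (\<sigma> x)))"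
    unfolding TV_def by (intro cSUP_upper P bdd_aboveI2[OF le])
  finally show "(LINT x|lborel. \<bar>f x\<bar>) / 2 \<le> TV (density lborel (\<lambda>x. ennreal (\<rho> x))) (density lborel (\<lambda>x. ennreal (\<sigma> x)))" .
qed

lemma perceptron_disc_density_le:
  fixes \<rho> \<sigma> f :: "'a::euclidean_space \<Rightarrow> real"
  assumes \<rho>: "integrable lborel \<rho>" "\<And>x. 0 \<le> \<rho> x" and \<sigma>: "integrable lborel \<sigma>" "\<And>x. 0 \<le> \<sigma> x"
    and f: "\<And>x. \<rho> x - \<sigma> x = f x" "\<And>v t. (LINT x|lborel. indicator {x. x \<bullet> v \<ge> t} x * f x) \<le> B"
  shows "perceptron_disc (density lborel (\<lambda>x. ennreal (\<rho> x))) (density lborel (\<lambda>x. ennreal (\<sigma> x))) \<le> B"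
proof -
  have "{x :: 'a. x \<bullet> v \<ge> t} \<in> sets borel" for v t
    by (intro borel_closed closed_Collect_le continuous_intros)
  then show ?thesis
    unfolding perceptron_disc_def using f measure_density_diff[OF \<rho> \<sigma>]
    by (intro cSUP_least) (auto simp: f)
qed

section \<open>The perturbation and the construction\<close>

text \<open>One full power of the frequency comes from the primitive and half a power from each of
  the other d - 1 coordinates, in total (d + 1)/2.\<close>

lemma divide_mult_divide_sqrt_power:
  fixes x :: real
  assumes "0 < x" "0 < d"
  shows "A / x * (A / sqrt x) ^ (d - 1) = A ^ d * x powr (- (real d + 1) / 2)"
proof -
  obtain k where k: "d = Suc k" using assms(2) by (cases d) auto
  have "1 / sqrt x = x powr (- (1/2))" using assms(1) by (simp add: powr_minus powr_half_sqrt inverse_eq_divide)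
  then have e1: "(1 / sqrt x) ^ k = x powr (- (1/2) * real k)" using assms(1) by (simp only: powr_power) simp
  have e2: "1 / x = x powr (- 1)" using assms(1) by (simp add: powr_minus inverse_eq_divide)
  have "1 / x * (1 / sqrt x) ^ k = x powr (- (real d + 1) / 2)"
  proof -
    have "- 1 + - (1/2) * real k = - (real d + 1) / 2" by (simp add: k add_divide_distrib)
    then show ?thesis by (simp only: e1 e2 powr_add[symmetric])
  qed
  moreover have "A / x * (A / sqrt x) ^ k = A * A ^ k * (1 / x * (1 / sqrt x) ^ k)" by (simp add: power_divide)
  ultimately show ?thesis by (simp add: k)
qed

text \<open>The bump \<open>q\<close> is the normalised product of the envelopes. The perturbation
  uses the differentiated wave in one coordinate and the flat polynomial in all others; its integral
  vanishes because of that one coordinate.\<close>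

lemma perturbations_exist:
  assumes \<beta>: "0 < \<beta>"
  shows "\<exists>(q :: 'a::euclidean_space \<Rightarrow> real) A c. 0 < A \<and> 0 < c \<and> integrable lborel q \<and> (\<forall>x. 0 \<le> q x) \<and> 
    (LINT x|lborel. q x) = 1 \<and> (\<forall>x. 1 < norm x \<longrightarrow> q x = 0) \<and> integrable lborel (\<lambda>x. (q x)\<^sup>2) \<and> sobolev_sq \<beta> q < \<infinity> \<and>
    (\<forall>n. \<exists>f. integrable lborel f \<and> (\<forall>x. \<bar>f x\<bar> \<le> A * q x) \<and> (LINT x|lborel. f x) = 0 \<and> c \<le> (LINT x|lborel. \<bar>f x\<bar>) \<and>
       sobolev_sq \<beta> f \<le> ennreal (A * (2 ^ n) powr (2 * \<beta>)) \<and> 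
       (\<forall>v t. \<bar>LINT x|lborel. indicator {x. x \<bullet> v \<ge> t} x * f x\<bar> \<le> A * (2 ^ n) powr (- (real DIM('a) + 1) / 2)))"
proof -
  define d where "d = DIM('a)"
  have d: "0 < d" by (simp add: d_def)
  \<comment> \<open>The half-width 1/d keeps the cube inside the unit ball, because the Euclidean
    norm is at most the sum of the d absolute coordinates.\<close>
  obtain \<eta> A c where Ac: "0 < A" "0 < c" and \<eta>: "integrable lborel \<eta>" "\<And>s. 0 \<le> \<eta> s" "\<And>s. \<eta> s \<le> 1"
    "\<And>s. 1 / real d < \<bar>s\<bar> \<Longrightarrow> \<eta> s = 0" "0 < (LINT s|lborel. \<eta> s)" "weighted_energy \<beta> 1 \<eta> \<le> ennreal A"
    and main: "\<And>n. \<exists>g h w H. wave_factor \<beta> (2 ^ n) \<eta> A c g \<and> (\<forall>\<tau>. cmod (fourier g \<tau>) \<le> A / sqrt (2 ^ n)) \<and>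
       wave_factor \<beta> (2 ^ n) \<eta> A c w \<and> half_line_primitive h w \<and> 
       (\<forall>s. complex_of_real (h s) = (LINT t|lborel. iexp (t * s) * H t) / (2 * pi)) \<and>
       integrable lborel H \<and> (LINT t|lborel. cmod (H t)) \<le> A / 2 ^ n"
    using wave_factors_exist[of "1 / real d" \<beta>] d \<beta> by auto
  define Z where "Z = (LINT s|lborel. \<eta> s)"
  have Z: "0 < Z" using \<eta>(5) by (simp add: Z_def)
  have [measurable]: "\<eta> \<in> borel_measurable borel" using \<eta>(1) by auto
  define p where "p x = (\<Prod>b\<in>Basis. \<eta> (x \<bullet> b))" for x :: 'a
  define q where "q x = p x / Z ^ d" for x
  have p: "0 \<le> p x" "p x \<le> 1" for x unfolding p_def using \<eta>(2,3) by (auto intro: prod_nonneg prod_le_1)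
  have p_int: "integrable lborel p" "(LINT x|lborel. p x) = Z ^ d"
    unfolding p_def[abs_def] using integrable_lborel_prod[of "\<lambda>_. \<eta>"] integral_lborel_prod[of "\<lambda>_. \<eta>"] \<eta>(1)
    by (auto simp: Z_def d_def)
  have q_int: "integrable lborel q" "(LINT x|lborel. q x) = 1"
    unfolding q_def[abs_def] using p_int Z by auto
  have q0: "0 \<le> q x" for x using p Z by (simp add: q_def)
  have q_out: "q x = 0" if "1 < norm x" for x
  proof -
    have "\<exists>b\<in>Basis. 1 / real d < \<bar>x \<bullet> b\<bar>"
    proof (rule ccontr)
      assume "\<not> ?thesis"
      then have "(\<Sum>b\<in>Basis. \<bar>x \<bullet> b\<bar>) \<le> (\<Sum>b\<in>(Basis :: 'a set). 1 / real d)" by (intro sum_mono) force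
      also have "\<dots> = 1" using d by (simp add: d_def)
      finally show False using that norm_le_l1[of x] by linarith
    qed
    then show ?thesis using \<eta>(4) by (auto simp: q_def p_def)
  qed
  have q2: "integrable lborel (\<lambda>x. (q x)\<^sup>2)"
  proof (rule Bochner_Integration.integrable_bound)
    show "integrable lborel (\<lambda>x. q x / Z ^ d)" using q_int by simp
    have [measurable]: "q \<in> borel_measurable borel" using q_int by auto
    show "(\<lambda>x. (q x)\<^sup>2) \<in> borel_measurable lborel" by measurable
    have "q x * q x \<le> q x * (1 / Z ^ d)" for x
      using q0 p(2)[of x] Z by (intro mult_left_mono) (auto simp: q_def divide_right_mono)
    then show "AE x in lborel. norm ((q x)\<^sup>2) \<le> norm (q x / Z ^ d)"
      using q0 Z by (intro AE_I2) (simp add: power2_eq_square)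
  qed
  have p_sob: "sobolev_sq \<beta> p < \<infinity>"
  proof -
    have "sobolev_sq \<beta> p \<le> ennreal (1 powr (2 * \<beta>) * A ^ DIM('a))"
      unfolding p_def[abs_def] using \<eta>(1,6) Ac \<beta> 
      by (intro sobolev_sq_prod_le[of "\<lambda>_. \<eta>"]) (auto simp: weighted_energy_def)
    then show ?thesis by (rule order_le_less_trans) simp
  qed
  have "sobolev_sq \<beta> q = ennreal ((1 / Z ^ d)\<^sup>2) * sobolev_sq \<beta> p"
    using sobolev_sq_cmult[of p \<beta> "1 / Z ^ d"] p_int(1) by (auto simp: q_def[abs_def])
  then have q_sob: "sobolev_sq \<beta> q < \<infinity>" using p_sob by (simp add: ennreal_mult_less_top)
  \<comment> \<open>The first summand pays for the normalisation of the bump in the pointwise bound,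
    the second for the Sobolev and half-space bounds.\<close>
  define B where "B = A ^ d * Z ^ d + A ^ d"
  have B: "A ^ d * Z ^ d \<le> B" "A ^ d \<le> B" "0 < B" using Ac Z by (auto simp: B_def add_pos_pos)
  obtain e :: 'a where e: "e \<in> Basis" using nonempty_Basis by blast
  have "\<exists>f. integrable lborel f \<and> (\<forall>x. \<bar>f x\<bar> \<le> B * q x) \<and> (LINT x|lborel. f x) = 0 \<and> c ^ d \<le> (LINT x|lborel. \<bar>f x\<bar>) \<and>
       sobolev_sq \<beta> f \<le> ennreal (B * (2 ^ n) powr (2 * \<beta>)) \<and> 
       (\<forall>v t. \<bar>LINT x|lborel. indicator {x. x \<bullet> v \<ge> t} x * f x\<bar> \<le> B * (2 ^ n) powr (- (real DIM('a) + 1) / 2))" for n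
  proof -
    obtain g h w H where g: "wave_factor \<beta> (2 ^ n) \<eta> A c g" "\<And>\<tau>. cmod (fourier g \<tau>) \<le> A / sqrt (2 ^ n)"
      and w: "wave_factor \<beta> (2 ^ n) \<eta> A c w" and hw: "half_line_primitive h w"
      and H: "\<And>s. complex_of_real (h s) = (LINT t|lborel. iexp (t * s) * H t) / (2 * pi)"
         "integrable lborel H" "(LINT t|lborel. cmod (H t)) \<le> A / 2 ^ n"
      using main[of n] by blast
    define F where "F b = (if b = e then w else g)" for b
    have F: "integrable lborel (F b)" "\<bar>F b s\<bar> \<le> A * \<eta> s" "c \<le> (LINT s|lborel. \<bar>F b s\<bar>)" "weighted_energy \<beta> (2 ^ n) (F b) \<le> ennreal A" for b s
      using g(1) w by (auto simp: F_def wave_factor_def)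
    define f where "f x = (\<Prod>b\<in>Basis. F b (x \<bullet> b))" for x
    have "integrable lborel f" unfolding f_def[abs_def] by (intro integrable_lborel_prod F)
    moreover have "\<bar>f x\<bar> \<le> B * q x" for x
    proof -
      have "\<bar>f x\<bar> \<le> (\<Prod>b\<in>Basis. A * \<eta> (x \<bullet> b))" 
        unfolding f_def abs_prod by (intro prod_mono) (use F in auto)
      also have "\<dots> = A ^ d * p x" by (simp add: prod.distrib p_def d_def)
      also have "\<dots> = A ^ d * Z ^ d * q x" using Z by (simp add: q_def)
      also have "\<dots> \<le> B * q x" using B(1) q0 by (intro mult_right_mono) auto
      finally show ?thesis .
    qed
    moreover have "(LINT x|lborel. f x) = 0"
    proof -
      have "(LINT s|lborel. F e s) = 0" using hw by (simp add: F_def half_line_primitive_def)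
      then have "(\<Prod>b\<in>Basis. LINT s|lborel. F b s) = 0" using e by (intro prod_zero) auto
      then show ?thesis unfolding f_def integral_lborel_prod[OF F(1)] .
    qed
    moreover have "c ^ d \<le> (LINT x|lborel. \<bar>f x\<bar>)"
    proof -
      have "c ^ d = (\<Prod>b\<in>(Basis :: 'a set). c)" by (simp add: d_def)
      also have "\<dots> \<le> (\<Prod>b\<in>Basis. LINT s|lborel. \<bar>F b s\<bar>)" using Ac F by (intro prod_mono) auto
      also have "\<dots> = (LINT x|lborel. \<bar>f x\<bar>)"
        unfolding f_def abs_prod using F(1) by (subst integral_lborel_prod[of "\<lambda>b s. \<bar>F b s\<bar>"]) auto
      finally show ?thesis .
    qed
    moreover have "sobolev_sq \<beta> f \<le> ennreal (B * (2 ^ n) powr (2 * \<beta>))"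
    proof -
      have "sobolev_sq \<beta> f \<le> ennreal ((2 ^ n) powr (2 * \<beta>) * A ^ DIM('a))"
        unfolding f_def[abs_def] using F Ac \<beta> 
        by (intro sobolev_sq_prod_le) (auto simp: weighted_energy_def)
      also have "\<dots> \<le> ennreal (B * (2 ^ n) powr (2 * \<beta>))"
        using B(2) by (intro ennreal_leI) (simp add: mult.commute[of B] mult_left_mono flip: d_def)
      finally show ?thesis .
    qed
    moreover have "\<bar>LINT x|lborel. indicator {x. x \<bullet> v \<ge> t} x * f x\<bar> \<le> B * (2 ^ n) powr (- (real DIM('a) + 1) / 2)" for v t
    proof -
      have "\<bar>LINT x|lborel. indicator {x. x \<bullet> v \<ge> t} x * f x\<bar> \<le> (LINT t|lborel. cmod (H t)) * (\<Prod>b\<in>Basis - {e}. A / sqrt (2 ^ n))"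
        unfolding f_def using w hw g F(1)
        by (intro halfspace_integral_le[OF H(1,2) e]) (auto simp: F_def wave_factor_def half_line_primitive_def)
      also have "(\<Prod>b\<in>Basis - {e}. A / sqrt (2 ^ n)) = (A / sqrt (2 ^ n)) ^ (d - 1)"
        using e by (simp add: d_def)
      also have "(LINT t|lborel. cmod (H t)) * (A / sqrt (2 ^ n)) ^ (d - 1) \<le> A / 2 ^ n * (A / sqrt (2 ^ n)) ^ (d - 1)"
        using Ac by (intro mult_right_mono H(3)) auto
      also have "\<dots> = A ^ d * (2 ^ n) powr (- (real d + 1) / 2)" using d by (intro divide_mult_divide_sqrt_power) auto
      also have "\<dots> \<le> B * (2 ^ n) powr (- (real d + 1) / 2)" using B(2) by (intro mult_right_mono) auto
      finally show ?thesis by (simp add: d_def)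
    qed
    ultimately show ?thesis by blast
  qed
  then show ?thesis using B(3) Ac q_int q0 q_out q2 q_sob
    by (intro exI[of _ q] exI[of _ B] exI[of _ "c ^ d"]) auto
qed

text \<open>Rudin-Shapiro polynomials have lengths that are powers of two, so the ideal frequency is
  rounded down to such a power; this costs at most the factor \<open>2 powr \<beta>\<close>.\<close>

lemma dyadic_scale_exists:
  fixes \<beta> \<epsilon> :: real
  assumes \<beta>: "0 < \<beta>" and \<epsilon>: "0 < \<epsilon>" "\<epsilon> < 1"
  shows "\<exists>n. \<epsilon> \<le> (2 ^ n) powr (- \<beta>) \<and> (2 ^ n) powr (- \<beta>) \<le> 2 powr \<beta> * \<epsilon>"
proof -
  \<comment> \<open>The ideal frequency, at which \<open>X powr (- \<beta>)\<close> equals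
    \<epsilon>.\<close>
  define X where "X = \<epsilon> powr (- 1 / \<beta>)"
  have X: "1 \<le> X" using powr_mono2'[of "- 1 / \<beta>" \<epsilon> 1] \<beta> \<epsilon> by (simp add: X_def)
  have X\<beta>: "X powr (- \<beta>) = \<epsilon>" using \<beta> \<epsilon> by (simp add: X_def powr_powr)
  define n where "n = nat \<lfloor>log 2 X\<rfloor>"
  have l: "0 \<le> log 2 X" using X by simp
  have n: "real n \<le> log 2 X" "log 2 X \<le> real n + 1" using l unfolding n_def by linarith+
  have 1: "2 ^ n \<le> X"
    using n(1) X by (simp add: le_log_iff powr_realpow)
  have 2: "X \<le> 2 * 2 ^ n"
    using n(2) X by (simp add: log_le_iff powr_add powr_realpow)
  have "\<epsilon> \<le> (2 ^ n) powr (- \<beta>)"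
    unfolding X\<beta>[symmetric] using 1 X \<beta> by (intro powr_mono2') auto
  moreover have "(2 ^ n) powr (- \<beta>) \<le> 2 powr \<beta> * \<epsilon>"
  proof -
    have "(2 * 2 ^ n) powr (- \<beta>) \<le> \<epsilon>"
      unfolding X\<beta>[symmetric] using 2 X \<beta> by (intro powr_mono2') auto
    then have "2 powr \<beta> * (2 powr (- \<beta>) * (2 ^ n) powr (- \<beta>)) \<le> 2 powr \<beta> * \<epsilon>"
      by (intro mult_left_mono) (simp_all add: powr_mult)
    then show ?thesis by (simp add: powr_minus mult.assoc[symmetric])
  qed
  ultimately show ?thesis by blast
qed

text \<open>Only an orthonormal basis enters the argument, so it is carried out in any Euclidean
  space; the theorem is the instance \<open>real ^ 'n\<close>.\<close>

lemma proposition6_euclidean: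
  fixes \<beta> C :: real
  assumes \<beta>: "\<beta> > 0" and C: "C > 0"
    and ne: "(smooth_densities \<beta> (C / 2) :: 'a::euclidean_space measure set) \<noteq> {}"
  shows "\<exists>C1 :: real. C1 > 0 \<and>
    (\<forall>\<epsilon> \<in> {0<..<1}. \<exists>\<mu> \<in> smooth_densities \<beta> C. \<exists>\<nu> \<in> smooth_densities \<beta> C.
       TV \<mu> (\<nu> :: 'a measure) / \<epsilon> \<in> {1 / C1 <..< C1} \<and>
       perceptron_disc \<mu> \<nu>
         \<le> C1 * TV \<mu> \<nu> powr ((2 * \<beta> + real DIM('a) + 1) / (2 * \<beta>))
              * ln (3 + 1 / TV \<mu> \<nu>) ^ (DIM('a) - 1))"
proof -
  from ne obtain \<mu>0 :: "'a measure" where \<mu>0: "\<mu>0 \<in> smooth_densities \<beta> (C / 2)" by blast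
  then obtain p0 :: "'a \<Rightarrow> real" where p0 [measurable]: "p0 \<in> borel_measurable borel" and p0_nn: "\<And>x. 0 \<le> p0 x"
    and \<mu>0_eq: "\<mu>0 = density lborel (\<lambda>x. ennreal (p0 x))"
    and p0_sq: "integrable lborel (\<lambda>x. (p0 x)\<^sup>2)" and p0_norm: "sobolev_norm \<beta> p0 < ennreal (C / 2)"
    and prob: "prob_space \<mu>0" and ball: "AE x in \<mu>0. x \<in> cball 0 1"
    unfolding smooth_densities_def by blast
  have p0_sob: "sobolev_sq \<beta> p0 < ennreal ((C / 2)\<^sup>2)"
    using p0_norm C by (simp add: sobolev_norm_less_iff)
  have "(\<integral>\<^sup>+x. ennreal (p0 x) \<partial>lborel) = emeasure \<mu>0 (space \<mu>0)"
    by (simp add: \<mu>0_eq emeasure_density)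
  also have "\<dots> = 1" by (rule prob_space.emeasure_space_1[OF prob])
  finally have nn1: "(\<integral>\<^sup>+x. ennreal (p0 x) \<partial>lborel) = 1" .
  have p0_int: "integrable lborel p0" using nn1 p0_nn by (intro integrableI_nonneg) auto
  have p0_1: "(LINT x|lborel. p0 x) = 1" using nn1 p0_nn by (subst integral_eq_nn_integral) auto
  have p0_ball: "AE x in lborel. x \<notin> cball 0 1 \<longrightarrow> p0 x = 0"
    using ball p0_nn unfolding \<mu>0_eq by (subst (asm) AE_density) (auto elim!: eventually_mono simp: less_le)
  obtain q :: "'a \<Rightarrow> real" and A c where Ac: "0 < A" "0 < c"
    and q: "integrable lborel q" "\<And>x. 0 \<le> q x" "(LINT x|lborel. q x) = 1" "\<And>x. 1 < norm x \<Longrightarrow> q x = 0" 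
      "integrable lborel (\<lambda>x. (q x)\<^sup>2)" "sobolev_sq \<beta> q < \<infinity>"
    and pert: "\<And>n. \<exists>f. integrable lborel f \<and> (\<forall>x. \<bar>f x\<bar> \<le> A * q x) \<and> (LINT x|lborel. f x) = 0 \<and> c \<le> (LINT x|lborel. \<bar>f x\<bar>) \<and>
       sobolev_sq \<beta> f \<le> ennreal (A * (2 ^ n) powr (2 * \<beta>)) \<and> 
       (\<forall>v t. \<bar>LINT x|lborel. indicator {x. x \<bullet> v \<ge> t} x * f x\<bar> \<le> A * (2 ^ n) powr (- (real DIM('a) + 1) / 2))"
    using perturbations_exist[OF \<beta>, where 'a='a] by auto
  have [measurable]: "q \<in> borel_measurable borel" using q(1) by auto
  obtain Q where Q: "0 \<le> Q" "sobolev_sq \<beta> q = ennreal Q"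
    using q(6) by (cases "sobolev_sq \<beta> q") auto
  \<comment> \<open>The Sobolev budget: the given density contributes at most twice the square of
    C/2, bump and perturbation at most four times C^2/32 each. The total is 3/4 of C^2.\<close>
  define s where "s = C / sqrt (32 * (Q + A + 1))"
  have s: "0 < s" "s\<^sup>2 * Q \<le> C\<^sup>2 / 32" "s\<^sup>2 * A \<le> C\<^sup>2 / 32"
  proof -
    have s2: "s\<^sup>2 * (Q + A + 1) = C\<^sup>2 / 32" using Q Ac by (simp add: s_def power_divide field_simps)
    show "0 < s" using C Q Ac by (simp add: s_def)
    have "s\<^sup>2 * Q \<le> s\<^sup>2 * (Q + A + 1)" "s\<^sup>2 * A \<le> s\<^sup>2 * (Q + A + 1)" using Q Ac by (auto intro!: mult_left_mono)
    then show "s\<^sup>2 * Q \<le> C\<^sup>2 / 32" "s\<^sup>2 * A \<le> C\<^sup>2 / 32" unfolding s2 .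
  qed
  \<comment> \<open>\<open>t\<close> is the weight of the bump in the mixture and \<open>c1\<close>
    the largest amplitude. The bound by \<open>s\<close> respects the Sobolev budget;
    \<open>c1 * A \<le> t\<close> keeps the perturbation below the bump, so the density stays
    nonnegative.\<close>
  define t where "t = min 1 s"
  define c1 where "c1 = min s (t / A)"
  have t: "0 < t" "t \<le> 1" "t \<le> s" using s by (auto simp: t_def)
  have c1: "0 < c1" "c1 \<le> s" "c1 * A \<le> t" using s t Ac by (auto simp: c1_def min_def field_simps)
  have t2: "t\<^sup>2 * Q \<le> C\<^sup>2 / 32"
    using order_trans[OF mult_right_mono[OF power_mono[of t s 2]] s(2)] t Q by auto
  have c12: "c1\<^sup>2 * A \<le> C\<^sup>2 / 32"
    using order_trans[OF mult_right_mono[OF power_mono[of c1 s 2]] s(3)] c1 Ac by auto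
  define \<rho> where "\<rho> \<delta> f x = (1 - t) * p0 x + (t * q x + \<delta> * f x)" for \<delta> and f :: "'a \<Rightarrow> real" and x
  have member: "integrable lborel (\<rho> \<delta> f)" "\<And>x. 0 \<le> \<rho> \<delta> f x" 
       "density lborel (\<lambda>x. ennreal (\<rho> \<delta> f x)) \<in> smooth_densities \<beta> C"
    if f: "integrable lborel f" "\<And>x. \<bar>f x\<bar> \<le> A * q x" "(LINT x|lborel. f x) = 0" 
      and S: "ennreal (\<delta>\<^sup>2) * sobolev_sq \<beta> f \<le> ennreal (C\<^sup>2 / 32)" and \<delta>: "0 \<le> \<delta>" "\<delta> \<le> c1" for \<delta> f
  proof -
    have [measurable]: "f \<in> borel_measurable borel" using f(1) by auto
    have dom: "\<bar>\<delta> * f x\<bar> \<le> t * q x" for x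
    proof -
      have "\<delta> * \<bar>f x\<bar> \<le> c1 * (A * q x)" using \<delta> c1 f(2) by (intro mult_mono) auto
      also have "\<dots> \<le> t * q x" using c1(3) q(2)[of x] by (simp add: mult.assoc[symmetric] mult_right_mono)
      finally show ?thesis using \<delta> by (simp add: abs_mult)
    qed
    have rint: "integrable lborel (\<lambda>x. t * q x + \<delta> * f x)" using q f by simp
    show int: "integrable lborel (\<rho> \<delta> f)" unfolding \<rho>_def[abs_def] using rint p0_int by simp
    show nn: "0 \<le> \<rho> \<delta> f x" for x
    proof -
      have "0 \<le> t * q x + \<delta> * f x" using dom[of x] by (simp add: abs_le_iff)
      then show ?thesis using t p0_nn[of x] by (simp add: \<rho>_def)
    qed
    have one: "(LINT x|lborel. \<rho> \<delta> f x) = 1"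
      unfolding \<rho>_def using rint p0_int q f p0_1 by simp
    have out: "AE x in lborel. x \<notin> cball 0 1 \<longrightarrow> \<rho> \<delta> f x = 0"
      using p0_ball
    proof eventually_elim
      case (elim x)
      show ?case
      proof
        assume x: "x \<notin> cball 0 1"
        then have "q x = 0" using q(4) by simp
        then show "\<rho> \<delta> f x = 0" using elim x f(2)[of x] by (simp add: \<rho>_def)
      qed
    qed
    have le: "(\<rho> \<delta> f x)\<^sup>2 \<le> 2 * (p0 x)\<^sup>2 + 8 * (q x)\<^sup>2" for x
    proof -
      have "\<rho> \<delta> f x \<le> p0 x + 2 * q x"
      proof -
        have "0 \<le> t * p0 x" using t p0_nn by simp
        moreover have "t * q x \<le> q x" using t q(2)[of x] by (simp add: mult_left_le_one_le)
        moreover have "\<delta> * f x \<le> t * q x" using dom[of x] by (simp add: abs_le_iff)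
        ultimately show ?thesis unfolding \<rho>_def left_diff_distrib by linarith
      qed
      then have "(\<rho> \<delta> f x)\<^sup>2 \<le> (p0 x + 2 * q x)\<^sup>2" using nn by (intro power_mono)
      also have "\<dots> \<le> 2 * (p0 x)\<^sup>2 + 8 * (q x)\<^sup>2"
        using sum_squares_bound[of "p0 x" "2 * q x"] by (simp add: power2_sum)
      finally show ?thesis .
    qed
    have sq: "integrable lborel (\<lambda>x. (\<rho> \<delta> f x)\<^sup>2)"
    proof (rule Bochner_Integration.integrable_bound)
      show "integrable lborel (\<lambda>x. 2 * (p0 x)\<^sup>2 + 8 * (q x)\<^sup>2)" using p0_sq q(5) by simp
      show "(\<lambda>x. (\<rho> \<delta> f x)\<^sup>2) \<in> borel_measurable lborel" unfolding \<rho>_def[abs_def] by measurable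
    qed (use le in \<open>auto intro!: AE_I2\<close>)
    have "sobolev_sq \<beta> (\<rho> \<delta> f) \<le> 2 * sobolev_sq \<beta> (\<lambda>x. (1 - t) * p0 x) + 2 * sobolev_sq \<beta> (\<lambda>x. t * q x + \<delta> * f x)"
      unfolding \<rho>_def[abs_def] using p0_int rint by (intro sobolev_sq_add_le) auto
    also have "\<dots> \<le> 2 * sobolev_sq \<beta> (\<lambda>x. (1 - t) * p0 x) + 2 * (2 * sobolev_sq \<beta> (\<lambda>x. t * q x) + 2 * sobolev_sq \<beta> (\<lambda>x. \<delta> * f x))"
      using q f by (intro add_left_mono mult_left_mono sobolev_sq_add_le) auto
    also have "\<dots> = 2 * (ennreal ((1 - t)\<^sup>2) * sobolev_sq \<beta> p0) + 2 * (2 * (ennreal (t\<^sup>2) * ennreal Q) + 2 * (ennreal (\<delta>\<^sup>2) * sobolev_sq \<beta> f))"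
      by (simp add: sobolev_sq_cmult Q(2))
    also have "\<dots> \<le> 2 * (1 * ennreal ((C / 2)\<^sup>2)) + 2 * (2 * ennreal (C\<^sup>2 / 32) + 2 * ennreal (C\<^sup>2 / 32))"
    proof (intro add_mono mult_left_mono S)
      have "(1 - t)\<^sup>2 \<le> 1" using t by (simp add: power_le_one)
      then show "ennreal ((1 - t)\<^sup>2) * sobolev_sq \<beta> p0 \<le> 1 * ennreal ((C / 2)\<^sup>2)"
        using p0_sob by (intro mult_mono) (auto simp: ennreal_le_1)
      show "ennreal (t\<^sup>2) * ennreal Q \<le> ennreal (C\<^sup>2 / 32)"
        using t2 Q by (simp add: ennreal_mult[symmetric] ennreal_leI)
    qed auto
    also have "\<dots> = ennreal (2 * (C / 2)\<^sup>2 + 2 * (2 * (C\<^sup>2 / 32) + 2 * (C\<^sup>2 / 32)))"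
    proof -
      have tw: "2 * ennreal x = ennreal (2 * x)" for x by (simp add: ennreal_mult')
      have pl: "ennreal x + ennreal y = ennreal (x + y)" if "0 \<le> x" "0 \<le> y" for x y using that by simp
      have "2 * (2 * ennreal (C\<^sup>2 / 32) + 2 * ennreal (C\<^sup>2 / 32)) = ennreal (2 * (2 * (C\<^sup>2 / 32) + 2 * (C\<^sup>2 / 32)))"
        unfolding tw by (subst pl) (simp_all only: tw, auto)
      then show ?thesis unfolding mult_1 tw by (subst pl[symmetric]) auto
    qed
    also have "\<dots> < ennreal (C\<^sup>2)"
      using C by (intro ennreal_lessI) (auto simp: power_divide)
    finally have "sobolev_sq \<beta> (\<rho> \<delta> f) < ennreal (C\<^sup>2)" .
    then show "density lborel (\<lambda>x. ennreal (\<rho> \<delta> f x)) \<in> smooth_densities \<beta> C"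
      by (intro density_in_smooth_densities int nn one out sq C)
  qed
  define d where "d = DIM('a)"
  \<comment> \<open>With this exponent, \<open>K powr (- \<beta>)\<close> raised to
    \<open>\<theta>\<close> is the half-space gain K^{-(d+1)/2}. \<open>B\<close> arises when the
    amplitude is expressed through the total variation; the next two terms of \<open>C1\<close>
    bound the ratio of total variation to \<epsilon> from below and from above.\<close>
  define \<theta> where "\<theta> = (real d + 1) / (2 * \<beta>)"
  define B where "B = A * (2 / c) * (2 / (c * c1)) powr \<theta>"
  define C1 where "C1 = B + 2 / (c1 * c) + c1 * A * 2 powr \<beta> + 1"
  have B: "0 \<le> B" using Ac by (simp add: B_def)
  have pos: "0 < 2 / (c1 * c)" "0 < c1 * A * 2 powr \<beta>" using c1 Ac by auto
  have C1: "0 < C1" "B \<le> C1" "2 / (c1 * c) < C1" "c1 * A * 2 powr \<beta> < C1"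
    using B pos unfolding C1_def by linarith+
  have "\<exists>\<mu> \<in> smooth_densities \<beta> C. \<exists>\<nu> \<in> smooth_densities \<beta> C.
       TV \<mu> (\<nu> :: 'a measure) / \<epsilon> \<in> {1 / C1 <..< C1} \<and>
       perceptron_disc \<mu> \<nu> \<le> C1 * TV \<mu> \<nu> powr ((2 * \<beta> + real DIM('a) + 1) / (2 * \<beta>)) * ln (3 + 1 / TV \<mu> \<nu>) ^ (DIM('a) - 1)"
    if \<epsilon>: "0 < \<epsilon>" "\<epsilon> < 1" for \<epsilon>
  proof -
    obtain n where n: "\<epsilon> \<le> (2 ^ n) powr (- \<beta>)" "(2 ^ n) powr (- \<beta>) \<le> 2 powr \<beta> * \<epsilon>"
      using dyadic_scale_exists[OF \<beta> \<epsilon>] by blast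
    define K :: real where "K = 2 ^ n"
    have K: "1 \<le> K" by (simp add: K_def)
    define \<delta> where "\<delta> = c1 * K powr (- \<beta>)"
    obtain f where f: "integrable lborel f" "\<And>x. \<bar>f x\<bar> \<le> A * q x" "(LINT x|lborel. f x) = 0" "c \<le> (LINT x|lborel. \<bar>f x\<bar>)"
       "sobolev_sq \<beta> f \<le> ennreal (A * K powr (2 * \<beta>))"
       "\<And>v t. \<bar>LINT x|lborel. indicator {x. x \<bullet> v \<ge> t} x * f x\<bar> \<le> A * K powr (- (real DIM('a) + 1) / 2)"
      using pert[of n] unfolding K_def by blast
    have K\<beta>: "0 < K powr (- \<beta>)" "K powr (- \<beta>) \<le> 1" using K \<beta> by (auto simp: powr_minus inverse_le_1_iff ge_one_powr_ge_zero)
    have \<delta>: "0 < \<delta>" "\<delta> \<le> c1" using K\<beta> c1 by (auto simp: \<delta>_def mult_le_cancel_left1)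
    have "ennreal (\<delta>\<^sup>2) * sobolev_sq \<beta> f \<le> ennreal (\<delta>\<^sup>2) * ennreal (A * K powr (2 * \<beta>))"
      by (intro mult_left_mono f) auto
    also have "\<dots> = ennreal (c1\<^sup>2 * A)"
    proof -
      have "(K powr (- \<beta>))\<^sup>2 * K powr (2 * \<beta>) = 1"
        using K by (simp add: power2_eq_square powr_add[symmetric])
      then have "\<delta>\<^sup>2 * (A * K powr (2 * \<beta>)) = c1\<^sup>2 * A"
        by (simp add: \<delta>_def power_mult_distrib mult.assoc mult.left_commute[of _ A])
      then show ?thesis using Ac by (simp add: ennreal_mult[symmetric])
    qed
    also have "\<dots> \<le> ennreal (C\<^sup>2 / 32)" by (rule ennreal_leI[OF c12])
    finally have S: "ennreal (\<delta>\<^sup>2) * sobolev_sq \<beta> f \<le> ennreal (C\<^sup>2 / 32)" .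
    note m1 = member[OF f(1-3) S less_imp_le[OF \<delta>(1)] \<delta>(2)]
    \<comment> \<open>Amplitude zero gives the unperturbed mixture, which is a member for the same
      reason.\<close>
    have m0: "integrable lborel (\<rho> 0 f)" "\<And>x. 0 \<le> \<rho> 0 f x" "density lborel (\<lambda>x. ennreal (\<rho> 0 f x)) \<in> smooth_densities \<beta> C"
      using c1 by (auto intro!: member f)
    define \<mu> where "\<mu> = density lborel (\<lambda>x. ennreal (\<rho> \<delta> f x))"
    define \<nu> where "\<nu> = density lborel (\<lambda>x. ennreal (\<rho> 0 f x))"
    define T where "T = TV \<mu> \<nu>"
    have diff: "\<rho> \<delta> f x - \<rho> 0 f x = \<delta> * f x" for x by (simp add: \<rho>_def)
    have L1: "(LINT x|lborel. \<bar>\<delta> * f x\<bar>) = \<delta> * (LINT x|lborel. \<bar>f x\<bar>)" using \<delta> by (simp add: abs_mult)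
    have L1_le: "(LINT x|lborel. \<bar>f x\<bar>) \<le> A"
    proof -
      have "(LINT x|lborel. \<bar>f x\<bar>) \<le> (LINT x|lborel. A * q x)" using f q by (intro integral_mono) auto
      then show ?thesis using q by simp
    qed
    have i0: "(LINT x|lborel. \<delta> * f x) = 0" using f by simp
    have "T \<le> \<delta> * (LINT x|lborel. \<bar>f x\<bar>)"
      using TV_density_bounds(1)[OF m1(1,2) m0(1,2) diff i0] unfolding T_def \<mu>_def \<nu>_def L1 .
    also have "\<dots> \<le> \<delta> * A" using L1_le \<delta> by (intro mult_left_mono) auto
    finally have T_le: "T \<le> \<delta> * A" .
    have "\<delta> * c / 2 \<le> \<delta> * (LINT x|lborel. \<bar>f x\<bar>) / 2" using f(4) \<delta> by (intro divide_right_mono mult_left_mono) auto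
    also have "\<dots> \<le> T" using TV_density_bounds(2)[OF m1(1,2) m0(1,2) diff i0] unfolding T_def \<mu>_def \<nu>_def L1 .
    finally have T_ge: "\<delta> * c / 2 \<le> T" .
    have T: "0 < T" using T_ge \<delta> Ac mult_pos_pos[OF \<delta>(1) Ac(2)] by linarith
    have "T / \<epsilon> < C1"
    proof -
      have "\<delta> * A \<le> c1 * (2 powr \<beta> * \<epsilon>) * A"
        unfolding \<delta>_def K_def using n(2) c1 Ac by (intro mult_right_mono mult_left_mono) auto
      then have "T / \<epsilon> \<le> c1 * A * 2 powr \<beta>" using T_le \<epsilon> by (simp add: divide_le_eq mult_ac)
      then show ?thesis using C1 by linarith
    qed
    moreover have "1 / C1 < T / \<epsilon>"
    proof -
      have "c1 * \<epsilon> * c / 2 \<le> \<delta> * c / 2"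
        unfolding \<delta>_def K_def using n(1) c1 Ac by (intro divide_right_mono mult_right_mono mult_left_mono) auto
      then have "c1 * c / 2 \<le> T / \<epsilon>" using T_ge \<epsilon> by (simp add: le_divide_eq mult_ac)
      moreover have "1 / C1 < c1 * c / 2" using C1(1,3) c1 Ac by (simp add: field_simps)
      ultimately show ?thesis by linarith
    qed
    moreover have "perceptron_disc \<mu> \<nu> \<le> C1 * T powr ((2 * \<beta> + real DIM('a) + 1) / (2 * \<beta>)) * ln (3 + 1 / T) ^ (DIM('a) - 1)"
    proof -
      have "(LINT x|lborel. indicator {x. x \<bullet> v \<ge> t} x * (\<delta> * f x)) \<le> \<delta> * (A * K powr (- (real d + 1) / 2))" for v t
      proof -
        have "(LINT x|lborel. indicator {x. x \<bullet> v \<ge> t} x * (\<delta> * f x)) = \<delta> * (LINT x|lborel. indicator {x. x \<bullet> v \<ge> t} x * f x)"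
          by (simp add: mult.left_commute)
        also have "\<dots> \<le> \<delta> * (A * K powr (- (real d + 1) / 2))"
          using f(6)[of t v] \<delta> unfolding d_def by (intro mult_left_mono) auto
        finally show ?thesis .
      qed
      then have "perceptron_disc \<mu> \<nu> \<le> \<delta> * (A * K powr (- (real d + 1) / 2))"
        unfolding \<mu>_def \<nu>_def by (intro perceptron_disc_density_le[OF m1(1,2) m0(1,2) diff])
      also have "K powr (- (real d + 1) / 2) = (\<delta> / c1) powr \<theta>"
      proof -
        have "- \<beta> * \<theta> = - (real d + 1) / 2" using \<beta> by (simp add: \<theta>_def field_simps)
        moreover have "(\<delta> / c1) powr \<theta> = K powr (- \<beta> * \<theta>)" using c1 by (simp add: \<delta>_def powr_powr)
        ultimately show ?thesis by (simp only:)
      qed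
      \<comment> \<open>The lower bound on the total variation enters here: the amplitude is at most
        \<open>2 * T / c\<close>, and the expression increases with the amplitude.\<close>
      also have "\<delta> * (A * (\<delta> / c1) powr \<theta>) \<le> (2 * T / c) * (A * (2 / (c * c1) * T) powr \<theta>)"
      proof -
        have "\<delta> \<le> 2 * T / c" using T_ge Ac by (simp add: field_simps)
        moreover have "\<delta> / c1 \<le> 2 / (c * c1) * T" using T_ge Ac c1 by (simp add: field_simps)
        ultimately show ?thesis using Ac c1 \<delta> \<beta> T by (intro mult_mono powr_mono2) (auto simp: \<theta>_def)
      qed
      also have "\<dots> = B * (T powr 1 * T powr \<theta>)"
        using T Ac c1 by (subst powr_mult) (auto simp: B_def)
      also have "T powr 1 * T powr \<theta> = T powr ((2 * \<beta> + real d + 1) / (2 * \<beta>))"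
        unfolding powr_add[symmetric] using \<beta> by (simp add: \<theta>_def add_divide_distrib add.assoc)
      also have "B * T powr ((2 * \<beta> + real d + 1) / (2 * \<beta>)) \<le> C1 * T powr ((2 * \<beta> + real d + 1) / (2 * \<beta>)) * 1"
        using C1 by (simp add: mult_right_mono)
      also have "\<dots> \<le> C1 * T powr ((2 * \<beta> + real d + 1) / (2 * \<beta>)) * ln (3 + 1 / T) ^ (d - 1)"
      proof (intro mult_left_mono one_le_power)
        have "exp 1 \<le> (3::real)" by (rule exp_le)
        then have "exp 1 \<le> 3 + 1 / T" using T by (smt (verit) divide_pos_pos)
        then show "1 \<le> ln (3 + 1 / T)" using T by (subst ln_ge_iff) (auto intro: add_pos_pos)
      qed (use C1 in auto)
      finally show ?thesis by (simp add: d_def)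
    qed
    ultimately show ?thesis using m1(3) m0(3) unfolding T_def \<mu>_def \<nu>_def by auto
  qed
  then show ?thesis using C1(1) by (intro exI[of _ C1]) auto
qed

theorem proposition6:
  fixes \<beta> C :: real
  assumes "\<beta> > 0" and "C > 0"
    and "(smooth_densities \<beta> (C / 2) :: (real ^ 'n) measure set) \<noteq> {}"
  shows "\<exists>C1 :: real. C1 > 0 \<and>
    (\<forall>\<epsilon> \<in> {0<..<1}. \<exists>\<mu> \<in> smooth_densities \<beta> C. \<exists>\<nu> \<in> smooth_densities \<beta> C.
       TV \<mu> (\<nu> :: (real ^ 'n) measure) / \<epsilon> \<in> {1 / C1 <..< C1} \<and>
       perceptron_disc \<mu> \<nu>
         \<le> C1 * TV \<mu> \<nu> powr ((2 * \<beta> + real CARD('n) + 1) / (2 * \<beta>))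
              * ln (3 + 1 / TV \<mu> \<nu>) ^ (CARD('n) - 1))"
  using proposition6_euclidean[OF assms] by simp

end
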